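(* Let $(\mathfrak{E},h)=(E,\Phi,h)$ be a hermitian Higgs bundle over a compact Kähler manifold $M$, with Hitchin-Simpson connection $\mathcal{D}_h = D_h+\Phi+\bar\Phi_h$. Let $\mathfrak{S}=(S,\Phi|_S)\subset\mathfrak{E}$ be a Higgs subbundle, let $h_S$ be the restriction of $h$ to $S$, and let $S^{\perp}$ be the orthogonal complement of $S$ with respect to $h$. For $\xi\in A^0(S)$ write $D_h\xi = D_{h,S}\xi + A_h\xi$ with $D_{h,S}\xi\in A^1(S)$ and $A_h\xi\in A^1(S^{\perp})$, and define $$\mathcal{D}_{h,S} = D_{h,S}+\Phi|_S+P_S\bar\Phi_h|_S,\qquad \mathcal{A}_h = A_h+P_{S^{\perp}}\bar\Phi_h|_S,$$ so that $\mathcal{D}_h\xi=\mathcal{D}_{h,S}\xi+\mathcal{A}_h\xi$ for all $\xi\in A^0(S)$. Then the operator $\mathcal{D}_{h,S}$ is the Hitchin-Simpson connection of $(\mathfrak{S},h_S)$, i.e. $\mathcal{D}_{h,S}=\mathcal{D}_{h_S}$, and $\mathcal{A}_h$ is a $1$-form with values in $\mathrm{Hom}(S,S^{\perp})$, i.e. $\mathcal{A}_h\in A^1(\mathrm{Hom}(S,S^{\perp}))$.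
   Context: $M$ is a compact Kähler manifold. $\Omega^{1,0}$ is its holomorphic cotangent bundle. For a $C^\infty$ complex vector bundle $V$ over $M$, $A^s(V)$ (resp. $A^{p,q}(V)$) is the space of $C^\infty$ complex $s$-forms (resp. $(p,q)$-forms) on $M$ with values in $V$. A Higgs bundle $\mathfrak{E}=(E,\Phi)$ over $M$ is a holomorphic vector bundle $E$ with a holomorphic $\Phi\in A^{1,0}(\mathrm{End}\,E)$ (the Higgs field) satisfying $\Phi\wedge\Phi=0$. A hermitian Higgs bundle $(\mathfrak{E},h)=(E,\Phi,h)$ is a Higgs bundle with a hermitian metric $h$ in $E$. $D_h=D'_h+d''$ is the Chern connection of $(E,h)$, and $\bar\Phi_h\in A^{0,1}(\mathrm{End}\,E)$ is the hermitian conjugate of $\Phi$ with respect to $h$, i.e. $h(\bar\Phi_h\xi,\eta)=h(\xi,\Phi\eta)$ for all sections $\xi,\eta$ of $E$. The Hitchin-Simpson connection of $(\mathfrak{E},h)$ is $\mathcal{D}_h=D_h+\Phi+\bar\Phi_h$. A Higgs subbundle $\mathfrak{S}\subset\mathfrak{E}$ is a holomorphic subbundle $S\subset E$ that is $\Phi$-invariant ($\Phi(S)\subset S\otimes\Omega^{1,0}$); then $\mathfrak{S}=(S,\Phi|_S)$ is itself a Higgs bundle, and its Hitchin-Simpson connection with respect to $h_S$ is $\mathcal{D}_{h_S}=D_{h_S}+\Phi|_S+\bar\Phi_{h_S}$, where $D_{h_S}$ is the Chern connection of $(S,h_S)$ and $\bar\Phi_{h_S}$ is the hermitian conjugate of $\Phi|_S$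 with respect to $h_S$. $S^{\perp}$ is a $C^\infty$ complex subbundle of $E$, not necessarily holomorphic. $P_S$ and $P_{S^{\perp}}$ are the orthogonal projections of $E=S\oplus S^{\perp}$ onto $S$ and $S^{\perp}$; $P_S\bar\Phi_h$ and $P_{S^{\perp}}\bar\Phi_h$ denote their compositions with $\bar\Phi_h$ (acting on the bundle factor). *)

theory Defs
  imports "HOL-Analysis.Analysis"
begin
primrec Ck_on ::
  "nat \<Rightarrow> 'a::real_normed_vector set \<Rightarrow> ('a \<Rightarrow> 'b::real_normed_vector) \<Rightarrow> bool" where
  "Ck_on 0 S f \<longleftrightarrow> continuous_on S f"
| "Ck_on (Suc k) S f \<longleftrightarrow> (\<forall>z\<in>S. f differentiable (at z)) \<and>
     (\<forall>v. Ck_on k S (\<lambda>z. frechet_derivative f (at z) v))"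

definition smooth_on ::
  "'a::real_normed_vector set \<Rightarrow> ('a \<Rightarrow> 'b::real_normed_vector) \<Rightarrow> bool" where
  "smooth_on S f \<longleftrightarrow> (\<forall>k. Ck_on k S f)"

text \<open>Holomorphic functions of several variables: smooth with complex linear differential
  (the Cauchy-Riemann equations).\<close>

definition hol_on :: "(complex^'n::finite) set \<Rightarrow> (complex^'n \<Rightarrow> complex) \<Rightarrow> bool" where
  "hol_on S f \<longleftrightarrow> smooth_on S f \<and>
     (\<forall>z\<in>S. \<forall>v. frechet_derivative f (at z) (\<i> *s v) = \<i> * frechet_derivative f (at z) v)"

text \<open>The manifold is the whole type \<open>'m\<close>, with a holomorphic atlas \<open>M\<close> of charts
  \<open>(U, \<phi>)\<close>; its complex dimension is \<open>CARD('n)\<close>.\<close>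

type_synonym ('m, 'n) chart = "'m set \<times> ('m \<Rightarrow> complex^'n)"
type_synonym ('m, 'n) atlas = "('m, 'n) chart set"

definition chart_inv :: "('m, 'n::finite) chart \<Rightarrow> complex^'n \<Rightarrow> 'm" where
  "chart_inv c = inv_into (fst c) (snd c)"

definition complex_manifold :: "('m::t2_space, 'n::finite) atlas \<Rightarrow> bool" where
  "complex_manifold M \<longleftrightarrow>
     (\<Union>c\<in>M. fst c) = UNIV \<and>
     (\<forall>c\<in>M. open (fst c) \<and> open (snd c ` fst c) \<and>
        homeomorphism (fst c) (snd c ` fst c) (snd c) (chart_inv c)) \<and>
     (\<forall>c\<in>M. \<forall>c'\<in>M. \<forall>k. hol_on (snd c ` (fst c \<inter> fst c')) (\<lambda>z. snd c' (chart_inv c z) $ k))"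

text \<open>A real tangent vector at \<open>x\<close> is the family of its coordinate vectors in all charts around
  \<open>x\<close>, related by the differentials of the coordinate changes (and \<open>0\<close> at the other charts).\<close>

type_synonym ('m, 'n) tangent = "('m, 'n) chart \<Rightarrow> complex^'n"

definition transition_deriv ::
  "('m, 'n::finite) chart \<Rightarrow> ('m, 'n) chart \<Rightarrow> 'm \<Rightarrow> complex^'n \<Rightarrow> complex^'n" where
  "transition_deriv c c' x = frechet_derivative (snd c' \<circ> chart_inv c) (at (snd c x))"

definition tangent_space :: "('m, 'n::finite) atlas \<Rightarrow> 'm \<Rightarrow> ('m, 'n) tangent set" where
  "tangent_space M x = {X.
     (\<forall>c\<in>M. \<forall>c'\<in>M. x \<in> fst c \<inter> fst c' \<longrightarrow> X c' = transition_deriv c c' x (X c)) \<and>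
     (\<forall>c. \<not> (c \<in> M \<and> x \<in> fst c) \<longrightarrow> X c = 0)}"

definition tadd :: "('m, 'n::finite) tangent \<Rightarrow> ('m, 'n) tangent \<Rightarrow> ('m, 'n) tangent" where
  "tadd X Y = (\<lambda>c. X c + Y c)"

definition tscale :: "real \<Rightarrow> ('m, 'n::finite) tangent \<Rightarrow> ('m, 'n) tangent" where
  "tscale a X = (\<lambda>c. a *\<^sub>R X c)"

definition tJ :: "('m, 'n::finite) tangent \<Rightarrow> ('m, 'n) tangent" where
  "tJ X = (\<lambda>c. \<i> *s X c)"

text \<open>The tangent vector at \<open>x\<close> with coordinate vector \<open>v\<close> in the chart \<open>c\<close>.\<close>

definition tvec ::
  "('m, 'n::finite) atlas \<Rightarrow> ('m, 'n) chart \<Rightarrow> 'm \<Rightarrow> complex^'n \<Rightarrow> ('m, 'n) tangent" where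
  "tvec M c x v = (\<lambda>c'. if c' \<in> M \<and> x \<in> fst c' then transition_deriv c c' x v else 0)"

text \<open>In the rest of the theory, a \<open>regularity\<close> parameter \<open>R\<close> is either \<^const>\<open>smooth_on\<close> or
  \<^const>\<open>hol_on\<close>; \<open>fun_on R M W f\<close> says that \<open>f\<close> has this regularity on the open set \<open>W\<close>.\<close>

type_synonym 'n regularity = "(complex^'n) set \<Rightarrow> (complex^'n \<Rightarrow> complex) \<Rightarrow> bool"

definition fun_on ::
  "'n::finite regularity \<Rightarrow> ('m, 'n) atlas \<Rightarrow> 'm set \<Rightarrow> ('m \<Rightarrow> complex) \<Rightarrow> bool" where
  "fun_on R M W f \<longleftrightarrow> (\<forall>c\<in>M. R (snd c ` (fst c \<inter> W)) (f \<circ> chart_inv c))"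

text \<open>The differential does not depend on the chart, by the chain rule.\<close>

definition differential ::
  "('m, 'n::finite) atlas \<Rightarrow> ('m \<Rightarrow> complex) \<Rightarrow> 'm \<Rightarrow> ('m, 'n) tangent \<Rightarrow> complex" where
  "differential M f x X =
     (let c = (SOME c. c \<in> M \<and> x \<in> fst c)
      in frechet_derivative (f \<circ> chart_inv c) (at (snd c x)) (X c))"

definition dbar ::
  "('m, 'n::finite) atlas \<Rightarrow> ('m \<Rightarrow> complex) \<Rightarrow> 'm \<Rightarrow> ('m, 'n) tangent \<Rightarrow> complex" where
  "dbar M f x X = (differential M f x X + \<i> * differential M f x (tJ X)) / 2"

definition closed_2form ::
  "('m, 'n::finite) atlas \<Rightarrow> ('m \<Rightarrow> ('m, 'n) tangent \<Rightarrow> ('m, 'n) tangent \<Rightarrow> real) \<Rightarrow> bool" where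
  "closed_2form M \<omega> \<longleftrightarrow> (\<forall>c\<in>M.
     let \<omega>\<^sub>c = (\<lambda>u v z. \<omega> (chart_inv c z) (tvec M c (chart_inv c z) u) (tvec M c (chart_inv c z) v))
     in \<forall>z \<in> snd c ` fst c. \<forall>u v w.
          frechet_derivative (\<omega>\<^sub>c v w) (at z) u
        - frechet_derivative (\<omega>\<^sub>c u w) (at z) v
        + frechet_derivative (\<omega>\<^sub>c u v) (at z) w = 0)"

text \<open>A Kaehler metric: a \<open>J\<close>-invariant Riemannian metric \<open>g\<close> whose fundamental form
  \<open>g(JX, Y)\<close> is closed.\<close>

definition kaehler_metric ::
  "('m, 'n::finite) atlas \<Rightarrow> ('m \<Rightarrow> ('m, 'n) tangent \<Rightarrow> ('m, 'n) tangent \<Rightarrow> real) \<Rightarrow> bool" where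
  "kaehler_metric M g \<longleftrightarrow>
     (\<forall>x. \<forall>X\<in>tangent_space M x. \<forall>Y\<in>tangent_space M x.
        g x X Y = g x Y X \<and>
        (\<forall>Z\<in>tangent_space M x. g x (tadd X Y) Z = g x X Z + g x Y Z) \<and>
        (\<forall>a. g x (tscale a X) Y = a * g x X Y) \<and>
        g x (tJ X) (tJ Y) = g x X Y) \<and>
     (\<forall>x. \<forall>X\<in>tangent_space M x. X \<noteq> (\<lambda>_. 0) \<longrightarrow> g x X X > 0) \<and>
     (\<forall>c\<in>M. \<forall>u v. smooth_on (snd c ` fst c)
        (\<lambda>z. g (chart_inv c z) (tvec M c (chart_inv c z) u) (tvec M c (chart_inv c z) v))) \<and>
     closed_2form M (\<lambda>x X Y. g x (tJ X) Y)"

definition compact_kaehler_manifold :: "('m::t2_space, 'n::finite) atlas \<Rightarrow> bool" where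
  "compact_kaehler_manifold M \<longleftrightarrow>
     compact (UNIV :: 'm set) \<and> complex_manifold M \<and> (\<exists>g. kaehler_metric M g)"

text \<open>All fibres of a bundle are subspaces of one ambient complex vector space \<open>'v\<close> with scalar
  multiplication \<open>vscale\<close>. The ambient space carries no topology and is no restriction (the
  fibres of any bundle embed into their direct sum); the smooth or holomorphic structure is given by
  the atlas \<open>frames\<close> of local frames \<open>(U, e)\<close>, where \<open>e 0, \<dots>, e (rank - 1)\<close> are the
  members of the frame.\<close>

record ('m, 'v) vbundle =
  vscale :: "complex \<Rightarrow> 'v \<Rightarrow> 'v"
  rank :: nat
  fibre :: "'m \<Rightarrow> 'v set"
  frames :: "('m set \<times> (nat \<Rightarrow> 'm \<Rightarrow> 'v)) set"

type_synonym ('m, 'v) bsection = "'m \<Rightarrow> 'v"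
type_synonym ('m, 'n, 'v) bform = "'m \<Rightarrow> ('m, 'n) tangent \<Rightarrow> 'v"
type_synonym ('m, 'n, 'v) hom_form = "'m \<Rightarrow> ('m, 'n) tangent \<Rightarrow> 'v \<Rightarrow> 'v"

definition basis_of ::
  "(complex \<Rightarrow> 'v \<Rightarrow> 'v::ab_group_add) \<Rightarrow> nat \<Rightarrow> 'v set \<Rightarrow> (nat \<Rightarrow> 'v) \<Rightarrow> bool" where
  "basis_of sc r F b \<longleftrightarrow> inj_on b {..<r} \<and>
     \<not> module.dependent sc (b ` {..<r}) \<and> module.span sc (b ` {..<r}) = F"

definition component ::
  "('m, 'v::ab_group_add) vbundle \<Rightarrow> (nat \<Rightarrow> 'm \<Rightarrow> 'v) \<Rightarrow> nat \<Rightarrow> 'm \<Rightarrow> 'v \<Rightarrow> complex" where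
  "component V e j x v =
     module.representation (vscale V) ((\<lambda>i. e i x) ` {..<rank V}) v (e j x)"

definition section_on ::
  "'n::finite regularity \<Rightarrow> ('m, 'n) atlas \<Rightarrow> ('m, 'v::ab_group_add) vbundle \<Rightarrow> 'm set \<Rightarrow>
    ('m, 'v) bsection \<Rightarrow> bool" where
  "section_on R M V W \<xi> \<longleftrightarrow> (\<forall>x\<in>W. \<xi> x \<in> fibre V x) \<and>
     (\<forall>(U, e) \<in> frames V. \<forall>j<rank V. fun_on R M (U \<inter> W) (\<lambda>x. component V e j x (\<xi> x)))"

definition vector_bundle ::
  "'n::finite regularity \<Rightarrow> ('m::t2_space, 'n) atlas \<Rightarrow> ('m, 'v::ab_group_add) vbundle \<Rightarrow> bool" where
  "vector_bundle R M V \<longleftrightarrow>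
     vector_space (vscale V) \<and>
     (\<Union>F\<in>frames V. fst F) = UNIV \<and>
     (\<forall>(U, e) \<in> frames V. open U \<and>
        (\<forall>x\<in>U. basis_of (vscale V) (rank V) (fibre V x) (\<lambda>j. e j x)) \<and>
        (\<forall>j<rank V. section_on R M V U (e j)))"

abbreviation "smooth_vector_bundle \<equiv> vector_bundle smooth_on"
abbreviation "holomorphic_vector_bundle \<equiv> vector_bundle hol_on"

text \<open>\<open>A0 M V\<close> and \<open>A1 M V\<close> are the spaces of global smooth sections and of smooth
  complex 1-forms with values in \<open>V\<close>. A 1-form is evaluated at real tangent vectors only, so it is a
  real linear map from the tangent space to the fibre; its values elsewhere are irrelevant, and
  \<open>form_eq\<close> is equality of forms.\<close>

definition A0 ::
  "('m, 'n::finite) atlas \<Rightarrow> ('m, 'v::ab_group_add) vbundle \<Rightarrow> ('m, 'v) bsection set" where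
  "A0 M V = {\<xi>. section_on smooth_on M V UNIV \<xi>}"

definition A1 ::
  "('m, 'n::finite) atlas \<Rightarrow> ('m, 'v::ab_group_add) vbundle \<Rightarrow> ('m, 'n, 'v) bform set" where
  "A1 M V = {\<omega>.
     (\<forall>x. \<forall>X\<in>tangent_space M x. \<omega> x X \<in> fibre V x \<and>
        (\<forall>Y\<in>tangent_space M x. \<omega> x (tadd X Y) = \<omega> x X + \<omega> x Y) \<and>
        (\<forall>a. \<omega> x (tscale a X) = vscale V (complex_of_real a) (\<omega> x X))) \<and>
     (\<forall>(U, e) \<in> frames V. \<forall>j<rank V. \<forall>c\<in>M. \<forall>u.
        smooth_on (snd c ` (fst c \<inter> U))
          ((\<lambda>x. component V e j x (\<omega> x (tvec M c x u))) \<circ> chart_inv c))}"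

definition form_eq ::
  "('m, 'n::finite) atlas \<Rightarrow> ('m, 'n, 'v) bform \<Rightarrow> ('m, 'n, 'v) bform \<Rightarrow> bool" where
  "form_eq M \<omega> \<omega>' \<longleftrightarrow> (\<forall>x. \<forall>X\<in>tangent_space M x. \<omega> x X = \<omega>' x X)"

definition part01 ::
  "('m, 'v::ab_group_add) vbundle \<Rightarrow> ('m, 'n::finite, 'v) bform \<Rightarrow> ('m, 'n, 'v) bform" where
  "part01 V \<omega> = (\<lambda>x X. vscale V (1 / 2) (\<omega> x X + vscale V \<i> (\<omega> x (tJ X))))"

text \<open>1-forms with values in \<open>Hom(V, W)\<close>, where \<open>V\<close> and \<open>W\<close> share the ambient space.
  For \<^const>\<open>smooth_on\<close> this is \<open>A\<^sup>1(Hom(V, W))\<close>. For a form of type (1,0) the functions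
  below are the matrix entries of its contractions with the constant holomorphic coordinate vector
  fields, so that \<^const>\<open>hol_on\<close> expresses that the form is holomorphic.\<close>

definition hom_forms ::
  "'n::finite regularity \<Rightarrow> ('m, 'n) atlas \<Rightarrow> ('m, 'v::ab_group_add) vbundle \<Rightarrow> ('m, 'v) vbundle \<Rightarrow>
    ('m, 'n, 'v) hom_form set" where
  "hom_forms R M V W = {\<alpha>.
     (\<forall>x. \<forall>X\<in>tangent_space M x. \<forall>v\<in>fibre V x.
        \<alpha> x X v \<in> fibre W x \<and>
        (\<forall>w\<in>fibre V x. \<alpha> x X (v + w) = \<alpha> x X v + \<alpha> x X w) \<and>
        (\<forall>a. \<alpha> x X (vscale V a v) = vscale W a (\<alpha> x X v)) \<and>
        (\<forall>Y\<in>tangent_space M x. \<alpha> x (tadd X Y) v = \<alpha> x X v + \<alpha> x Y v) \<and>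
        (\<forall>a. \<alpha> x (tscale a X) v = vscale W (complex_of_real a) (\<alpha> x X v))) \<and>
     (\<forall>(U, e) \<in> frames V. \<forall>(U', f) \<in> frames W. \<forall>j<rank V. \<forall>k<rank W. \<forall>c\<in>M. \<forall>u.
        R (snd c ` (fst c \<inter> U \<inter> U'))
          ((\<lambda>x. component W f k x (\<alpha> x (tvec M c x u) (e j x))) \<circ> chart_inv c))}"

definition A1_Hom ::
  "('m, 'n::finite) atlas \<Rightarrow> ('m, 'v::ab_group_add) vbundle \<Rightarrow> ('m, 'v) vbundle \<Rightarrow>
    ('m, 'n, 'v) hom_form set" where
  "A1_Hom M V W = hom_forms smooth_on M V W"

definition hermitian_metric ::
  "('m, 'n::finite) atlas \<Rightarrow> ('m, 'v::ab_group_add) vbundle \<Rightarrow> ('m \<Rightarrow> 'v \<Rightarrow> 'v \<Rightarrow> complex) \<Rightarrow> bool" where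
  "hermitian_metric M V h \<longleftrightarrow>
     (\<forall>x. \<forall>u\<in>fibre V x. \<forall>v\<in>fibre V x.
        h x v u = cnj (h x u v) \<and>
        (\<forall>w\<in>fibre V x. h x (u + v) w = h x u w + h x v w) \<and>
        (\<forall>a. h x (vscale V a u) v = a * h x u v)) \<and>
     (\<forall>x. \<forall>v\<in>fibre V x. v \<noteq> 0 \<longrightarrow> Re (h x v v) > 0) \<and>
     (\<forall>(U, e) \<in> frames V. \<forall>j<rank V. \<forall>k<rank V. fun_on smooth_on M U (\<lambda>x. h x (e j x) (e k x)))"

definition connection ::
  "('m, 'n::finite) atlas \<Rightarrow> ('m, 'v::ab_group_add) vbundle \<Rightarrow>
    (('m, 'v) bsection \<Rightarrow> ('m, 'n, 'v) bform) \<Rightarrow> bool" where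
  "connection M V D \<longleftrightarrow>
     (\<forall>\<xi>\<in>A0 M V. D \<xi> \<in> A1 M V) \<and>
     (\<forall>\<xi>\<in>A0 M V. \<forall>\<eta>\<in>A0 M V. form_eq M (D (\<lambda>x. \<xi> x + \<eta> x)) (\<lambda>x X. D \<xi> x X + D \<eta> x X)) \<and>
     (\<forall>f. \<forall>\<xi>\<in>A0 M V. fun_on smooth_on M UNIV f \<longrightarrow>
        form_eq M (D (\<lambda>x. vscale V (f x) (\<xi> x)))
          (\<lambda>x X. vscale V (differential M f x X) (\<xi> x) + vscale V (f x) (D \<xi> x X)))"

text \<open>The operator \<open>d''\<close> of a holomorphic vector bundle; it does not depend on the
  holomorphic frame \<open>e\<close> in which it is computed.\<close>

definition dbar_in_frame ::
  "('m, 'n::finite) atlas \<Rightarrow> ('m, 'v::ab_group_add) vbundle \<Rightarrow> (nat \<Rightarrow> 'm \<Rightarrow> 'v) \<Rightarrow>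
    ('m, 'v) bsection \<Rightarrow> ('m, 'n, 'v) bform" where
  "dbar_in_frame M V e \<xi> = (\<lambda>x X.
     \<Sum>j<rank V. vscale V (dbar M (\<lambda>y. component V e j y (\<xi> y)) x X) (e j x))"

definition chern_connection ::
  "('m, 'n::finite) atlas \<Rightarrow> ('m, 'v::ab_group_add) vbundle \<Rightarrow> ('m \<Rightarrow> 'v \<Rightarrow> 'v \<Rightarrow> complex) \<Rightarrow>
    (('m, 'v) bsection \<Rightarrow> ('m, 'n, 'v) bform) \<Rightarrow> bool" where
  "chern_connection M V h D \<longleftrightarrow>
     connection M V D \<and>
     (\<forall>\<xi>\<in>A0 M V. \<forall>\<eta>\<in>A0 M V. \<forall>x. \<forall>X\<in>tangent_space M x.
        differential M (\<lambda>y. h y (\<xi> y) (\<eta> y)) x X = h x (D \<xi> x X) (\<eta> x) + h x (\<xi> x) (D \<eta> x X)) \<and>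
     (\<forall>\<xi>\<in>A0 M V. \<forall>(U, e) \<in> frames V. \<forall>x\<in>U. \<forall>X\<in>tangent_space M x.
        part01 V (D \<xi>) x X = dbar_in_frame M V e \<xi> x X)"

definition higgs_bundle ::
  "('m::t2_space, 'n::finite) atlas \<Rightarrow> ('m, 'v::ab_group_add) vbundle \<Rightarrow>
    ('m, 'n, 'v) hom_form \<Rightarrow> bool" where
  "higgs_bundle M E \<Phi> \<longleftrightarrow>
     holomorphic_vector_bundle M E \<and>
     \<Phi> \<in> hom_forms hol_on M E E \<and>
     (\<forall>x. \<forall>X\<in>tangent_space M x. \<forall>v\<in>fibre E x. \<Phi> x (tJ X) v = vscale E \<i> (\<Phi> x X v)) \<and>
     (\<forall>x. \<forall>X\<in>tangent_space M x. \<forall>Y\<in>tangent_space M x. \<forall>v\<in>fibre E x.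
        \<Phi> x X (\<Phi> x Y v) - \<Phi> x Y (\<Phi> x X v) = 0)"

definition hermitian_higgs_bundle ::
  "('m::t2_space, 'n::finite) atlas \<Rightarrow> ('m, 'v::ab_group_add) vbundle \<Rightarrow>
    ('m, 'n, 'v) hom_form \<Rightarrow> ('m \<Rightarrow> 'v \<Rightarrow> 'v \<Rightarrow> complex) \<Rightarrow> bool" where
  "hermitian_higgs_bundle M E \<Phi> h \<longleftrightarrow> higgs_bundle M E \<Phi> \<and> hermitian_metric M E h"

text \<open>The hermitian conjugate of \<open>\<Phi>\<close>. At a real tangent vector \<open>X\<close> it is the adjoint of
  the endomorphism \<open>\<Phi>(X)\<close> of the fibre.\<close>

definition hermitian_conj ::
  "('m, 'v) vbundle \<Rightarrow> ('m \<Rightarrow> 'v \<Rightarrow> 'v \<Rightarrow> complex) \<Rightarrow>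
    ('m, 'n::finite, 'v) hom_form \<Rightarrow> ('m, 'n, 'v) hom_form" where
  "hermitian_conj E h \<Phi> = (\<lambda>x X v.
     THE w. w \<in> fibre E x \<and> (\<forall>u\<in>fibre E x. h x w u = h x v (\<Phi> x X u)))"

definition higgs_operator ::
  "('m, 'v::ab_group_add) vbundle \<Rightarrow> ('m, 'n::finite, 'v) hom_form \<Rightarrow>
    ('m \<Rightarrow> 'v \<Rightarrow> 'v \<Rightarrow> complex) \<Rightarrow> (('m, 'v) bsection \<Rightarrow> ('m, 'n, 'v) bform) \<Rightarrow>
    ('m, 'v) bsection \<Rightarrow> ('m, 'n, 'v) bform" where
  "higgs_operator E \<Phi> h D = (\<lambda>\<xi> x X.
     D \<xi> x X + \<Phi> x X (\<xi> x) + hermitian_conj E h \<Phi> x X (\<xi> x))"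

definition hitchin_simpson_connection ::
  "('m, 'n::finite) atlas \<Rightarrow> ('m, 'v::ab_group_add) vbundle \<Rightarrow> ('m, 'n, 'v) hom_form \<Rightarrow>
    ('m \<Rightarrow> 'v \<Rightarrow> 'v \<Rightarrow> complex) \<Rightarrow> (('m, 'v) bsection \<Rightarrow> ('m, 'n, 'v) bform) \<Rightarrow> bool" where
  "hitchin_simpson_connection M E \<Phi> h \<D> \<longleftrightarrow>
     (\<exists>D. chern_connection M E h D \<and>
        (\<forall>\<xi>\<in>A0 M E. form_eq M (\<D> \<xi>) (higgs_operator E \<Phi> h D \<xi>)))"

text \<open>A holomorphic subbundle is a holomorphic vector bundle whose fibres are subspaces of those of
  \<open>E\<close> and whose inclusion into \<open>E\<close> is holomorphic. The restrictions \<open>\<Phi>|\<^sub>S\<close> and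
  \<open>h\<^sub>S\<close> are represented by \<open>\<Phi>\<close> and \<open>h\<close> themselves, since all notions above
  only use their values on the fibres of the bundle at hand.\<close>

definition holomorphic_subbundle ::
  "('m::t2_space, 'n::finite) atlas \<Rightarrow> ('m, 'v::ab_group_add) vbundle \<Rightarrow> ('m, 'v) vbundle \<Rightarrow> bool" where
  "holomorphic_subbundle M S E \<longleftrightarrow>
     holomorphic_vector_bundle M S \<and> vscale S = vscale E \<and>
     (\<forall>x. fibre S x \<subseteq> fibre E x) \<and>
     (\<forall>(U, e) \<in> frames S. \<forall>j<rank S. section_on hol_on M E U (e j))"

definition higgs_subbundle ::
  "('m::t2_space, 'n::finite) atlas \<Rightarrow> ('m, 'v::ab_group_add) vbundle \<Rightarrow> ('m, 'v) vbundle \<Rightarrow>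
    ('m, 'n, 'v) hom_form \<Rightarrow> bool" where
  "higgs_subbundle M S E \<Phi> \<longleftrightarrow> holomorphic_subbundle M S E \<and>
     (\<forall>x. \<forall>X\<in>tangent_space M x. \<forall>v\<in>fibre S x. \<Phi> x X v \<in> fibre S x)"

text \<open>The orthogonal complement of \<open>S\<close> in \<open>E\<close>, with the smooth structure of a subbundle of
  \<open>E\<close>: its frames are all local frames consisting of smooth sections of \<open>E\<close>.\<close>

definition orth_fibre ::
  "('m, 'v) vbundle \<Rightarrow> ('m \<Rightarrow> 'v \<Rightarrow> 'v \<Rightarrow> complex) \<Rightarrow> ('m, 'v) vbundle \<Rightarrow> 'm \<Rightarrow> 'v set" where
  "orth_fibre E h S x = {v \<in> fibre E x. \<forall>s\<in>fibre S x. h x v s = 0}"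

definition orth_complement ::
  "('m::t2_space, 'n::finite) atlas \<Rightarrow> ('m, 'v::ab_group_add) vbundle \<Rightarrow>
    ('m \<Rightarrow> 'v \<Rightarrow> 'v \<Rightarrow> complex) \<Rightarrow> ('m, 'v) vbundle \<Rightarrow> ('m, 'v) vbundle" where
  "orth_complement M E h S =
     \<lparr>vscale = vscale E, rank = rank E - rank S, fibre = orth_fibre E h S,
      frames = {(U, f). open U \<and>
        (\<forall>x\<in>U. basis_of (vscale E) (rank E - rank S) (orth_fibre E h S x) (\<lambda>j. f j x)) \<and>
        (\<forall>j<rank E - rank S. section_on smooth_on M E U (f j))}\<rparr>"

text \<open>The projection onto \<open>V\<close> along \<open>W\<close>, meaningful when the fibres of \<open>V\<close> and
  \<open>W\<close> span a direct sum containing \<open>v\<close>.\<close>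

definition projection ::
  "('m, 'v::ab_group_add) vbundle \<Rightarrow> ('m, 'v) vbundle \<Rightarrow> 'm \<Rightarrow> 'v \<Rightarrow> 'v" where
  "projection V W x v = (THE w. w \<in> fibre V x \<and> v - w \<in> fibre W x)"

end

theory Submission
  imports Defs
begin

text \<open>
  The projections of \<open>E\<close> onto \<open>S\<close> and its orthogonal complement are complex linear on fibres and
  preserve smoothness. Hence the part \<open>P\<^sub>S D\<^sub>h\<close> of the Chern connection is a connection in \<open>S\<close>. It is
  compatible with the metric because the complementary part is orthogonal to \<open>S\<close>. A holomorphic
  frame of \<open>S\<close> has holomorphic components in \<open>E\<close>, so the (0,1)-part of \<open>D\<^sub>h \<xi>\<close> is computed by the
  Dolbeault operator of \<open>S\<close> and lies in \<open>S\<close> already. Thus \<open>P\<^sub>S D\<^sub>h\<close> is a Chern connection of \<open>S\<close>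
  (\<open>chern_connection_PS\<close>), and a Chern connection is unique (\<open>chern_connection_unique\<close>).
  Fibrewise, the adjoint of \<open>\<Phi>|\<^sub>S\<close> with respect to \<open>h\<^sub>S\<close> is the compression to \<open>S\<close> of the
  adjoint of \<open>\<Phi>\<close> (\<open>hermitian_conj_S\<close>). Together this identifies the Hitchin-Simpson connection of
  the subbundle.

  The second fundamental form is tensorial: differentiating \<open>h(\<xi>, \<eta>) = 0\<close> for sections \<open>\<xi>\<close> of \<open>S\<close>
  and \<open>\<eta>\<close> of the orthogonal complement gives \<open>h(D\<^sub>h \<xi>, \<eta>) = - h(\<xi>, D\<^sub>h \<eta>)\<close>, so that the component of
  \<open>D\<^sub>h \<xi>\<close> orthogonal to \<open>S\<close> depends on the value of \<open>\<xi>\<close> at the point only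
  (\<open>Pperp_D_tensorial\<close>, \<open>second_form_A1_Hom\<close>).

  Connections act on global sections. The pointwise statements therefore need enough
  global sections, which bump functions provide (\<open>bump_function\<close>, \<open>extend_section\<close>,
  \<open>extend_vector\<close>). All smoothness statements about projections and adjoints rest on one fact: the
  coefficients of a field in a smooth frame are smooth if its inner products with the members of the
  frame are (\<open>smooth_coefficients\<close>, \<open>smooth_field_subbundleI\<close>). Local frames of the orthogonal
  complement exist because linear independence is an open condition (\<open>indep_family_open\<close>,
  \<open>ex_orth_frame\<close>).
\<close>

section \<open>Smooth functions on open subsets of normed spaces\<close>

lemma Ck_on_cong:
  assumes "open S" "\<And>z. z \<in> S \<Longrightarrow> f z = g z" "Ck_on k S f"
  shows "Ck_on k S g"
  using assms(2,3)
proof (induction k arbitrary: f g)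
  case 0
  then show ?case by (simp cong: continuous_on_cong)
next
  case (Suc k)
  have fd: "(g has_derivative frechet_derivative f (at z)) (at z)" if z: "z \<in> S" for z
    using has_derivative_transform_within_open[OF _ assms(1) z Suc.prems(1)] Suc.prems(2) z
    by (simp add: frechet_derivative_works)
  have eq: "frechet_derivative g (at z) = frechet_derivative f (at z)" if "z \<in> S" for z
    using frechet_derivative_at[OF fd[OF that]] by simp
  have "Ck_on k S (\<lambda>z. frechet_derivative g (at z) v)" for v
    by (rule Suc.IH[of "\<lambda>z. frechet_derivative f (at z) v", rotated]) (use eq Suc.prems(2) in simp_all)
  then show ?case using fd by (auto simp: differentiable_def)
qed

lemma Ck_on_SucI:
  assumes "open S" "\<And>z. z \<in> S \<Longrightarrow> (f has_derivative f' z) (at z)" "\<And>v. Ck_on k S (\<lambda>z. f' z v)"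
  shows "Ck_on (Suc k) S f"
proof -
  have "frechet_derivative f (at z) = f' z" if "z \<in> S" for z
    using frechet_derivative_at[OF assms(2)[OF that]] by simp
  then have "Ck_on k S (\<lambda>z. frechet_derivative f (at z) v)" for v
    by (intro Ck_on_cong[OF assms(1) _ assms(3)[of v]]) auto
  then show ?thesis using assms(2) by (auto simp: differentiable_def)
qed

lemma Ck_on_SucD:
  "Ck_on (Suc k) S f \<Longrightarrow> z \<in> S \<Longrightarrow> (f has_derivative frechet_derivative f (at z)) (at z)"
  by (simp add: frechet_derivative_works)

lemma Ck_on_Suc_imp: "Ck_on (Suc k) S f \<Longrightarrow> Ck_on k S f"
proof (induction k arbitrary: f)
  case 0
  then show ?case
    by (auto intro!: continuous_at_imp_continuous_on differentiable_imp_continuous_within)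
next
  case (Suc k)
  then show ?case by (metis Ck_on.simps(2))
qed

lemma Ck_on_const: "open S \<Longrightarrow> Ck_on k S (\<lambda>z. c)"
proof (induction k arbitrary: c)
  case (Suc k)
  then show ?case by (intro Ck_on_SucI[where f' = "\<lambda>_ _. 0"]) auto
qed simp

lemma Ck_on_add:
  "open S \<Longrightarrow> Ck_on k S f \<Longrightarrow> Ck_on k S g \<Longrightarrow> Ck_on k S (\<lambda>z. f z + g z)"
proof (induction k arbitrary: f g)
  case (Suc k)
  show ?case
    by (rule Ck_on_SucI[where
          f' = "\<lambda>z v. frechet_derivative f (at z) v + frechet_derivative g (at z) v"])
      (use Suc in \<open>auto intro!: has_derivative_add simp: frechet_derivative_works\<close>)
qed (auto intro: continuous_on_add)

lemma Ck_on_bounded_linear: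
  "bounded_linear L \<Longrightarrow> open S \<Longrightarrow> Ck_on k S f \<Longrightarrow> Ck_on k S (\<lambda>z. L (f z))"
proof (induction k arbitrary: f)
  case (Suc k)
  show ?case
  proof (rule Ck_on_SucI[where f' = "\<lambda>z v. L (frechet_derivative f (at z) v)"])
    show "((\<lambda>z. L (f z)) has_derivative (\<lambda>v. L (frechet_derivative f (at z) v))) (at z)"
      if "z \<in> S" for z
      by (rule bounded_linear.has_derivative[OF Suc.prems(1) Ck_on_SucD[OF Suc.prems(3) that]])
  qed (use Suc in simp_all)
qed (simp add: bounded_linear.continuous_on)

lemma Ck_on_mult:
  fixes f g :: "'a::real_normed_vector \<Rightarrow> complex"
  shows "open S \<Longrightarrow> Ck_on k S f \<Longrightarrow> Ck_on k S g \<Longrightarrow> Ck_on k S (\<lambda>z. f z * g z)"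
proof (induction k arbitrary: f g)
  case (Suc k)
  note fg = Ck_on_Suc_imp[OF Suc.prems(2)] Ck_on_Suc_imp[OF Suc.prems(3)]
  show ?case
  proof (rule Ck_on_SucI[where
        f' = "\<lambda>z v. f z * frechet_derivative g (at z) v + frechet_derivative f (at z) v * g z"])
    fix z assume "z \<in> S"
    then show "((\<lambda>z. f z * g z) has_derivative
        (\<lambda>v. f z * frechet_derivative g (at z) v + frechet_derivative f (at z) v * g z)) (at z)"
      using Suc.prems by (intro has_derivative_mult) (auto simp: frechet_derivative_works)
  next
    fix v
    show "Ck_on k S (\<lambda>z. f z * frechet_derivative g (at z) v + frechet_derivative f (at z) v * g z)"
      using Suc.prems Suc.IH fg by (intro Ck_on_add) auto
  qed fact
qed (auto intro: continuous_on_mult)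

lemma Ck_on_inverse:
  fixes f :: "'a::real_normed_vector \<Rightarrow> complex"
  assumes "open S" "\<And>z. z \<in> S \<Longrightarrow> f z \<noteq> 0"
  shows "Ck_on k S f \<Longrightarrow> Ck_on k S (\<lambda>z. inverse (f z))"
proof (induction k)
  case (Suc k)
  note IH = Suc.IH[OF Ck_on_Suc_imp[OF Suc.prems]]
  show ?case
  proof (rule Ck_on_SucI[where
        f' = "\<lambda>z v. (-1) * (inverse (f z) * frechet_derivative f (at z) v * inverse (f z))"])
    fix z assume "z \<in> S"
    then show "((\<lambda>z. inverse (f z)) has_derivative
        (\<lambda>v. (-1) * (inverse (f z) * frechet_derivative f (at z) v * inverse (f z)))) (at z)"
      using Suc.prems assms(2) has_derivative_inverse[where f = f and x = z]
      by (auto simp: frechet_derivative_works)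
  next
    fix v
    show "Ck_on k S (\<lambda>z. (-1) * (inverse (f z) * frechet_derivative f (at z) v * inverse (f z)))"
      using Suc.prems IH assms(1) by (intro Ck_on_mult Ck_on_const) auto
  qed fact
qed (use assms in \<open>auto intro!: continuous_on_inverse\<close>)

lemma Ck_on_subset: "T \<subseteq> S \<Longrightarrow> Ck_on k S f \<Longrightarrow> Ck_on k T f"
  by (induction k arbitrary: f) (auto intro: continuous_on_subset)

lemma Ck_on_local:
  assumes "\<And>z. z \<in> S \<Longrightarrow> \<exists>T. open T \<and> z \<in> T \<and> Ck_on k T f"
  shows "Ck_on k S f"
  using assms
proof (induction k arbitrary: f)
  case 0
  then have "isCont f z" if "z \<in> S" for z
    using that continuous_on_eq_continuous_at by fastforce
  then show ?case by (simp add: continuous_at_imp_continuous_on)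
next
  case (Suc k)
  show ?case
    unfolding Ck_on.simps
  proof (intro conjI ballI allI)
    show "f differentiable at z" if "z \<in> S" for z
      using Suc.prems[OF that] by auto
    show "Ck_on k S (\<lambda>z. frechet_derivative f (at z) v)" for v
    proof (rule Suc.IH)
      fix z assume "z \<in> S"
      from Suc.prems[OF this]
      show "\<exists>T. open T \<and> z \<in> T \<and> Ck_on k T (\<lambda>z. frechet_derivative f (at z) v)" by auto
    qed
  qed
qed

lemma smooth_on_cong:
  "open S \<Longrightarrow> (\<And>z. z \<in> S \<Longrightarrow> f z = g z) \<Longrightarrow> smooth_on S f \<Longrightarrow> smooth_on S g"
  unfolding smooth_on_def using Ck_on_cong by blast

lemma smooth_on_local:
  assumes "\<And>z. z \<in> S \<Longrightarrow> \<exists>T. open T \<and> z \<in> T \<and> smooth_on T f"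
  shows "smooth_on S f"
  unfolding smooth_on_def
proof
  fix k show "Ck_on k S f"
    using assms unfolding smooth_on_def by (intro Ck_on_local) meson
qed

lemma smooth_on_differentiable: "smooth_on S f \<Longrightarrow> z \<in> S \<Longrightarrow> f differentiable (at z)"
  unfolding smooth_on_def by (metis Ck_on.simps(2))

text \<open>The functions \<open>t \<mapsto> p(1/t) exp(-1/t)\<close>, extended by \<open>0\<close> to \<open>t \<le> 0\<close>. This family is closed
  under differentiation, which makes its members smooth.\<close>

definition flat_fun :: "real poly \<Rightarrow> real \<Rightarrow> real" where
  "flat_fun p t = (if t > 0 then poly p (1 / t) * exp (- (1 / t)) else 0)"

lemma poly_times_exp_tendsto_0: "((\<lambda>t. poly (p::real poly) t * exp (- t)) \<longlongrightarrow> 0) at_top"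
proof -
  have "((\<lambda>t. \<Sum>i\<le>degree p. coeff p i * (t ^ i / exp t)) \<longlongrightarrow> (\<Sum>i\<le>degree p. coeff p i * 0)) at_top"
    by (intro tendsto_sum tendsto_mult tendsto_const tendsto_power_div_exp_0)
  then show ?thesis
    by (simp add: poly_altdef sum_distrib_right exp_minus divide_inverse mult.assoc)
qed

lemma flat_fun_has_real_derivative:
  "(flat_fun p has_real_derivative flat_fun ([:0, 0, 1:] * (p - pderiv p)) t) (at t)"
proof (cases "t > 0")
  case True
  have "((\<lambda>t. poly p (1 / t) * exp (- (1 / t))) has_real_derivative
      flat_fun ([:0, 0, 1:] * (p - pderiv p)) t) (at t)"
    using True
    by (auto intro!: derivative_eq_intros DERIV_chain2[OF poly_DERIV, of "\<lambda>t. 1 / t"]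
        simp: flat_fun_def field_simps power2_eq_square)
  moreover have "\<forall>\<^sub>F s in nhds t. flat_fun p s = poly p (1 / s) * exp (- (1 / s))"
    using eventually_nhds_in_open[of "{0<..}" t] True
    by (auto simp: flat_fun_def elim!: eventually_mono)
  ultimately show ?thesis by (subst DERIV_cong_ev[OF refl _ refl])
next
  case neg: False
  show ?thesis
  proof (cases "t = 0")
    case False
    have "((\<lambda>t. 0) has_real_derivative 0) (at t)" by simp
    moreover have "\<forall>\<^sub>F s in nhds t. flat_fun p s = 0"
      using eventually_nhds_in_open[of "{..<0}" t] neg False
      by (auto simp: flat_fun_def elim!: eventually_mono)
    ultimately have "(flat_fun p has_real_derivative 0) (at t)" by (subst DERIV_cong_ev[OF refl _ refl])
    then show ?thesis using neg by (simp add: flat_fun_def)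
  next
    case True
    have r: "((\<lambda>s. flat_fun p s / s) \<longlongrightarrow> 0) (at_right 0)"
    proof -
      have "((\<lambda>s. poly (pCons 0 p) (inverse s) * exp (- inverse s)) \<longlongrightarrow> 0) (at_right 0)"
        by (rule filterlim_compose[OF poly_times_exp_tendsto_0 filterlim_inverse_at_top_right])
      moreover have "\<forall>\<^sub>F s in at_right 0. poly (pCons 0 p) (inverse s) * exp (- inverse s)
          = flat_fun p s / s"
        by (rule eventually_at_right_less[THEN eventually_mono])
          (simp add: flat_fun_def divide_inverse)
      ultimately show ?thesis by (rule Lim_transform_eventually)
    qed
    have l: "((\<lambda>s. flat_fun p s / s) \<longlongrightarrow> 0) (at_left 0)"
      by (rule Lim_transform_eventually[OF tendsto_const])
        (auto simp: eventually_at_filter flat_fun_def)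
    have "((\<lambda>s. flat_fun p s / s) \<longlongrightarrow> 0) (at 0)" using l r by (rule filterlim_split_at)
    then show ?thesis using True by (simp add: has_field_derivative_iff flat_fun_def)
  qed
qed

lemma Ck_on_flat_fun:
  fixes f :: "'a::real_normed_vector \<Rightarrow> complex"
  assumes "open S"
  shows "Ck_on k S f \<Longrightarrow> Ck_on k S (\<lambda>z. complex_of_real (flat_fun p (Re (f z))))"
proof (induction k arbitrary: p)
  case 0
  have "continuous_on UNIV (flat_fun p)"
    using DERIV_isCont[OF flat_fun_has_real_derivative] continuous_at_imp_continuous_on by blast
  moreover have "continuous_on S (\<lambda>z. Re (f z))"
    using 0 by (simp add: continuous_on_Re)
  ultimately have "continuous_on S (\<lambda>z. flat_fun p (Re (f z)))"
    by (rule continuous_on_compose2) simp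
  then show ?case by (simp add: continuous_on_of_real)
next
  case (Suc k)
  let ?q = "[:0, 0, 1:] * (p - pderiv p)"
  show ?case
  proof (rule Ck_on_SucI[where f' = "\<lambda>z v. complex_of_real (flat_fun ?q (Re (f z))) *
        complex_of_real (Re (frechet_derivative f (at z) v))"])
    fix z assume "z \<in> S"
    then have "((\<lambda>z. Re (f z)) has_derivative (\<lambda>v. Re (frechet_derivative f (at z) v))) (at z)"
      using Suc.prems by (intro bounded_linear.has_derivative[OF bounded_linear_Re])
        (auto simp: frechet_derivative_works)
    from bounded_linear.has_derivative[OF bounded_linear_of_real has_derivative_compose[OF this
        flat_fun_has_real_derivative[unfolded has_field_derivative_def]]]
    show "((\<lambda>z. complex_of_real (flat_fun p (Re (f z)))) has_derivative
        (\<lambda>v. complex_of_real (flat_fun ?q (Re (f z))) *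
          complex_of_real (Re (frechet_derivative f (at z) v)))) (at z)"
      by (simp only: of_real_mult)
  next
    fix v
    have "Ck_on k S (\<lambda>z. frechet_derivative f (at z) v)" using Suc.prems by simp
    then have "Ck_on k S (\<lambda>z. complex_of_real (Re (frechet_derivative f (at z) v)))"
      by (rule Ck_on_bounded_linear[OF bounded_linear_compose[OF bounded_linear_of_real
            bounded_linear_Re] assms])
    then show "Ck_on k S (\<lambda>z. complex_of_real (flat_fun ?q (Re (f z))) *
        complex_of_real (Re (frechet_derivative f (at z) v)))"
      by (rule Ck_on_mult[OF assms Suc.IH[OF Ck_on_Suc_imp[OF Suc.prems]]])
  qed fact
qed

section \<open>Finite families of vectors and hermitian forms\<close>

text \<open>Linear combinations and linear independence of a finite family \<open>e 0, \<dots>, e (r - 1)\<close> in a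
  complex vector space. Only the values of \<open>e\<close> and of the coefficients below \<open>r\<close> matter, and an
  independent family has no repetitions.\<close>

definition lincomb :: "(complex \<Rightarrow> 'v \<Rightarrow> 'v::ab_group_add) \<Rightarrow> nat \<Rightarrow> (nat \<Rightarrow> complex) \<Rightarrow> (nat \<Rightarrow> 'v) \<Rightarrow> 'v" where
  "lincomb sc r a e = (\<Sum>j<r. sc (a j) (e j))"

definition indep_family :: "(complex \<Rightarrow> 'v \<Rightarrow> 'v::ab_group_add) \<Rightarrow> nat \<Rightarrow> (nat \<Rightarrow> 'v) \<Rightarrow> bool" where
  "indep_family sc r e \<longleftrightarrow> (\<forall>a. lincomb sc r a e = 0 \<longrightarrow> (\<forall>j<r. a j = 0))"

lemma indep_familyD: "indep_family sc r e \<Longrightarrow> lincomb sc r a e = 0 \<Longrightarrow> j < r \<Longrightarrow> a j = 0"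
  by (simp add: indep_family_def)

context
  fixes sc :: "complex \<Rightarrow> 'v::ab_group_add \<Rightarrow> 'v"
  assumes vs: "vector_space sc"
begin

interpretation vector_space sc by (rule vs)

lemma indep_family_iff:
  "indep_family sc r e \<longleftrightarrow> inj_on e {..<r} \<and> \<not> dependent (e ` {..<r})"
proof (intro iffI conjI)
  assume ind: "indep_family sc r e"
  show inj: "inj_on e {..<r}"
  proof (rule inj_onI, rule ccontr)
    fix i j assume ij: "i \<in> {..<r}" "j \<in> {..<r}" "e i = e j" "i \<noteq> j"
    let ?a = "\<lambda>k. if k = i then 1 else if k = j then -1 else (0::complex)"
    have "lincomb sc r ?a e = (\<Sum>k\<in>{i,j}. sc (?a k) (e k))"
      unfolding lincomb_def by (rule sum.mono_neutral_right) (use ij in auto)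
    also have "\<dots> = 0" using ij by simp
    finally have "?a i = 0" by (rule indep_familyD[OF ind]) (use ij in simp)
    then show False by simp
  qed
  show "\<not> dependent (e ` {..<r})"
  proof
    assume "dependent (e ` {..<r})"
    then obtain u v where u: "v \<in> e ` {..<r}" "u v \<noteq> 0" "(\<Sum>v\<in>e ` {..<r}. sc (u v) v) = 0"
      by (auto simp: dependent_finite)
    have "lincomb sc r (u \<circ> e) e = 0"
      using u(3) by (simp add: lincomb_def sum.reindex[OF inj])
    then show False using ind u(1,2) by (auto simp: indep_family_def)
  qed
next
  assume inj: "inj_on e {..<r} \<and> \<not> dependent (e ` {..<r})"
  show "indep_family sc r e"
    unfolding indep_family_def
  proof (intro allI impI)
    fix a j assume a: "lincomb sc r a e = 0" "j < r"
    define u where "u = a \<circ> the_inv_into {..<r} e"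
    have ue: "u (e k) = a k" if "k < r" for k
      using inj that by (simp add: u_def the_inv_into_f_f)
    have "(\<Sum>v\<in>e ` {..<r}. sc (u v) v) = lincomb sc r a e"
      using inj by (simp add: lincomb_def sum.reindex ue)
    then have "u (e j) = 0"
      using independentD[of "e ` {..<r}" "e ` {..<r}" u "e j"] a inj by simp
    then show "a j = 0" using ue[OF a(2)] by simp
  qed
qed

lemma lincomb_single:
  assumes "j < r"
  shows "lincomb sc r (\<lambda>k. if k = j then c else 0) e = sc c (e j)"
proof -
  have "lincomb sc r (\<lambda>k. if k = j then c else 0) e = (\<Sum>k\<in>{j}. sc (if k = j then c else 0) (e k))"
    unfolding lincomb_def by (rule sum.mono_neutral_right) (use assms in auto)
  then show ?thesis by simp
qed

lemma lincomb_add: "lincomb sc r (\<lambda>j. a j + b j) e = lincomb sc r a e + lincomb sc r b e"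
  by (simp add: lincomb_def scale_left_distrib sum.distrib)

lemma lincomb_scale: "lincomb sc r (\<lambda>j. c * a j) e = sc c (lincomb sc r a e)"
  by (simp add: lincomb_def scale_sum_right)

lemma span_family_iff: "v \<in> span (e ` {..<r}) \<longleftrightarrow> (\<exists>a. v = lincomb sc r a e)"
proof
  have "lincomb sc r a e \<in> span (e ` {..<r})" for a
    unfolding lincomb_def by (intro span_sum span_scale span_base) auto
  then show "\<exists>a. v = lincomb sc r a e \<Longrightarrow> v \<in> span (e ` {..<r})" by auto
  show "v \<in> span (e ` {..<r}) \<Longrightarrow> \<exists>a. v = lincomb sc r a e"
  proof (induction rule: span_induct_alt)
    case base
    show ?case by (intro exI[of _ "\<lambda>_. 0"]) (simp add: lincomb_def)
  next
    case (step c x y)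
    then obtain j a where j: "j < r" "x = e j" "y = lincomb sc r a e" by auto
    have "sc c x + y = lincomb sc r (\<lambda>k. (if k = j then c else 0) + a k) e"
      using j by (simp only: lincomb_add lincomb_single)
    then show ?case by blast
  qed
qed

lemma basis_of_iff:
  "basis_of sc r F e \<longleftrightarrow> indep_family sc r e \<and> (\<forall>v. v \<in> F \<longleftrightarrow> (\<exists>a. v = lincomb sc r a e))"
  unfolding basis_of_def indep_family_iff using span_family_iff[of _ e r] by blast

lemma basis_of_subspace: "basis_of sc r F e \<Longrightarrow> subspace F"
  unfolding basis_of_def using subspace_span by auto

lemma basis_of_representation:
  assumes "basis_of sc r F e" "j < r"
  shows "representation (e ` {..<r}) (lincomb sc r a e) (e j) = a j"
proof -
  have inj: "inj_on e {..<r}" and ind: "\<not> dependent (e ` {..<r})"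
    using assms by (auto simp: basis_of_def)
  have "representation (e ` {..<r}) (lincomb sc r a e) (e j)
      = (\<Sum>k<r. a k * representation (e ` {..<r}) (e k) (e j))"
    unfolding lincomb_def using ind
    by (subst representation_sum) (auto simp: representation_scale span_base span_scale)
  also have "\<dots> = (\<Sum>k<r. if k = j then a k else 0)"
    using inj assms(2) ind by (intro sum.cong refl) (auto simp: representation_basis inj_on_eq_iff)
  also have "\<dots> = a j" using assms(2) by simp
  finally show ?thesis .
qed

text \<open>An independent family of the right length in a space spanned by \<open>n\<close> vectors is a basis.\<close>

lemma basis_of_indep_family:
  assumes b: "basis_of sc n F b" and e: "indep_family sc n e" "\<And>j. j < n \<Longrightarrow> e j \<in> F"
  shows "basis_of sc n F e"
proof -
  have F: "F = span (b ` {..<n})" using b by (simp add: basis_of_def)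
  have inj: "inj_on e {..<n}" "\<not> dependent (e ` {..<n})" using e indep_family_iff by auto
  have sub: "e ` {..<n} \<subseteq> F" using e by auto
  have "v \<in> span (e ` {..<n})" if "v \<in> F" for v
  proof (rule ccontr)
    assume v: "v \<notin> span (e ` {..<n})"
    then have "\<not> dependent (insert v (e ` {..<n}))" using inj independent_insertI by blast
    then have "card (insert v (e ` {..<n})) \<le> card (b ` {..<n})"
      using independent_span_bound[of "b ` {..<n}"] sub that F by simp
    moreover have "card (insert v (e ` {..<n})) = Suc n"
      using v span_base by (subst card_insert_disjoint) (auto simp: card_image[OF inj(1)])
    ultimately show False using card_image_le[of "{..<n}" b] by simp
  qed
  moreover have "span (e ` {..<n}) \<subseteq> F" using sub F span_minimal subspace_span by blast
  ultimately show ?thesis using inj by (auto simp: basis_of_def)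
qed

text \<open>An independent family in a subspace can be completed to a basis.\<close>

lemma indep_family_extend:
  assumes b: "basis_of sc n F b" and e: "indep_family sc r e" "\<And>j. j < r \<Longrightarrow> e j \<in> F"
  obtains e' where "r \<le> n" "basis_of sc n F e'" "\<And>j. j < r \<Longrightarrow> e' j = e j"
proof -
  have F: "F = span (b ` {..<n})" using b by (simp add: basis_of_def)
  have ind: "inj_on e {..<r}" "\<not> dependent (e ` {..<r})" using e indep_family_iff by auto
  have "e ` {..<r} \<subseteq> F" using e by auto
  then obtain B where B: "e ` {..<r} \<subseteq> B" "B \<subseteq> F" "\<not> dependent B" "F \<subseteq> span B"
    using maximal_independent_subset_extend[of "e ` {..<r}" F] ind by blast
  have spB: "span B = F" using B F span_minimal subspace_span by blast
  have finB: "finite B" "card B \<le> card (b ` {..<n})"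
    using independent_span_bound[of "b ` {..<n}" B] B F by auto
  have indb: "inj_on b {..<n}" "\<not> dependent (b ` {..<n})" using b by (auto simp: basis_of_def)
  have "card (b ` {..<n}) \<le> card B"
    using independent_span_bound[OF finB(1) indb(2)] spB F span_superset by auto
  then have cB: "card B = n" using finB card_image[OF indb(1)] by simp
  have rn: "r \<le> n" using card_mono[OF finB(1) B(1)] card_image[OF ind(1)] cB by simp
  have "card (B - e ` {..<r}) = n - r"
    using B cB card_image[OF ind(1)] by (simp add: card_Diff_subset)
  then obtain g where g: "bij_betw g {..<n - r} (B - e ` {..<r})"
    using finB by (metis bij_betw_iff_card card_lessThan finite_Diff finite_lessThan)
  define e' where "e' j = (if j < r then e j else g (j - r))" for j
  have "bij_betw (\<lambda>j. g (j - r)) {r..<n} (B - e ` {..<r})"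
  proof -
    have "bij_betw (\<lambda>j. j - r) {r..<n} {..<n - r}"
      by (rule bij_betw_byWitness[where f' = "\<lambda>j. j + r"]) auto
    from bij_betw_trans[OF this g] show ?thesis unfolding comp_def .
  qed
  then have 1: "bij_betw e' {r..<n} (B - e ` {..<r})"
    by (rule bij_betw_cong[THEN iffD1, rotated]) (auto simp: e'_def)
  have "bij_betw e {..<r} (e ` {..<r})" using ind by (simp add: bij_betw_def)
  then have 2: "bij_betw e' {..<r} (e ` {..<r})"
    by (rule bij_betw_cong[THEN iffD1, rotated]) (auto simp: e'_def)
  have "bij_betw e' ({..<r} \<union> {r..<n}) (e ` {..<r} \<union> (B - e ` {..<r}))"
    by (rule bij_betw_combine[OF 2 1]) auto
  moreover have "{..<r} \<union> {r..<n} = {..<n}" "e ` {..<r} \<union> (B - e ` {..<r}) = B"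
    using rn B by auto
  ultimately have "basis_of sc n F e'"
    using B spB by (auto simp: basis_of_def bij_betw_def)
  then show ?thesis using that rn e'_def by auto
qed

end

text \<open>A positive definite hermitian form \<open>h\<close> on a subspace \<open>F\<close>.\<close>

locale hermitian_space = vector_space sc
  for sc :: "complex \<Rightarrow> 'v::ab_group_add \<Rightarrow> 'v" +
  fixes F :: "'v set" and h :: "'v \<Rightarrow> 'v \<Rightarrow> complex"
  assumes subspace_F: "subspace F"
    and h_sym: "u \<in> F \<Longrightarrow> v \<in> F \<Longrightarrow> h v u = cnj (h u v)"
    and h_add: "u \<in> F \<Longrightarrow> v \<in> F \<Longrightarrow> w \<in> F \<Longrightarrow> h (u + v) w = h u w + h v w"
    and h_scale: "u \<in> F \<Longrightarrow> v \<in> F \<Longrightarrow> h (sc a u) v = a * h u v"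
    and h_pos: "v \<in> F \<Longrightarrow> v \<noteq> 0 \<Longrightarrow> Re (h v v) > 0"
begin

lemma F_closed [simp, intro]:
  "0 \<in> F" "u \<in> F \<Longrightarrow> v \<in> F \<Longrightarrow> u + v \<in> F" "u \<in> F \<Longrightarrow> v \<in> F \<Longrightarrow> u - v \<in> F" "u \<in> F \<Longrightarrow> sc a u \<in> F"
  using subspace_F by (auto intro: subspace_0 subspace_add subspace_diff subspace_scale)

lemma lincomb_closed: "(\<And>j. j < r \<Longrightarrow> e j \<in> F) \<Longrightarrow> lincomb sc r a e \<in> F"
  unfolding lincomb_def using subspace_F by (intro subspace_sum subspace_scale) auto

lemma h_add_right: "u \<in> F \<Longrightarrow> v \<in> F \<Longrightarrow> w \<in> F \<Longrightarrow> h w (u + v) = h w u + h w v"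
  using h_sym[of "u + v" w] h_sym[of u w] h_sym[of v w] by (simp add: h_add)

lemma h_scale_right: "u \<in> F \<Longrightarrow> v \<in> F \<Longrightarrow> h v (sc a u) = cnj a * h v u"
  using h_sym[of "sc a u" v] h_sym[of u v] by (simp add: h_scale)

lemma h_diff: "u \<in> F \<Longrightarrow> v \<in> F \<Longrightarrow> w \<in> F \<Longrightarrow> h (u - v) w = h u w - h v w"
  using h_add[of "u - v" v w] by simp

lemma h_diff_right: "u \<in> F \<Longrightarrow> v \<in> F \<Longrightarrow> w \<in> F \<Longrightarrow> h w (u - v) = h w u - h w v"
  using h_add_right[of "u - v" v w] by simp

lemma h_zero [simp]: "w \<in> F \<Longrightarrow> h 0 w = 0" "w \<in> F \<Longrightarrow> h w 0 = 0"
  using h_scale[of w w 0] h_scale_right[of w w 0] by auto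

lemma h_lincomb:
  "(\<And>j. j < r \<Longrightarrow> e j \<in> F) \<Longrightarrow> w \<in> F \<Longrightarrow> h (lincomb sc r a e) w = (\<Sum>j<r. a j * h (e j) w)"
proof (induction r)
  case (Suc r)
  have "h (lincomb sc (Suc r) a e) w = h (lincomb sc r a e + sc (a r) (e r)) w"
    by (simp add: lincomb_def)
  also have "\<dots> = h (lincomb sc r a e) w + a r * h (e r) w"
    using Suc by (subst h_add) (auto simp: h_scale intro: lincomb_closed)
  finally show ?case using Suc by simp
qed (simp add: lincomb_def)

lemma h_lincomb_right:
  assumes "\<And>j. j < r \<Longrightarrow> e j \<in> F" "w \<in> F"
  shows "h w (lincomb sc r a e) = (\<Sum>j<r. cnj (a j) * h w (e j))"
proof -
  have "h w (lincomb sc r a e) = cnj (h (lincomb sc r a e) w)"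
    using assms by (intro h_sym lincomb_closed) auto
  also have "\<dots> = (\<Sum>j<r. cnj (a j) * cnj (h (e j) w))" using assms by (simp add: h_lincomb)
  also have "\<dots> = (\<Sum>j<r. cnj (a j) * h w (e j))"
    using assms by (intro sum.cong refl) (metis h_sym lessThan_iff)
  finally show ?thesis .
qed

lemma h_definite: "v \<in> F \<Longrightarrow> h v v = 0 \<longleftrightarrow> v = 0"
  using h_pos[of v] by force

lemma eq_if_h_eq:
  assumes G: "subspace G" "G \<subseteq> F" and "u \<in> G" "v \<in> G" "\<And>w. w \<in> G \<Longrightarrow> h u w = h v w"
  shows "u = v"
proof -
  have d: "u - v \<in> G" using assms subspace_diff by blast
  then have "h (u - v) (u - v) = 0" using assms by (subst h_diff) auto
  then show ?thesis using h_definite[of "u - v"] d G by auto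
qed

text \<open>The Gram-Schmidt step: \<open>reduce n e v\<close> is the component of \<open>v\<close> orthogonal to \<open>e n\<close>. Applied to
  the members \<open>e j\<close> with \<open>j < n\<close>, it splits the last member off a family of length \<open>n + 1\<close>, which
  allows inductions on the length.\<close>

definition reduce :: "nat \<Rightarrow> (nat \<Rightarrow> 'v) \<Rightarrow> 'v \<Rightarrow> 'v" where
  "reduce n e v = v - sc (h v (e n) / h (e n) (e n)) (e n)"

lemma reduce_closed: "e n \<in> F \<Longrightarrow> v \<in> F \<Longrightarrow> reduce n e v \<in> F"
  by (auto simp: reduce_def)

lemma h_reduce_last:
  assumes "e n \<in> F" "v \<in> F" "e n \<noteq> 0"
  shows "h (reduce n e v) (e n) = 0"
  using assms h_definite[of "e n"] by (simp add: reduce_def h_diff h_scale)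

lemma h_reduce:
  assumes "e n \<in> F" "v \<in> F" "w \<in> F" "e n \<noteq> 0"
  shows "h (reduce n e v) (reduce n e w) = h v w - h v (e n) * h (e n) w / h (e n) (e n)"
proof -
  have "h (reduce n e v) (reduce n e w) = h (reduce n e v) w"
    using assms reduce_closed[of e n v] h_reduce_last[of e n v]
    unfolding reduce_def[of n e w] by (simp add: h_diff_right h_scale_right)
  then show ?thesis using assms by (simp add: reduce_def h_diff h_scale)
qed

lemma reduce_lincomb:
  assumes "\<And>j. j < Suc n \<Longrightarrow> e j \<in> F" "e n \<noteq> 0"
  shows "reduce n e (lincomb sc (Suc n) c e) = lincomb sc n c (\<lambda>j. reduce n e (e j))"
proof -
  let ?q = "h (e n) (e n)"
  have q: "?q \<noteq> 0" using assms h_definite[of "e n"] by simp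
  have "h (lincomb sc (Suc n) c e) (e n) / ?q = (\<Sum>j<n. c j * (h (e j) (e n) / ?q)) + c n"
    using q assms by (subst h_lincomb) (auto simp: add_divide_distrib sum_divide_distrib)
  then have "reduce n e (lincomb sc (Suc n) c e) =
      lincomb sc n c e - sc (\<Sum>j<n. c j * (h (e j) (e n) / ?q)) (e n)"
    by (simp add: reduce_def lincomb_def scale_left_distrib)
  also have "\<dots> = lincomb sc n c (\<lambda>j. reduce n e (e j))"
    by (simp add: reduce_def lincomb_def scale_right_diff_distrib sum_subtractf scale_sum_left)
  finally show ?thesis .
qed

lemma indep_family_reduce:
  assumes e: "\<And>j. j < Suc n \<Longrightarrow> e j \<in> F" and n: "e n \<noteq> 0"
  shows "indep_family sc (Suc n) e \<longleftrightarrow> indep_family sc n (\<lambda>j. reduce n e (e j))"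
proof
  assume ind: "indep_family sc (Suc n) e"
  show "indep_family sc n (\<lambda>j. reduce n e (e j))"
    unfolding indep_family_def
  proof (intro allI impI)
    fix a j assume a: "lincomb sc n a (\<lambda>j. reduce n e (e j)) = 0" "j < n"
    let ?v = "lincomb sc n a e"
    let ?a = "\<lambda>j. if j < n then a j else - (h ?v (e n) / h (e n) (e n))"
    have v: "lincomb sc (Suc n) (a(n := 0)) e = ?v" by (simp add: lincomb_def)
    have "reduce n e (lincomb sc (Suc n) (a(n := 0)) e)
        = lincomb sc n (a(n := 0)) (\<lambda>j. reduce n e (e j))"
      by (rule reduce_lincomb) (use e n in auto)
    then have "reduce n e ?v = 0" using a v by (simp add: lincomb_def)
    then have "lincomb sc (Suc n) ?a e = 0" by (simp add: reduce_def lincomb_def scale_minus_left)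
    then have "?a j = 0" by (rule indep_familyD[OF ind]) (use a in simp)
    then show "a j = 0" using a(2) by simp
  qed
next
  assume ind: "indep_family sc n (\<lambda>j. reduce n e (e j))"
  show "indep_family sc (Suc n) e"
    unfolding indep_family_def
  proof (intro allI impI)
    fix a j assume a: "lincomb sc (Suc n) a e = 0" "j < Suc n"
    have "lincomb sc n a (\<lambda>j. reduce n e (e j)) = 0"
      using reduce_lincomb[of n e a] a e n by (simp add: reduce_def)
    then have 0: "\<forall>j<n. a j = 0" using ind by (simp add: indep_family_def)
    then have "sc (a n) (e n) = 0" using a(1) by (simp add: lincomb_def)
    then have "a n = 0" using n by simp
    then show "a j = 0" using 0 a(2) less_Suc_eq by auto
  qed
qed

lemma indep_family_nonzero: "indep_family sc r e \<Longrightarrow> j < r \<Longrightarrow> e j \<noteq> 0"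
  using indep_family_iff[OF vector_space_axioms, of r e] dependent_zero by force

text \<open>The Riesz representation, for a functional that is prescribed on a basis.\<close>

lemma riesz_family:
  assumes "indep_family sc r e" "\<And>j. j < r \<Longrightarrow> e j \<in> F"
  shows "\<exists>a. \<forall>k<r. h (lincomb sc r a e) (e k) = b k"
  using assms
proof (induction r arbitrary: b)
  case (Suc n)
  have ind: "indep_family sc n e"
    unfolding indep_family_def
  proof (intro allI impI)
    fix a j assume "lincomb sc n a e = 0" "j < n"
    then have "lincomb sc (Suc n) (a(n := 0)) e = 0" by (simp add: lincomb_def)
    then have "(a(n := 0)) j = 0"
      by (rule indep_familyD[OF Suc.prems(1)]) (use \<open>j < n\<close> in simp)
    then show "a j = 0" using \<open>j < n\<close> by simp
  qed
  obtain p where p: "\<forall>k<n. h (lincomb sc n p e) (e k) = h (e n) (e k)"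
    using Suc.IH[OF ind, of "\<lambda>k. h (e n) (e k)"] Suc.prems(2) by auto
  obtain w where w: "\<forall>k<n. h (lincomb sc n w e) (e k) = b k"
    using Suc.IH[OF ind, of b] Suc.prems(2) by auto
  \<comment> \<open>\<open>y\<close> is \<open>e n\<close> minus its orthogonal projection to the span of the other members.\<close>
  define y where "y = lincomb sc (Suc n) (\<lambda>j. if j < n then - p j else 1) e"
  have F: "e n \<in> F" "lincomb sc n p e \<in> F" "lincomb sc n w e \<in> F"
    using Suc.prems(2) by (auto intro: lincomb_closed)
  have y: "y = e n - lincomb sc n p e"
    by (simp add: y_def lincomb_def scale_minus_left sum_negf)
  have "y \<noteq> 0"
    using indep_familyD[OF Suc.prems(1), of "\<lambda>j. if j < n then - p j else 1" n] by (auto simp: y_def)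
  have yF: "y \<in> F" using F y by auto
  have ye: "h y (e k) = 0" if "k < n" for k
    using p that F Suc.prems(2) by (simp add: y h_diff)
  have "h y (lincomb sc n p e) = 0"
    using yF ye Suc.prems(2) by (subst h_lincomb_right) auto
  then have "h y (e n) = h y y" using yF F by (simp add: y h_diff_right)
  then have yn: "h y (e n) \<noteq> 0" using h_definite[OF yF] \<open>y \<noteq> 0\<close> by simp
  define t where "t = (b n - h (lincomb sc n w e) (e n)) / h y (e n)"
  let ?a = "\<lambda>j. (if j < n then w j else 0) + t * (if j < n then - p j else 1)"
  have eq: "lincomb sc (Suc n) ?a e = lincomb sc n w e + sc t y"
    by (simp add: lincomb_def y_def scale_left_distrib sum.distrib scale_right_distrib scale_sum_right)
  have "h (lincomb sc (Suc n) ?a e) (e k) = b k" if "k < Suc n" for k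
  proof (cases "k = n")
    case True
    show ?thesis unfolding eq True using yn F yF by (simp add: h_add h_scale t_def)
  next
    case False
    then show ?thesis using that F yF w ye Suc.prems(2) by (simp add: eq h_add h_scale)
  qed
  then show ?case by blast
qed simp

lemma riesz:
  assumes b: "basis_of sc r G b" and G: "G \<subseteq> F"
    and add: "\<And>u v. u \<in> G \<Longrightarrow> v \<in> G \<Longrightarrow> f (u + v) = f u + f v"
    and scale: "\<And>a u. u \<in> G \<Longrightarrow> f (sc a u) = cnj a * f u"
  shows "\<exists>!w. w \<in> G \<and> (\<forall>u\<in>G. h w u = f u)"
proof -
  note b' = b[unfolded basis_of_iff[OF vector_space_axioms]]
  have sub: "subspace G" by (rule basis_of_subspace[OF vector_space_axioms b])
  have bG: "b j \<in> G" if "j < r" for j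
    using b that span_base by (auto simp: basis_of_def)
  then have bF: "b j \<in> F" if "j < r" for j using G that by auto
  obtain a where a: "\<forall>k<r. h (lincomb sc r a b) (b k) = f (b k)"
    using riesz_family[of r b "\<lambda>k. f (b k)"] b' bF by blast
  have wG: "lincomb sc r a b \<in> G" using b' by blast
  have lin: "f (lincomb sc m c b) = (\<Sum>j<m. cnj (c j) * f (b j))" if "m \<le> r" for m c
    using that
  proof (induction m)
    case 0
    show ?case using scale[of 0 0] subspace_0[OF sub] by (simp add: lincomb_def)
  next
    case (Suc m)
    have "lincomb sc m c b \<in> G"
      unfolding lincomb_def using bG Suc.prems sub by (intro subspace_sum subspace_scale) auto
    moreover have "lincomb sc (Suc m) c b = lincomb sc m c b + sc (c m) (b m)"
      by (simp add: lincomb_def)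
    ultimately show ?case using Suc bG[of m] sub by (simp add: add scale subspace_scale)
  qed
  have "h (lincomb sc r a b) u = f u" if "u \<in> G" for u
  proof -
    obtain c where u: "u = lincomb sc r c b" using b' \<open>u \<in> G\<close> by blast
    have "h (lincomb sc r a b) u = (\<Sum>j<r. cnj (c j) * h (lincomb sc r a b) (b j))"
      unfolding u using bF wG G by (intro h_lincomb_right) auto
    then show ?thesis using a lin[of r c] u by simp
  qed
  then show ?thesis
    using wG eq_if_h_eq[OF sub G] by (intro ex1I[of _ "lincomb sc r a b"]) auto
qed

text \<open>The orthogonal complement within \<open>F\<close>.\<close>

definition orth :: "'v set \<Rightarrow> 'v set" where
  "orth G = {v \<in> F. \<forall>s\<in>G. h v s = 0}"

lemma subspace_orth: "G \<subseteq> F \<Longrightarrow> subspace (orth G)"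
  by (rule subspaceI) (auto simp: orth_def h_add h_scale subset_iff)

lemma orth_disjoint: "v \<in> G \<Longrightarrow> v \<in> orth G \<Longrightarrow> v = 0"
  using h_definite by (auto simp: orth_def)

lemma orth_decomposition:
  assumes b: "basis_of sc r G b" and G: "G \<subseteq> F" and v: "v \<in> F"
  shows "\<exists>!w. w \<in> G \<and> v - w \<in> orth G"
proof -
  have "w \<in> G \<and> v - w \<in> orth G \<longleftrightarrow> w \<in> G \<and> (\<forall>u\<in>G. h w u = h v u)" for w
    using G v by (auto simp: orth_def h_diff subset_iff)
  moreover have "\<exists>!w. w \<in> G \<and> (\<forall>u\<in>G. h w u = h v u)"
    using G v by (intro riesz[OF b]) (auto simp: h_add_right h_scale_right subset_iff)
  ultimately show ?thesis by simp
qed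

text \<open>If \<open>b\<close> is a basis of \<open>F\<close> whose first \<open>r\<close> members form a basis of \<open>G\<close>, then the components
  of the other ones orthogonal to \<open>G\<close> form a basis of the orthogonal complement.\<close>

lemma basis_of_orth:
  assumes b: "basis_of sc n F b" and g: "basis_of sc r G b" and rn: "r \<le> n"
    and P: "\<And>j. j < n - r \<Longrightarrow> P j \<in> orth G \<and> b (r + j) - P j \<in> G"
  shows "basis_of sc (n - r) (orth G) P"
proof -
  note vs = vector_space_axioms
  note b' = b[unfolded basis_of_iff[OF vs]] and g' = g[unfolded basis_of_iff[OF vs]]
  have sub: "subspace G" "G \<subseteq> F"
    using basis_of_subspace[OF vs g] b g span_mono[OF image_mono, of "{..<r}" "{..<n}" b] rn
    by (simp_all add: basis_of_def)
  have split: "lincomb sc n a b = lincomb sc r a b + lincomb sc (n - r) (\<lambda>j. a (r + j)) (\<lambda>j. b (r + j))" for a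
  proof -
    have "(\<Sum>j<r + m. f j) = (\<Sum>j<r. f j) + (\<Sum>j<m. f (r + j))" for m and f :: "nat \<Rightarrow> 'v"
      by (induction m) (simp_all add: add.assoc)
    from this[of "\<lambda>j. sc (a j) (b j)" "n - r"]
    show ?thesis using rn by (simp add: lincomb_def)
  qed
  have diff: "lincomb sc (n - r) a (\<lambda>j. b (r + j)) - lincomb sc (n - r) a P \<in> G" for a
  proof -
    have "lincomb sc (n - r) a (\<lambda>j. b (r + j)) - lincomb sc (n - r) a P
        = (\<Sum>j<n - r. sc (a j) (b (r + j) - P j))"
      by (simp add: lincomb_def scale_right_diff_distrib sum_subtractf)
    then show ?thesis using P sub by (auto intro!: subspace_sum subspace_scale)
  qed
  have Porth: "lincomb sc (n - r) a P \<in> orth G" for a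
    unfolding lincomb_def using P subspace_orth[OF sub(2)] by (intro subspace_sum subspace_scale) auto
  show ?thesis
    unfolding basis_of_iff[OF vs]
  proof (intro conjI allI iffI)
    show "indep_family sc (n - r) P"
      unfolding indep_family_def
    proof (intro allI impI)
      fix a j assume a: "lincomb sc (n - r) a P = 0" "j < n - r"
      then have "lincomb sc (n - r) a (\<lambda>j. b (r + j)) \<in> G" using diff[of a] by simp
      then obtain c where c: "lincomb sc (n - r) a (\<lambda>j. b (r + j)) = lincomb sc r c b" using g' by blast
      let ?d = "\<lambda>j. if j < r then - c j else a (j - r)"
      have "lincomb sc n ?d b = 0"
        using split[of ?d] c by (simp add: lincomb_def scale_minus_left sum_negf)
      then have "?d (r + j) = 0" by (rule indep_familyD[OF conjunct1[OF b']]) (use a(2) in simp)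
      then show "a j = 0" by simp
    qed
    fix v
    show "\<exists>a. v = lincomb sc (n - r) a P \<Longrightarrow> v \<in> orth G" using Porth by auto
    assume v: "v \<in> orth G"
    then have "v \<in> F" by (simp add: orth_def)
    then obtain a where a: "v = lincomb sc n a b" using b' by blast
    let ?p = "lincomb sc (n - r) (\<lambda>j. a (r + j)) P"
    have "lincomb sc r a b \<in> G" using g' by blast
    then have "v - ?p \<in> G"
      using subspace_add[OF sub(1) _ diff[of "\<lambda>j. a (r + j)"], of "lincomb sc r a b"] a split[of a]
      by (simp add: algebra_simps)
    moreover have "v - ?p \<in> orth G" using v Porth subspace_orth[OF sub(2)] subspace_diff by blast
    ultimately have "v = ?p" using orth_disjoint by fastforce
    then show "\<exists>a. v = lincomb sc (n - r) a P" by blast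
  qed
qed

end

section \<open>Charts, bump functions and differentials\<close>

text \<open>Smoothness on the part of an open set \<open>W\<close> that lies in the domain of the chart \<open>c\<close>.\<close>

definition smooth_in ::
  "('m, 'n::finite) chart \<Rightarrow> 'm set \<Rightarrow> ('m \<Rightarrow> complex) \<Rightarrow> bool" where
  "smooth_in c W f \<longleftrightarrow> smooth_on (snd c ` (fst c \<inter> W)) (f \<circ> chart_inv c)"

lemma fun_on_smooth_iff: "fun_on smooth_on M W f \<longleftrightarrow> (\<forall>c\<in>M. smooth_in c W f)"
  by (simp add: fun_on_def smooth_in_def)

text \<open>A complex manifold with atlas \<open>M\<close>.\<close>

locale cmanifold =
  fixes M :: "('m::t2_space, 'n::finite) atlas"
  assumes manifold: "complex_manifold M"
begin

lemma ex_chart: obtains c where "c \<in> M" "x \<in> fst c"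
  using manifold unfolding complex_manifold_def by (metis UNIV_I UN_E)

lemma chart_homeomorphism: "c \<in> M \<Longrightarrow> homeomorphism (fst c) (snd c ` fst c) (snd c) (chart_inv c)"
  using manifold by (auto simp: complex_manifold_def)

lemma open_chart: "c \<in> M \<Longrightarrow> open (fst c)"
  using manifold by (auto simp: complex_manifold_def)

lemma chart_inv [simp]: "c \<in> M \<Longrightarrow> x \<in> fst c \<Longrightarrow> chart_inv c (snd c x) = x"
  using chart_homeomorphism by (auto simp: homeomorphism_def)

lemma open_chart_image: assumes "c \<in> M" "open W" shows "open (snd c ` (fst c \<inter> W))"
proof -
  have "openin (top_of_set (snd c ` fst c)) (snd c ` (fst c \<inter> W))"
    using assms by (intro homeomorphism_imp_open_map[OF chart_homeomorphism]) auto
  moreover have "open (snd c ` fst c)" using manifold assms by (auto simp: complex_manifold_def)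
  ultimately show ?thesis using openin_open_trans by blast
qed

lemma smooth_in_cong:
  assumes "c \<in> M" "open W" "\<And>x. x \<in> fst c \<Longrightarrow> x \<in> W \<Longrightarrow> f x = g x" "smooth_in c W f"
  shows "smooth_in c W g"
  using assms(4) unfolding smooth_in_def
  by (rule smooth_on_cong[OF open_chart_image, rotated -1]) (use assms in auto)

lemma smooth_in_subset: "smooth_in c W f \<Longrightarrow> W' \<subseteq> W \<Longrightarrow> smooth_in c W' f"
  unfolding smooth_in_def smooth_on_def by (meson Ck_on_subset Int_mono image_mono order_refl)

lemma smooth_in_local:
  assumes "c \<in> M" "\<And>x. x \<in> fst c \<Longrightarrow> x \<in> W \<Longrightarrow> \<exists>N. open N \<and> x \<in> N \<and> smooth_in c N f"
  shows "smooth_in c W f"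
  unfolding smooth_in_def
proof (rule smooth_on_local)
  fix z assume "z \<in> snd c ` (fst c \<inter> W)"
  then obtain x where x: "x \<in> fst c" "x \<in> W" "z = snd c x" by auto
  then obtain N where "open N" "x \<in> N" "smooth_in c N f" using assms(2) by blast
  then show "\<exists>T. open T \<and> z \<in> T \<and> smooth_on T (f \<circ> chart_inv c)"
    using x assms(1) by (intro exI[of _ "snd c ` (fst c \<inter> N)"]) (auto simp: smooth_in_def open_chart_image)
qed

lemma smooth_in_const: "c \<in> M \<Longrightarrow> open W \<Longrightarrow> smooth_in c W (\<lambda>x. a)"
  unfolding smooth_in_def smooth_on_def comp_def
  by (intro allI Ck_on_const[OF open_chart_image]) simp_all

lemma smooth_in_add:
  "c \<in> M \<Longrightarrow> open W \<Longrightarrow> smooth_in c W f \<Longrightarrow> smooth_in c W g \<Longrightarrow> smooth_in c W (\<lambda>x. f x + g x)"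
  unfolding smooth_in_def smooth_on_def comp_def
  by (intro allI Ck_on_add[OF open_chart_image]) simp_all

lemma smooth_in_mult:
  "c \<in> M \<Longrightarrow> open W \<Longrightarrow> smooth_in c W f \<Longrightarrow> smooth_in c W g \<Longrightarrow> smooth_in c W (\<lambda>x. f x * g x)"
  unfolding smooth_in_def smooth_on_def comp_def
  by (intro allI Ck_on_mult[OF open_chart_image]) simp_all

lemma smooth_in_diff:
  "c \<in> M \<Longrightarrow> open W \<Longrightarrow> smooth_in c W f \<Longrightarrow> smooth_in c W g \<Longrightarrow> smooth_in c W (\<lambda>x. f x - g x)"
  using smooth_in_add[of c W f "\<lambda>x. (-1) * g x"] smooth_in_mult[of c W "\<lambda>x. -1" g]
    smooth_in_const[where c = c and W = W and a = "-1"] by simp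

lemma smooth_in_sum:
  "c \<in> M \<Longrightarrow> open W \<Longrightarrow> (\<And>j. j < r \<Longrightarrow> smooth_in c W (f j)) \<Longrightarrow> smooth_in c W (\<lambda>x. \<Sum>j<(r::nat). f j x)"
  by (induction r) (simp_all add: smooth_in_const smooth_in_add)

lemma smooth_in_cnj: "c \<in> M \<Longrightarrow> open W \<Longrightarrow> smooth_in c W f \<Longrightarrow> smooth_in c W (\<lambda>x. cnj (f x))"
  unfolding smooth_in_def smooth_on_def comp_def
  by (intro allI Ck_on_bounded_linear[OF bounded_linear_cnj open_chart_image]) simp_all

lemma smooth_in_divide:
  assumes "c \<in> M" "open W" "smooth_in c W f" "smooth_in c W g"
    "\<And>x. x \<in> fst c \<Longrightarrow> x \<in> W \<Longrightarrow> g x \<noteq> 0"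
  shows "smooth_in c W (\<lambda>x. f x / g x)"
proof -
  have "g (chart_inv c z) \<noteq> 0" if "z \<in> snd c ` (fst c \<inter> W)" for z using that assms by auto
  from Ck_on_inverse[OF open_chart_image[OF assms(1,2)] this]
  have "smooth_in c W (\<lambda>x. inverse (g x))"
    using assms(4) by (simp add: smooth_in_def smooth_on_def comp_def)
  then show ?thesis using smooth_in_mult assms by (simp add: divide_inverse)
qed

lemma smooth_in_flat_fun:
  "c \<in> M \<Longrightarrow> open W \<Longrightarrow> smooth_in c W f \<Longrightarrow> smooth_in c W (\<lambda>x. complex_of_real (flat_fun p (Re (f x))))"
  unfolding smooth_in_def smooth_on_def comp_def
  by (intro allI Ck_on_flat_fun[OF open_chart_image]) simp_all

lemma coordinate_hol:
  "c \<in> M \<Longrightarrow> c' \<in> M \<Longrightarrow> hol_on (snd c ` (fst c \<inter> fst c')) (\<lambda>z. snd c' (chart_inv c z) $ k)"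
  using manifold by (auto simp: complex_manifold_def)

lemma smooth_in_coordinate: "c \<in> M \<Longrightarrow> c' \<in> M \<Longrightarrow> smooth_in c (fst c') (\<lambda>x. snd c' x $ k)"
  using coordinate_hol by (auto simp: smooth_in_def hol_on_def comp_def)

lemma smooth_in_continuous:
  assumes "c \<in> M" "open W" "x \<in> fst c" "x \<in> W" "smooth_in c W f"
  shows "isCont f x"
proof -
  have "smooth_on (snd c ` (fst c \<inter> W)) (f \<circ> chart_inv c)" using assms by (simp add: smooth_in_def)
  then have "Ck_on 0 (snd c ` (fst c \<inter> W)) (f \<circ> chart_inv c)" unfolding smooth_on_def by blast
  then have "continuous_on (snd c ` (fst c \<inter> W)) (f \<circ> chart_inv c)" by simp
  moreover have "continuous_on (fst c \<inter> W) (snd c)"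
    using chart_homeomorphism[OF assms(1)] by (auto simp: homeomorphism_def intro: continuous_on_subset)
  ultimately have "continuous_on (fst c \<inter> W) (\<lambda>x. (f \<circ> chart_inv c) (snd c x))"
    using continuous_on_compose2 by blast
  then have "continuous_on (fst c \<inter> W) f"
    by (rule continuous_on_eq) (use assms in auto)
  then show ?thesis
    using continuous_on_eq_continuous_at[OF open_Int[OF open_chart[OF assms(1)] assms(2)]] assms
    by blast
qed

text \<open>A smooth function that is \<open>1\<close> near \<open>x0\<close> and vanishes outside a closed subset of \<open>W\<close>. It is
  built in a chart around \<open>x0\<close> from the square of the distance to \<open>x0\<close> in the coordinates; smoothness
  in the other charts follows as this square is a polynomial in the coordinates and their
  conjugates.\<close>

lemma bump_function:
  assumes "open W" "x0 \<in> W"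
  obtains b K N where "fun_on smooth_on M UNIV b" "closed K" "K \<subseteq> W" "\<And>x. x \<notin> K \<Longrightarrow> b x = 0"
    "open N" "x0 \<in> N" "N \<subseteq> W" "\<And>x. x \<in> N \<Longrightarrow> b x = 1"
proof -
  obtain c where c: "c \<in> M" "x0 \<in> fst c" by (rule ex_chart)
  let ?z0 = "snd c x0" and ?O = "snd c ` (fst c \<inter> W)"
  obtain r where r: "r > 0" "cball ?z0 r \<subseteq> ?O"
    using open_contains_cball[of ?O] open_chart_image[OF c(1) assms(1)] c assms by blast
  define s where "s x = (\<Sum>k\<in>UNIV. (snd c x $ k - ?z0 $ k) * cnj (snd c x $ k - ?z0 $ k))" for x
  have s: "s x = complex_of_real ((dist (snd c x) ?z0)\<^sup>2)" for x
    by (simp add: s_def dist_vec_def L2_set_def sum_nonneg complex_mult_cnj dist_norm cmod_def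
        del: complex_cnj_diff)
  \<comment> \<open>\<open>f1\<close> vanishes from radius \<open>r\<close> on and \<open>f2\<close> up to radius \<open>r / 2\<close>; they never vanish together.\<close>
  define f1 where "f1 x = complex_of_real (flat_fun 1 (Re (complex_of_real (r\<^sup>2) - s x)))" for x
  define f2 where "f2 x = complex_of_real (flat_fun 1 (Re (s x - complex_of_real ((r / 2)\<^sup>2))))" for x
  define b where "b x = (if x \<in> fst c then f1 x / (f1 x + f2 x) else 0)" for x
  have flat: "flat_fun 1 t \<ge> 0" "flat_fun 1 t = 0 \<longleftrightarrow> t \<le> 0" for t
    by (auto simp: flat_fun_def)
  have sq: "dist (snd c x) ?z0 ^ 2 \<le> a\<^sup>2 \<longleftrightarrow> dist (snd c x) ?z0 \<le> a"
    "a\<^sup>2 \<le> dist (snd c x) ?z0 ^ 2 \<longleftrightarrow> a \<le> dist (snd c x) ?z0" if "a \<ge> 0" for a x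
    using that by (auto simp: abs_le_square_iff[symmetric])
  have f1_0: "f1 x = 0 \<longleftrightarrow> r \<le> dist (snd c x) ?z0" for x
    using r sq(2)[of r x] by (simp add: f1_def flat s)
  have f2_0: "f2 x = 0 \<longleftrightarrow> dist (snd c x) ?z0 \<le> r / 2" for x
    using r sq(1)[of "r / 2" x] by (simp add: f2_def flat s)
  have nz: "f1 x + f2 x \<noteq> 0" for x
  proof
    assume "f1 x + f2 x = 0"
    then have "flat_fun 1 (Re (complex_of_real (r\<^sup>2) - s x)) +
        flat_fun 1 (Re (s x - complex_of_real ((r / 2)\<^sup>2))) = 0"
      unfolding f1_def f2_def by (metis of_real_add of_real_eq_0_iff)
    then have "f1 x = 0 \<and> f2 x = 0"
      unfolding f1_def f2_def using flat(1) by (metis add_nonneg_eq_0_iff of_real_0)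
    then show False using r(1) by (simp add: f1_0 f2_0)
  qed
  define K where "K = chart_inv c ` cball ?z0 r"
  have ball: "cball ?z0 r \<subseteq> snd c ` fst c" using r by auto
  have "continuous_on (snd c ` fst c) (chart_inv c)"
    using chart_homeomorphism[OF c(1)] by (auto simp: homeomorphism_def)
  then have "compact K"
    unfolding K_def
    by (intro compact_continuous_image[OF continuous_on_subset[OF _ ball] compact_cball])
  then have cK: "closed K" by (rule compact_imp_closed)
  have KW: "K \<subseteq> W" unfolding K_def using r(2) c(1) by (force dest: subsetD)
  have K0: "b x = 0" if "x \<notin> K" for x
  proof (cases "x \<in> fst c")
    case True
    then have "snd c x \<notin> cball ?z0 r" using that c(1) unfolding K_def by (metis chart_inv image_eqI)
    then have "f1 x = 0" by (simp add: f1_0 dist_commute)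
    then show ?thesis by (simp add: b_def)
  qed (simp add: b_def)
  define N where "N = fst c \<inter> snd c -` ball ?z0 (r / 2)"
  have "open N"
    unfolding N_def using chart_homeomorphism[OF c(1)] open_chart[OF c(1)]
    by (intro continuous_open_preimage) (auto simp: homeomorphism_def)
  have N1: "b x = 1" if "x \<in> N" for x
    using that f2_0[of x] nz[of x] by (simp add: b_def N_def dist_commute)
  have "N \<subseteq> K"
  proof
    fix x assume "x \<in> N"
    then show "x \<in> K" using K0[of x] N1[of x] by auto
  qed
  have sm: "smooth_in c' UNIV b" if c': "c' \<in> M" for c'
  proof (rule smooth_in_local[OF c'])
    fix x
    show "\<exists>N. open N \<and> x \<in> N \<and> smooth_in c' N b"
    proof (cases "x \<in> K")
      case False
      have "smooth_in c' (- K) b"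
        by (rule smooth_in_cong[OF c' _ _ smooth_in_const[OF c', of _ 0]]) (use cK K0 in auto)
      then show ?thesis using False cK by (intro exI[of _ "- K"]) auto
    next
      case True
      note o = open_chart[OF c(1)]
      have "smooth_in c' (fst c) (\<lambda>x. \<Sum>k\<in>A. (snd c x $ k - ?z0 $ k) * cnj (snd c x $ k - ?z0 $ k))" for A
        using finite[of A] by (induction A rule: finite_induct)
          (auto intro!: smooth_in_add smooth_in_mult smooth_in_diff smooth_in_cnj smooth_in_const
            smooth_in_coordinate c' c(1) o simp del: complex_cnj_diff)
      then have ss: "smooth_in c' (fst c) s" unfolding s_def .
      have f1: "smooth_in c' (fst c) f1"
        unfolding f1_def by (rule smooth_in_flat_fun[OF c' o smooth_in_diff[OF c' o smooth_in_const[OF c' o] ss]])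
      have f2: "smooth_in c' (fst c) f2"
        unfolding f2_def by (rule smooth_in_flat_fun[OF c' o smooth_in_diff[OF c' o ss smooth_in_const[OF c' o]]])
      have "smooth_in c' (fst c) (\<lambda>x. f1 x / (f1 x + f2 x))"
        by (rule smooth_in_divide[OF c' o f1 smooth_in_add[OF c' o f1 f2] nz])
      then have "smooth_in c' (fst c) b"
        by (rule smooth_in_cong[OF c' o, rotated]) (simp add: b_def)
      moreover have "x \<in> fst c" using True ball c(1) by (auto simp: K_def dest!: subsetD)
      ultimately show ?thesis using o by auto
    qed
  qed
  show ?thesis
  proof (rule that[OF _ cK KW K0 \<open>open N\<close> _ _ N1])
    show "fun_on smooth_on M UNIV b" using sm by (simp add: fun_on_smooth_iff)
    show "x0 \<in> N" using c(2) r(1) by (simp add: N_def)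
    show "N \<subseteq> W" using \<open>N \<subseteq> K\<close> KW by simp
  qed
qed

text \<open>The coordinates of a coordinate change are smooth and satisfy the Cauchy-Riemann equations;
  here they are assembled to a differentiable map with complex linear differential.\<close>

lemma transition_has_derivative:
  assumes c: "c \<in> M" "c' \<in> M" "x \<in> fst c" "x \<in> fst c'"
  shows "((snd c' \<circ> chart_inv c) has_derivative transition_deriv c c' x) (at (snd c x))"
    and "transition_deriv c c' x (\<i> *s v) = \<i> *s transition_deriv c c' x v"
proof -
  let ?g = "\<lambda>k z. snd c' (chart_inv c z) $ k" and ?z = "snd c x"
  have g: "(?g k has_derivative frechet_derivative (?g k) (at ?z)) (at ?z)"
    "frechet_derivative (?g k) (at ?z) (\<i> *s v) = \<i> * frechet_derivative (?g k) (at ?z) v" for k v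
    using coordinate_hol[OF c(1,2), of k] smooth_on_differentiable[of _ "?g k" ?z] c(3,4)
    by (auto simp: hol_on_def frechet_derivative_works)
  define L where "L v = (\<Sum>k\<in>UNIV. axis k (frechet_derivative (?g k) (at ?z) v))" for v
  have axis: "bounded_linear (axis k :: complex \<Rightarrow> complex^'n)" for k
    by (rule linear_conv_bounded_linear[THEN iffD1], intro linearI) (auto simp: axis_def vec_eq_iff)
  have "((\<lambda>z. \<Sum>k\<in>UNIV. axis k (?g k z)) has_derivative L) (at ?z)"
    unfolding L_def by (intro has_derivative_sum bounded_linear.has_derivative[OF axis] g)
  moreover have vec: "(\<Sum>k\<in>UNIV. axis k (w k)) = (\<chi> k. w k)" for w :: "'n \<Rightarrow> complex"
    by (simp add: vec_eq_iff axis_def if_distrib[of "\<lambda>f. f _"] sum.delta cong: if_cong)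
  ultimately have "((snd c' \<circ> chart_inv c) has_derivative L) (at ?z)"
    by (simp add: comp_def)
  moreover from frechet_derivative_at[OF this] have L: "transition_deriv c c' x = L"
    by (simp add: transition_deriv_def)
  ultimately show "((snd c' \<circ> chart_inv c) has_derivative transition_deriv c c' x) (at ?z)" by simp
  show "transition_deriv c c' x (\<i> *s v) = \<i> *s transition_deriv c c' x v"
    unfolding L L_def vec by (simp add: g vec_eq_iff)
qed

lemma transition_deriv_trans:
  assumes c: "c \<in> M" "c' \<in> M" "c'' \<in> M" "x \<in> fst c" "x \<in> fst c'" "x \<in> fst c''"
  shows "transition_deriv c c'' x v = transition_deriv c' c'' x (transition_deriv c c' x v)"
proof -
  let ?z = "snd c x"
  have z: "(snd c' \<circ> chart_inv c) ?z = snd c' x" using c by simp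
  have "((snd c'' \<circ> chart_inv c') \<circ> (snd c' \<circ> chart_inv c) has_derivative
      transition_deriv c' c'' x \<circ> transition_deriv c c' x) (at ?z)"
    by (rule diff_chain_at) (use transition_has_derivative c z in simp_all)
  moreover have "open (snd c ` (fst c \<inter> fst c'))" using open_chart_image open_chart c by simp
  ultimately have "((snd c'' \<circ> chart_inv c) has_derivative
      transition_deriv c' c'' x \<circ> transition_deriv c c' x) (at ?z)"
    by (rule has_derivative_transform_within_open) (use c in auto)
  from frechet_derivative_at[OF this] show ?thesis by (simp add: transition_deriv_def fun_eq_iff)
qed

lemma tvec_tangent:
  assumes "c \<in> M" "x \<in> fst c"
  shows "tvec M c x u \<in> tangent_space M x"
  unfolding tangent_space_def
proof (intro CollectI conjI ballI allI impI)
  fix c1 c2 assume "c1 \<in> M" "c2 \<in> M" "x \<in> fst c1 \<inter> fst c2"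
  then show "tvec M c x u c2 = transition_deriv c1 c2 x (tvec M c x u c1)"
    using transition_deriv_trans[of c c1 c2 x u] assms by (simp add: tvec_def)
next
  fix c' assume "\<not> (c' \<in> M \<and> x \<in> fst c')"
  then show "tvec M c x u c' = 0" unfolding tvec_def by (rule if_not_P)
qed

lemma tJ_tangent:
  assumes "X \<in> tangent_space M x"
  shows "tJ X \<in> tangent_space M x"
  unfolding tangent_space_def
proof (intro CollectI conjI ballI allI impI)
  fix c1 c2 assume "c1 \<in> M" "c2 \<in> M" "x \<in> fst c1 \<inter> fst c2"
  moreover from this have "X c2 = transition_deriv c1 c2 x (X c1)"
    using assms unfolding tangent_space_def by blast
  ultimately show "tJ X c2 = transition_deriv c1 c2 x (tJ X c1)"
    using transition_has_derivative(2)[of c1 c2 x "X c1"] by (simp add: tJ_def)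
next
  fix c assume "\<not> (c \<in> M \<and> x \<in> fst c)"
  then have "X c = 0" using assms unfolding tangent_space_def by blast
  then show "tJ X c = 0" by (simp add: tJ_def)
qed

lemma tadd_tangent:
  assumes "X \<in> tangent_space M x" "Y \<in> tangent_space M x"
  shows "tadd X Y \<in> tangent_space M x"
  unfolding tangent_space_def
proof (intro CollectI conjI ballI allI impI)
  fix c1 c2 assume c: "c1 \<in> M" "c2 \<in> M" "x \<in> fst c1 \<inter> fst c2"
  have "X c2 = transition_deriv c1 c2 x (X c1)" "Y c2 = transition_deriv c1 c2 x (Y c1)"
    using assms c unfolding tangent_space_def by blast+
  then show "tadd X Y c2 = transition_deriv c1 c2 x (tadd X Y c1)"
    using linear_add[OF has_derivative_linear[OF transition_has_derivative(1)], of c1 c2 x "X c1" "Y c1"] c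
    by (simp add: tadd_def)
next
  fix c assume "\<not> (c \<in> M \<and> x \<in> fst c)"
  then have "X c = 0" "Y c = 0" using assms unfolding tangent_space_def by blast+
  then show "tadd X Y c = 0" by (simp add: tadd_def)
qed

lemma tscale_tangent:
  assumes "X \<in> tangent_space M x"
  shows "tscale r X \<in> tangent_space M x"
  unfolding tangent_space_def
proof (intro CollectI conjI ballI allI impI)
  fix c1 c2 assume c: "c1 \<in> M" "c2 \<in> M" "x \<in> fst c1 \<inter> fst c2"
  have "X c2 = transition_deriv c1 c2 x (X c1)"
    using assms c unfolding tangent_space_def by blast
  then show "tscale r X c2 = transition_deriv c1 c2 x (tscale r X c1)"
    using linear_cmul[OF has_derivative_linear[OF transition_has_derivative(1)], of c1 c2 x r "X c1"] c
    by (simp add: tscale_def)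
next
  fix c assume "\<not> (c \<in> M \<and> x \<in> fst c)"
  then have "X c = 0" using assms unfolding tangent_space_def by blast
  then show "tscale r X c = 0" by (simp add: tscale_def)
qed

text \<open>The differential at \<open>x\<close> is computed in one chosen chart that depends on \<open>x\<close> only; its rules hold
  in that chart, without recourse to a change of charts.\<close>

lemma differential_chart:
  obtains c where "c \<in> M" "x \<in> fst c"
    "\<And>f X. differential M f x X = frechet_derivative (f \<circ> chart_inv c) (at (snd c x)) (X c)"
proof -
  let ?c = "SOME c. c \<in> M \<and> x \<in> fst c"
  obtain c where "c \<in> M \<and> x \<in> fst c" using ex_chart by metis
  then have "?c \<in> M \<and> x \<in> fst ?c" by (rule someI)
  then show ?thesis by (intro that[of ?c]) (simp_all add: differential_def Let_def)
qed

lemma fun_on_smooth_has_derivative: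
  assumes "fun_on smooth_on M W f" "x \<in> W" "c \<in> M" "x \<in> fst c"
  shows "((f \<circ> chart_inv c) has_derivative frechet_derivative (f \<circ> chart_inv c) (at (snd c x)))
    (at (snd c x))"
  using assms smooth_on_differentiable[of "snd c ` (fst c \<inter> W)" "f \<circ> chart_inv c" "snd c x"]
  by (auto simp: fun_on_def frechet_derivative_works)

lemma fun_on_hol_smooth: "fun_on hol_on M W f \<Longrightarrow> fun_on smooth_on M W f"
  by (auto simp: fun_on_def hol_on_def)

lemma differential_cong:
  assumes "open N" "x \<in> N" "\<And>y. y \<in> N \<Longrightarrow> f y = g y" "fun_on smooth_on M N f"
  shows "differential M g x X = differential M f x X"
proof -
  obtain c where c: "c \<in> M" "x \<in> fst c"
    "\<And>f X. differential M f x X = frechet_derivative (f \<circ> chart_inv c) (at (snd c x)) (X c)"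
    using differential_chart[of x] by blast
  have "((g \<circ> chart_inv c) has_derivative frechet_derivative (f \<circ> chart_inv c) (at (snd c x))) (at (snd c x))"
    by (rule has_derivative_transform_within_open[OF
          fun_on_smooth_has_derivative[OF assms(4,2) c(1,2)] open_chart_image[OF c(1) assms(1)]])
      (use assms c in auto)
  from frechet_derivative_at[OF this] show ?thesis by (simp add: c)
qed

lemma differential_const: "differential M (\<lambda>y. a) x X = 0"
proof -
  obtain c where c: "c \<in> M" "x \<in> fst c"
    "\<And>f X. differential M f x X = frechet_derivative (f \<circ> chart_inv c) (at (snd c x)) (X c)"
    using differential_chart[of x] by blast
  show ?thesis by (simp add: c comp_def frechet_derivative_const)
qed

lemma differential_add:
  assumes "x \<in> W" "fun_on smooth_on M W f" "fun_on smooth_on M W g"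
  shows "differential M (\<lambda>y. f y + g y) x X = differential M f x X + differential M g x X"
proof -
  obtain c where c: "c \<in> M" "x \<in> fst c"
    "\<And>f X. differential M f x X = frechet_derivative (f \<circ> chart_inv c) (at (snd c x)) (X c)"
    using differential_chart[of x] by blast
  note f = fun_on_smooth_has_derivative[OF assms(2,1) c(1,2)]
  note g = fun_on_smooth_has_derivative[OF assms(3,1) c(1,2)]
  from frechet_derivative_at[OF has_derivative_add[OF f g]]
  show ?thesis by (simp add: c comp_def fun_eq_iff)
qed

lemma differential_mult:
  assumes "x \<in> W" "fun_on smooth_on M W f" "fun_on smooth_on M W g"
  shows "differential M (\<lambda>y. f y * g y) x X = differential M f x X * g x + f x * differential M g x X"
proof -
  obtain c where c: "c \<in> M" "x \<in> fst c"
    "\<And>f X. differential M f x X = frechet_derivative (f \<circ> chart_inv c) (at (snd c x)) (X c)"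
    using differential_chart[of x] by blast
  note f = fun_on_smooth_has_derivative[OF assms(2,1) c(1,2)]
  note g = fun_on_smooth_has_derivative[OF assms(3,1) c(1,2)]
  have "frechet_derivative (\<lambda>z. f (chart_inv c z) * g (chart_inv c z)) (at (snd c x)) (X c) =
      f x * frechet_derivative (g \<circ> chart_inv c) (at (snd c x)) (X c) +
      frechet_derivative (f \<circ> chart_inv c) (at (snd c x)) (X c) * g x"
    using fun_cong[OF frechet_derivative_at[OF has_derivative_mult[OF f g]], of "X c"] c
    by (simp add: comp_def)
  then show ?thesis by (simp add: c comp_def)
qed

lemma dbar_hol:
  assumes "x \<in> W" "fun_on hol_on M W f"
  shows "dbar M f x X = 0"
proof -
  obtain c where c: "c \<in> M" "x \<in> fst c"
    "\<And>f X. differential M f x X = frechet_derivative (f \<circ> chart_inv c) (at (snd c x)) (X c)"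
    using differential_chart[of x] by blast
  then have "differential M f x (tJ X) = \<i> * differential M f x X"
    using assms by (auto simp: fun_on_def hol_on_def tJ_def)
  then show ?thesis by (simp add: dbar_def)
qed

lemma dbar_cong:
  assumes "open N" "x \<in> N" "\<And>y. y \<in> N \<Longrightarrow> f y = g y" "fun_on smooth_on M N f"
  shows "dbar M g x X = dbar M f x X"
  using differential_cong[OF assms] by (simp add: dbar_def)

lemma fun_on_sum_mult:
  assumes "open W" "\<And>j. j < r \<Longrightarrow> fun_on smooth_on M W (f j)" "\<And>j. j < r \<Longrightarrow> fun_on smooth_on M W (g j)"
  shows "fun_on smooth_on M W (\<lambda>y. \<Sum>j<(r::nat). f j y * g j y)"
  unfolding fun_on_smooth_iff
proof
  fix c assume "c \<in> M"
  then show "smooth_in c W (\<lambda>y. \<Sum>j<r. f j y * g j y)"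
    using assms by (intro smooth_in_sum smooth_in_mult) (simp_all add: fun_on_smooth_iff)
qed

text \<open>The Leibniz rule for \<open>dbar\<close>, where the second factors are annihilated.\<close>

lemma dbar_sum_mult_hol:
  assumes "open W" "x \<in> W" "\<And>j. j < r \<Longrightarrow> fun_on smooth_on M W (f j)" "\<And>j. j < r \<Longrightarrow> fun_on hol_on M W (g j)"
  shows "dbar M (\<lambda>y. \<Sum>j<(r::nat). f j y * g j y) x X = (\<Sum>j<r. dbar M (f j) x X * g j x)"
  using assms(3,4)
proof (induction r)
  case 0
  show ?case by (simp add: dbar_def differential_const)
next
  case (Suc r)
  note sm = Suc.prems(1) fun_on_hol_smooth[OF Suc.prems(2)]
  have fg: "fun_on smooth_on M W (\<lambda>y. f r y * g r y)"
    using sm[of r] assms(1) by (auto simp: fun_on_smooth_iff intro!: smooth_in_mult)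
  have S: "fun_on smooth_on M W (\<lambda>y. \<Sum>j<r. f j y * g j y)"
    using sm assms(1) by (intro fun_on_sum_mult) auto
  have "dbar M (\<lambda>y. f r y * g r y) x X = dbar M (f r) x X * g r x + f r x * dbar M (g r) x X"
    using differential_mult[OF assms(2) sm(1)[of r] sm(2)[of r]] by (simp add: dbar_def algebra_simps add_divide_distrib)
  also have "dbar M (g r) x X = 0" using dbar_hol assms(2) Suc.prems(2) by blast
  finally have 1: "dbar M (\<lambda>y. f r y * g r y) x X = dbar M (f r) x X * g r x" by simp
  have "dbar M (\<lambda>y. (\<Sum>j<r. f j y * g j y) + f r y * g r y) x X
      = dbar M (\<lambda>y. \<Sum>j<r. f j y * g j y) x X + dbar M (\<lambda>y. f r y * g r y) x X"
    unfolding dbar_def differential_add[OF assms(2) S fg] by (simp add: field_simps)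
  then show ?case using 1 Suc by simp
qed

end

section \<open>Smooth bundles and their global sections\<close>

text \<open>A field \<open>s\<close> of elements of the fibres of \<open>V\<close> whose components are smooth
  functions of the coordinates in the chart \<open>c\<close>, over the part of \<open>W\<close> in the domain of \<open>c\<close>.\<close>

definition smooth_field ::
  "('m, 'n::finite) chart \<Rightarrow> ('m, 'v::ab_group_add) vbundle \<Rightarrow> 'm set \<Rightarrow> ('m, 'v) bsection \<Rightarrow> bool" where
  "smooth_field c V W s \<longleftrightarrow> (\<forall>x\<in>fst c \<inter> W. s x \<in> fibre V x) \<and>
     (\<forall>(U, e) \<in> frames V. \<forall>j<rank V. smooth_in c (U \<inter> W) (\<lambda>x. component V e j x (s x)))"

lemma smooth_field_fibre: "smooth_field c V W s \<Longrightarrow> x \<in> fst c \<Longrightarrow> x \<in> W \<Longrightarrow> s x \<in> fibre V x"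
  by (auto simp: smooth_field_def)

lemma smooth_field_component:
  "smooth_field c V W s \<Longrightarrow> (U, e) \<in> frames V \<Longrightarrow> j < rank V \<Longrightarrow>
    smooth_in c (U \<inter> W) (\<lambda>x. component V e j x (s x))"
  unfolding smooth_field_def by blast

context cmanifold
begin

lemma section_on_smooth_iff: "section_on smooth_on M V W s \<longleftrightarrow> (\<forall>c\<in>M. smooth_field c V W s)"
proof -
  have "(\<forall>x\<in>W. s x \<in> fibre V x) \<longleftrightarrow> (\<forall>c\<in>M. \<forall>x\<in>fst c \<inter> W. s x \<in> fibre V x)"
    by (metis IntE IntI ex_chart)
  then show ?thesis
    unfolding section_on_def smooth_field_def fun_on_smooth_iff split_def by (metis (lifting))
qed

lemma A1_iff:
  "\<omega> \<in> A1 M V \<longleftrightarrow>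
     (\<forall>x. \<forall>X\<in>tangent_space M x. \<omega> x X \<in> fibre V x \<and>
        (\<forall>Y\<in>tangent_space M x. \<omega> x (tadd X Y) = \<omega> x X + \<omega> x Y) \<and>
        (\<forall>a. \<omega> x (tscale a X) = vscale V (complex_of_real a) (\<omega> x X))) \<and>
     (\<forall>c\<in>M. \<forall>u. smooth_field c V UNIV (\<lambda>x. \<omega> x (tvec M c x u)))" (is "_ \<longleftrightarrow> ?A \<and> ?B")
proof -
  let ?C = "\<forall>(U, e)\<in>frames V. \<forall>j<rank V. \<forall>c\<in>M. \<forall>u.
        smooth_in c (U \<inter> UNIV) (\<lambda>x. component V e j x (\<omega> x (tvec M c x u)))"
  have 1: "\<omega> \<in> A1 M V \<longleftrightarrow> ?A \<and> ?C"
    by (simp add: A1_def smooth_in_def comp_def)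
  have "?B \<longleftrightarrow> ?C" if A: ?A
  proof -
    have "\<forall>x\<in>fst c \<inter> UNIV. \<omega> x (tvec M c x u) \<in> fibre V x" if "c \<in> M" for c u
      using A tvec_tangent[OF that] by blast
    then have "?B \<longleftrightarrow> (\<forall>c\<in>M. \<forall>u. \<forall>(U, e)\<in>frames V. \<forall>j<rank V.
        smooth_in c (U \<inter> UNIV) (\<lambda>x. component V e j x (\<omega> x (tvec M c x u))))"
      unfolding smooth_field_def by (intro ball_cong all_cong1 refl) blast
    also have "\<dots> \<longleftrightarrow> ?C" by blast
    finally show ?thesis .
  qed
  then show ?thesis using 1 by blast
qed

end

text \<open>A smooth complex vector bundle \<open>V\<close> over a complex manifold.\<close>

locale smooth_bundle = cmanifold M
  for M :: "('m::t2_space, 'n::finite) atlas" +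
  fixes V :: "('m, 'v::ab_group_add) vbundle"
  assumes smooth_bundle: "smooth_vector_bundle M V"
begin

sublocale vector_space "vscale V"
  using smooth_bundle by (simp add: vector_bundle_def)

lemma ex_frame: obtains U e where "(U, e) \<in> frames V" "x \<in> U"
proof -
  have "x \<in> (\<Union>F\<in>frames V. fst F)" using smooth_bundle by (simp add: vector_bundle_def)
  then show ?thesis using that by (metis UN_E prod.collapse)
qed

lemma frame:
  assumes "(U, e) \<in> frames V"
  shows "open U" "x \<in> U \<Longrightarrow> basis_of (vscale V) (rank V) (fibre V x) (\<lambda>j. e j x)"
    "c \<in> M \<Longrightarrow> j < rank V \<Longrightarrow> smooth_field c V U (e j)"
    "x \<in> U \<Longrightarrow> j < rank V \<Longrightarrow> e j x \<in> fibre V x"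
proof -
  have *: "open U \<and> (\<forall>x\<in>U. basis_of (vscale V) (rank V) (fibre V x) (\<lambda>j. e j x)) \<and>
        (\<forall>j<rank V. section_on smooth_on M V U (e j))"
    using smooth_bundle assms unfolding vector_bundle_def by blast
  then show "open U" "x \<in> U \<Longrightarrow> basis_of (vscale V) (rank V) (fibre V x) (\<lambda>j. e j x)"
    "c \<in> M \<Longrightarrow> j < rank V \<Longrightarrow> smooth_field c V U (e j)"
    by (auto simp: section_on_smooth_iff)
  show "x \<in> U \<Longrightarrow> j < rank V \<Longrightarrow> e j x \<in> fibre V x"
    using * by (auto simp: section_on_def)
qed

lemma subspace_fibre: "subspace (fibre V x)"
  using ex_frame[of x] basis_of_subspace[OF vector_space_axioms] frame(2) by metis

lemma fibre_closed [simp, intro]: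
  "0 \<in> fibre V x" "u \<in> fibre V x \<Longrightarrow> v \<in> fibre V x \<Longrightarrow> u + v \<in> fibre V x"
  "u \<in> fibre V x \<Longrightarrow> v \<in> fibre V x \<Longrightarrow> u - v \<in> fibre V x"
  "u \<in> fibre V x \<Longrightarrow> vscale V a u \<in> fibre V x"
  using subspace_fibre by (auto intro: subspace_0 subspace_add subspace_diff subspace_scale)

lemma component_lincomb:
  "(U, e) \<in> frames V \<Longrightarrow> x \<in> U \<Longrightarrow> j < rank V \<Longrightarrow>
    component V e j x (lincomb (vscale V) (rank V) a (\<lambda>j. e j x)) = a j"
  unfolding component_def by (rule basis_of_representation[OF vector_space_axioms frame(2)])

lemma lincomb_component:
  assumes "(U, e) \<in> frames V" "x \<in> U" "v \<in> fibre V x"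
  shows "lincomb (vscale V) (rank V) (\<lambda>j. component V e j x v) (\<lambda>j. e j x) = v"
proof -
  obtain a where "v = lincomb (vscale V) (rank V) a (\<lambda>j. e j x)"
    using frame(2)[OF assms(1,2)] assms(3) basis_of_iff[OF vector_space_axioms] by blast
  then show ?thesis using component_lincomb[OF assms(1,2)] by (simp add: lincomb_def)
qed

lemma component_add:
  assumes "(U, e) \<in> frames V" "x \<in> U" "j < rank V" "u \<in> fibre V x" "v \<in> fibre V x"
  shows "component V e j x (u + v) = component V e j x u + component V e j x v"
  using component_lincomb[OF assms(1-3), of "\<lambda>j. component V e j x u + component V e j x v"]
  by (simp add: lincomb_add[OF vector_space_axioms] lincomb_component[OF assms(1,2)] assms(4,5))

lemma component_scale:
  assumes "(U, e) \<in> frames V" "x \<in> U" "j < rank V" "u \<in> fibre V x"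
  shows "component V e j x (vscale V a u) = a * component V e j x u"
  using component_lincomb[OF assms(1-3), of "\<lambda>j. a * component V e j x u"]
  by (simp add: lincomb_scale[OF vector_space_axioms] lincomb_component[OF assms(1,2)] assms(4))

lemma smooth_fieldI:
  assumes "\<And>x. x \<in> fst c \<Longrightarrow> x \<in> W \<Longrightarrow> s x \<in> fibre V x"
    "\<And>U e j. (U, e) \<in> frames V \<Longrightarrow> j < rank V \<Longrightarrow> smooth_in c (U \<inter> W) (\<lambda>x. component V e j x (s x))"
  shows "smooth_field c V W s"
  using assms unfolding smooth_field_def by blast

lemma smooth_field_subset:
  assumes "smooth_field c V W s" "W' \<subseteq> W"
  shows "smooth_field c V W' s"
proof (rule smooth_fieldI)
  show "s x \<in> fibre V x" if "x \<in> fst c" "x \<in> W'" for x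
    using smooth_field_fibre[OF assms(1) that(1)] that(2) assms(2) by blast
  show "smooth_in c (U \<inter> W') (\<lambda>x. component V e j x (s x))" if "(U, e) \<in> frames V" "j < rank V" for U e j
    by (rule smooth_in_subset[OF smooth_field_component[OF assms(1) that]]) (use assms(2) in blast)
qed

lemma smooth_field_cong:
  assumes "c \<in> M" "open W" "\<And>x. x \<in> fst c \<Longrightarrow> x \<in> W \<Longrightarrow> s x = t x" "smooth_field c V W s"
  shows "smooth_field c V W t"
proof (rule smooth_fieldI)
  show "t x \<in> fibre V x" if "x \<in> fst c" "x \<in> W" for x
    using smooth_field_fibre[OF assms(4) that] assms(3)[OF that] by simp
  show "smooth_in c (U \<inter> W) (\<lambda>x. component V e j x (t x))" if "(U, e) \<in> frames V" "j < rank V" for U e j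
    by (rule smooth_in_cong[OF assms(1) _ _ smooth_field_component[OF assms(4) that]])
      (use frame(1)[OF that(1)] assms in auto)
qed

lemma smooth_field_local:
  assumes "c \<in> M" "\<And>x. x \<in> fst c \<Longrightarrow> x \<in> W \<Longrightarrow> \<exists>N. open N \<and> x \<in> N \<and> smooth_field c V N s"
  shows "smooth_field c V W s"
proof (rule smooth_fieldI)
  show "s x \<in> fibre V x" if "x \<in> fst c" "x \<in> W" for x
    using assms(2)[OF that] smooth_field_fibre[OF _ that(1)] by blast
  show "smooth_in c (U \<inter> W) (\<lambda>x. component V e j x (s x))" if U: "(U, e) \<in> frames V" "j < rank V" for U e j
  proof (rule smooth_in_local[OF assms(1)])
    fix x assume x: "x \<in> fst c" "x \<in> U \<inter> W"
    then obtain N where N: "open N" "x \<in> N" "smooth_field c V N s" using assms(2) by blast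
    then show "\<exists>N. open N \<and> x \<in> N \<and> smooth_in c N (\<lambda>x. component V e j x (s x))"
      using smooth_field_component[OF N(3) U] x open_Int[OF frame(1)[OF U(1)] N(1)] by blast
  qed
qed

lemma smooth_field_add:
  assumes "c \<in> M" "open W" "smooth_field c V W s" "smooth_field c V W t"
  shows "smooth_field c V W (\<lambda>x. s x + t x)"
proof (rule smooth_fieldI)
  show "s x + t x \<in> fibre V x" if "x \<in> fst c" "x \<in> W" for x
    using smooth_field_fibre[OF assms(3) that] smooth_field_fibre[OF assms(4) that] by simp
  fix U e j assume U: "(U, e) \<in> frames V" "j < rank V"
  have o: "open (U \<inter> W)" using frame(1)[OF U(1)] assms(2) by (rule open_Int)
  show "smooth_in c (U \<inter> W) (\<lambda>x. component V e j x (s x + t x))"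
    by (rule smooth_in_cong[OF assms(1) o _ smooth_in_add[OF assms(1) o
            smooth_field_component[OF assms(3) U] smooth_field_component[OF assms(4) U]]])
      (use component_add[OF U(1)] U smooth_field_fibre[OF assms(3)] smooth_field_fibre[OF assms(4)] in auto)
qed

lemma smooth_field_scale:
  assumes "c \<in> M" "open W" "smooth_in c W a" "smooth_field c V W s"
  shows "smooth_field c V W (\<lambda>x. vscale V (a x) (s x))"
proof (rule smooth_fieldI)
  show "vscale V (a x) (s x) \<in> fibre V x" if "x \<in> fst c" "x \<in> W" for x
    using smooth_field_fibre[OF assms(4) that] by simp
  fix U e j assume U: "(U, e) \<in> frames V" "j < rank V"
  have o: "open (U \<inter> W)" using frame(1)[OF U(1)] assms(2) by (rule open_Int)
  show "smooth_in c (U \<inter> W) (\<lambda>x. component V e j x (vscale V (a x) (s x)))"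
    by (rule smooth_in_cong[OF assms(1) o _ smooth_in_mult[OF assms(1) o
            smooth_in_subset[OF assms(3)] smooth_field_component[OF assms(4) U]]])
      (use component_scale[OF U(1)] U smooth_field_fibre[OF assms(4)] in auto)
qed

lemma smooth_field_zero:
  assumes "c \<in> M" "open W"
  shows "smooth_field c V W (\<lambda>x. 0)"
proof (rule smooth_fieldI)
  fix U e j assume U: "(U, e) \<in> frames V" "j < rank V"
  have o: "open (U \<inter> W)" using frame(1)[OF U(1)] assms(2) by (rule open_Int)
  show "smooth_in c (U \<inter> W) (\<lambda>x. component V e j x 0)"
    by (rule smooth_in_cong[OF assms(1) o _ smooth_in_const[OF assms(1) o, of 0]])
      (use component_scale[OF U(1) _ U(2), of _ 0 0] in auto)
qed simp

lemma smooth_field_diff: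
  assumes "c \<in> M" "open W" "smooth_field c V W s" "smooth_field c V W t"
  shows "smooth_field c V W (\<lambda>x. s x - t x)"
  using smooth_field_add[OF assms(1,2,3) smooth_field_scale[OF assms(1,2)
        smooth_in_const[OF assms(1,2), of "-1"] assms(4)]] by simp

lemma smooth_field_lincomb:
  assumes "c \<in> M" "open W" "\<And>j. j < r \<Longrightarrow> smooth_in c W (a j)" "\<And>j. j < r \<Longrightarrow> smooth_field c V W (e j)"
  shows "smooth_field c V W (\<lambda>x. lincomb (vscale V) r (\<lambda>j. a j x) (\<lambda>j. e j x))"
  using assms(3,4)
proof (induction r)
  case 0
  then show ?case using smooth_field_zero[OF assms(1,2)] by (simp add: lincomb_def)
next
  case (Suc r)
  then show ?case
    using smooth_field_add[OF assms(1,2) Suc.IH smooth_field_scale[OF assms(1,2), of "a r" "e r"]]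
    by (simp add: lincomb_def)
qed

text \<open>A local smooth section agrees, near a given point, with a global one.\<close>

lemma extend_section:
  assumes W: "open W" "x0 \<in> W" and s: "\<And>c. c \<in> M \<Longrightarrow> smooth_field c V W s"
  obtains \<xi> N where "\<xi> \<in> A0 M V" "open N" "x0 \<in> N" "N \<subseteq> W" "\<And>x. x \<in> N \<Longrightarrow> \<xi> x = s x"
proof -
  obtain b K N where b: "fun_on smooth_on M UNIV b" "closed K" "K \<subseteq> W" "\<And>x. x \<notin> K \<Longrightarrow> b x = 0"
    "open N" "x0 \<in> N" "N \<subseteq> W" "\<And>x. x \<in> N \<Longrightarrow> b x = 1"
    using bump_function[OF W] by metis
  define \<xi> where "\<xi> x = (if x \<in> W then vscale V (b x) (s x) else 0)" for x
  have "smooth_field c V UNIV \<xi>" if c: "c \<in> M" for c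
  proof (rule smooth_field_local[OF c])
    fix x
    have "smooth_in c W b" using b(1) c by (auto simp: fun_on_smooth_iff intro: smooth_in_subset)
    then have 1: "smooth_field c V W \<xi>"
      by (rule smooth_field_cong[OF c W(1) _ smooth_field_scale[OF c W(1) _ s[OF c]], rotated])
        (simp add: \<xi>_def)
    have K: "open (- K)" using b(2) by (simp add: open_Compl)
    have 2: "smooth_field c V (- K) \<xi>"
      by (rule smooth_field_cong[OF c K _ smooth_field_zero[OF c K]]) (simp add: \<xi>_def b(4))
    show "\<exists>N. open N \<and> x \<in> N \<and> smooth_field c V N \<xi>"
    proof (cases "x \<in> W")
      case True
      then show ?thesis using 1 W by blast
    next
      case False
      then show ?thesis using 2 K b(3) by blast
    qed
  qed
  then have "\<xi> \<in> A0 M V" by (simp add: A0_def section_on_smooth_iff)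
  then show ?thesis by (rule that[OF _ b(5-7)]) (use b in \<open>auto simp: \<xi>_def\<close>)
qed

lemma extend_vector:
  assumes "v \<in> fibre V x"
  obtains \<xi> where "\<xi> \<in> A0 M V" "\<xi> x = v"
proof -
  obtain U e where U: "(U, e) \<in> frames V" "x \<in> U" by (rule ex_frame)
  let ?s = "\<lambda>y. lincomb (vscale V) (rank V) (\<lambda>j. component V e j x v) (\<lambda>j. e j y)"
  have "smooth_field c V U ?s" if c: "c \<in> M" for c
    by (rule smooth_field_lincomb[OF c frame(1)[OF U(1)] smooth_in_const[OF c frame(1)[OF U(1)]]
          frame(3)[OF U(1) c]])
  then obtain \<xi> N where "\<xi> \<in> A0 M V" "x \<in> N" "\<And>y. y \<in> N \<Longrightarrow> \<xi> y = ?s y"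
    using extend_section[OF frame(1)[OF U(1)] U(2), of ?s] by metis
  then show ?thesis using that lincomb_component[OF U assms] by metis
qed

lemma A0_iff: "\<xi> \<in> A0 M V \<longleftrightarrow> (\<forall>c\<in>M. smooth_field c V UNIV \<xi>)"
  by (simp add: A0_def section_on_smooth_iff)

lemma A0_fibre: "\<xi> \<in> A0 M V \<Longrightarrow> \<xi> x \<in> fibre V x"
  by (simp add: A0_def section_on_def)

end

section \<open>Hermitian bundles and their smooth subbundles\<close>

text \<open>A smooth complex vector bundle \<open>E\<close> with a hermitian metric.\<close>

locale hermitian_bundle = smooth_bundle M E
  for M :: "('m::t2_space, 'n::finite) atlas" and E :: "('m, 'v::ab_group_add) vbundle" +
  fixes h :: "'m \<Rightarrow> 'v \<Rightarrow> 'v \<Rightarrow> complex"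
  assumes metric: "hermitian_metric M E h"
begin

lemma hermitian_space: "hermitian_space (vscale E) (fibre E x) (h x)"
proof (intro hermitian_space.intro hermitian_space_axioms.intro)
  show "vector_space (vscale E)" by (rule vector_space_axioms)
  show "subspace (fibre E x)" by (rule subspace_fibre)
qed (use metric[unfolded hermitian_metric_def] in blast)+

lemma smooth_in_metric_frame:
  "c \<in> M \<Longrightarrow> (U, e) \<in> frames E \<Longrightarrow> j < rank E \<Longrightarrow> k < rank E \<Longrightarrow> smooth_in c U (\<lambda>x. h x (e j x) (e k x))"
  using metric[unfolded hermitian_metric_def fun_on_smooth_iff, THEN conjunct2, THEN conjunct2] by blast

lemma smooth_in_metric:
  assumes c: "c \<in> M" and W: "open W" and s: "smooth_field c E W s" and t: "smooth_field c E W t"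
  shows "smooth_in c W (\<lambda>x. h x (s x) (t x))"
proof (rule smooth_in_local[OF c])
  fix x assume x: "x \<in> fst c" "x \<in> W"
  obtain U e where U: "(U, e) \<in> frames E" "x \<in> U" by (rule ex_frame)
  have o: "open (U \<inter> W)" using frame(1)[OF U(1)] W by (rule open_Int)
  let ?a = "\<lambda>j x. component E e j x (s x)" and ?b = "\<lambda>j x. component E e j x (t x)"
  have h: "(\<Sum>j<rank E. ?a j y * (\<Sum>k<rank E. cnj (?b k y) * h y (e j y) (e k y))) = h y (s y) (t y)"
    if y: "y \<in> fst c" "y \<in> U \<inter> W" for y
  proof -
    interpret hermitian_space "vscale E" "fibre E y" "h y" by (rule hermitian_space)
    have e: "e j y \<in> fibre E y" if "j < rank E" for j using frame(4)[OF U(1) _ that] y by simp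
    have st: "s y \<in> fibre E y" "t y \<in> fibre E y"
      using smooth_field_fibre[OF s] smooth_field_fibre[OF t] y by auto
    have "h y (s y) (t y) = h y (lincomb (vscale E) (rank E) (\<lambda>j. ?a j y) (\<lambda>j. e j y)) (t y)"
      using lincomb_component[OF U(1)] st y by simp
    also have "\<dots> = (\<Sum>j<rank E. ?a j y * h y (e j y) (t y))" using e st by (intro h_lincomb)
    also have "\<dots> = (\<Sum>j<rank E. ?a j y * (\<Sum>k<rank E. cnj (?b k y) * h y (e j y) (e k y)))"
    proof (intro sum.cong refl)
      fix j assume "j \<in> {..<rank E}"
      then have "h y (e j y) (lincomb (vscale E) (rank E) (\<lambda>k. ?b k y) (\<lambda>k. e k y))
          = (\<Sum>k<rank E. cnj (?b k y) * h y (e j y) (e k y))"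
        using e by (intro h_lincomb_right) auto
      then show "?a j y * h y (e j y) (t y) = ?a j y * (\<Sum>k<rank E. cnj (?b k y) * h y (e j y) (e k y))"
        using lincomb_component[OF U(1)] st y by simp
    qed
    finally show ?thesis by simp
  qed
  have "smooth_in c (U \<inter> W) (\<lambda>y. \<Sum>j<rank E. ?a j y * (\<Sum>k<rank E. cnj (?b k y) * h y (e j y) (e k y)))"
    by (rule smooth_in_sum[OF c o smooth_in_mult[OF c o smooth_field_component[OF s U(1)]
          smooth_in_sum[OF c o smooth_in_mult[OF c o smooth_in_cnj[OF c o smooth_field_component[OF t U(1)]]
            smooth_in_subset[OF smooth_in_metric_frame[OF c U(1)]]]]]]) simp_all
  then have "smooth_in c (U \<inter> W) (\<lambda>x. h x (s x) (t x))"
    by (rule smooth_in_cong[OF c o, rotated]) (rule h)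
  then show "\<exists>N. open N \<and> x \<in> N \<and> smooth_in c N (\<lambda>x. h x (s x) (t x))" using o U x by blast
qed

text \<open>The coefficients in a smooth frame are smooth if the inner products with its members are.
  One member of the frame is split off by orthogonalising the others against it.\<close>

lemma smooth_coefficients:
  assumes c: "c \<in> M" and W: "open W"
    and "\<And>j x. j < r \<Longrightarrow> x \<in> fst c \<Longrightarrow> x \<in> W \<Longrightarrow> e j x \<in> fibre E x"
    and "\<And>x. x \<in> fst c \<Longrightarrow> x \<in> W \<Longrightarrow> indep_family (vscale E) r (\<lambda>j. e j x)"
    and "\<And>j k. j < r \<Longrightarrow> k < r \<Longrightarrow> smooth_in c W (\<lambda>x. h x (e j x) (e k x))"
    and "\<And>k. k < r \<Longrightarrow>
      smooth_in c W (\<lambda>x. h x (lincomb (vscale E) r (\<lambda>j. a j x) (\<lambda>j. e j x)) (e k x))"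
    and "j < r"
  shows "smooth_in c W (a j)"
  using assms(3-)
proof (induction r arbitrary: e j)
  case (Suc n)
  let ?v = "\<lambda>x. lincomb (vscale E) (Suc n) (\<lambda>j. a j x) (\<lambda>j. e j x)"
  define e' where "e' j x = hermitian_space.reduce (vscale E) (h x) n (\<lambda>j. e j x) (e j x)" for j x
  have pt: "e n x \<noteq> 0" "h x (e n x) (e n x) \<noteq> 0"
    "j < n \<Longrightarrow> e' j x \<in> fibre E x"
    "indep_family (vscale E) n (\<lambda>j. e' j x)"
    "j < n \<Longrightarrow> k < n \<Longrightarrow> h x (e' j x) (e' k x) =
       h x (e j x) (e k x) - h x (e j x) (e n x) * h x (e n x) (e k x) / h x (e n x) (e n x)"
    "k < n \<Longrightarrow> h x (lincomb (vscale E) n (\<lambda>j. a j x) (\<lambda>j. e' j x)) (e' k x) =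
       h x (?v x) (e k x) - h x (?v x) (e n x) * h x (e n x) (e k x) / h x (e n x) (e n x)"
    "(h x (?v x) (e n x) - (\<Sum>j<n. a j x * h x (e j x) (e n x))) / h x (e n x) (e n x) = a n x"
    if x: "x \<in> fst c" "x \<in> W" for x j k
  proof -
    interpret hermitian_space "vscale E" "fibre E x" "h x" by (rule hermitian_space)
    have e: "e j x \<in> fibre E x" if "j < Suc n" for j using Suc.prems(1) x that by blast
    have ind: "indep_family (vscale E) (Suc n) (\<lambda>j. e j x)" using Suc.prems(2) x by blast
    show 1: "e n x \<noteq> 0" using indep_family_nonzero[OF ind, of n] by simp
    show 2: "h x (e n x) (e n x) \<noteq> 0" using h_definite[of "e n x"] 1 e by simp
    show "e' j x \<in> fibre E x" if "j < n" using that e unfolding e'_def by (intro reduce_closed) auto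
    show "indep_family (vscale E) n (\<lambda>j. e' j x)"
      unfolding e'_def using indep_family_reduce[of n "\<lambda>j. e j x"] e ind 1 by blast
    show "h x (e' j x) (e' k x) =
       h x (e j x) (e k x) - h x (e j x) (e n x) * h x (e n x) (e k x) / h x (e n x) (e n x)"
      if "j < n" "k < n" using that e 1 unfolding e'_def by (subst h_reduce) auto
    have v: "?v x \<in> fibre E x" using e by (intro lincomb_closed)
    have "lincomb (vscale E) n (\<lambda>j. a j x) (\<lambda>j. e' j x) = reduce n (\<lambda>j. e j x) (?v x)"
      unfolding e'_def by (rule reduce_lincomb[symmetric]) (use e 1 in auto)
    then show "h x (lincomb (vscale E) n (\<lambda>j. a j x) (\<lambda>j. e' j x)) (e' k x) =
       h x (?v x) (e k x) - h x (?v x) (e n x) * h x (e n x) (e k x) / h x (e n x) (e n x)" if "k < n"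
      using that e 1 v unfolding e'_def by (simp add: h_reduce)
    have "h x (?v x) (e n x) = (\<Sum>j<Suc n. a j x * h x (e j x) (e n x))"
      by (rule h_lincomb) (use e in auto)
    then show "(h x (?v x) (e n x) - (\<Sum>j<n. a j x * h x (e j x) (e n x))) / h x (e n x) (e n x) = a n x"
      using 2 by simp
  qed
  have quot: "smooth_in c W (\<lambda>x. p x - q x * h x (e n x) (e k x) / h x (e n x) (e n x))"
    if "k < n" "smooth_in c W p" "smooth_in c W q" for p q k
    using that Suc.prems(3)[of n n] Suc.prems(3)[of n k] pt(2)
    by (intro smooth_in_diff smooth_in_divide smooth_in_mult c W) simp_all
  have IH: "smooth_in c W (a j)" if "j < n" for j
  proof (rule Suc.IH[of e'])
    fix j k assume jk: "j < n" "k < n"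
    show "smooth_in c W (\<lambda>x. h x (e' j x) (e' k x))"
      by (rule smooth_in_cong[OF c W _ quot[OF jk(2) Suc.prems(3)[of j k] Suc.prems(3)[of j n]]])
        (use jk pt(5) in simp_all)
  next
    fix k assume k: "k < n"
    show "smooth_in c W (\<lambda>x. h x (lincomb (vscale E) n (\<lambda>j. a j x) (\<lambda>j. e' j x)) (e' k x))"
      by (rule smooth_in_cong[OF c W _ quot[OF k Suc.prems(4)[of k] Suc.prems(4)[of n]]])
        (use k pt(6) in simp_all)
  qed (use pt that in auto)
  show ?case
  proof (cases "j = n")
    case True
    have "smooth_in c W
        (\<lambda>x. (h x (?v x) (e n x) - (\<Sum>j<n. a j x * h x (e j x) (e n x))) / h x (e n x) (e n x))"
      using IH Suc.prems(3)[of _ n] Suc.prems(4)[of n] pt(2)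
      by (intro smooth_in_diff smooth_in_divide smooth_in_mult smooth_in_sum c W) simp_all
    then show ?thesis unfolding True by (rule smooth_in_cong[OF c W, rotated]) (rule pt(7))
  qed (use IH Suc.prems(5) in simp)
qed simp

text \<open>Linear independence is an open condition.\<close>

lemma indep_family_open:
  assumes c: "c \<in> M" and x0: "x0 \<in> fst c"
    and "open W" "x0 \<in> W"
    and "\<And>j x. j < r \<Longrightarrow> x \<in> fst c \<Longrightarrow> x \<in> W \<Longrightarrow> e j x \<in> fibre E x"
    and "\<And>j k. j < r \<Longrightarrow> k < r \<Longrightarrow> smooth_in c W (\<lambda>x. h x (e j x) (e k x))"
    and "indep_family (vscale E) r (\<lambda>j. e j x0)"
  shows "\<exists>N. open N \<and> x0 \<in> N \<and> N \<subseteq> fst c \<inter> W \<and> (\<forall>x\<in>N. indep_family (vscale E) r (\<lambda>j. e j x))"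
  using assms(3-)
proof (induction r arbitrary: e W)
  case 0
  then show ?case using x0 open_chart[OF c]
    by (intro exI[of _ "fst c \<inter> W"]) (auto simp: indep_family_def)
next
  case (Suc n)
  define e' where "e' j x = hermitian_space.reduce (vscale E) (h x) n (\<lambda>j. e j x) (e j x)" for j x
  let ?q = "\<lambda>x. h x (e n x) (e n x)"
  have cont: "isCont ?q x" if "x \<in> fst c" "x \<in> W" for x
    using smooth_in_continuous[OF c Suc.prems(1) that Suc.prems(4)[of n n]] by simp
  define W' where "W' = {x \<in> fst c \<inter> W. ?q x \<noteq> 0}"
  have o: "open (fst c \<inter> W)" using open_chart[OF c] Suc.prems(1) by (rule open_Int)
  have "continuous_on (fst c \<inter> W) ?q" using cont by (simp add: continuous_at_imp_continuous_on)
  then have "open (fst c \<inter> W \<inter> ?q -` (- {0}))"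
    by (rule continuous_open_preimage[OF _ o]) auto
  also have "fst c \<inter> W \<inter> ?q -` (- {0}) = W'" by (auto simp: W'_def)
  finally have oW': "open W'" .
  have pt: "e n x \<noteq> 0" "j < n \<Longrightarrow> e' j x \<in> fibre E x"
    "indep_family (vscale E) n (\<lambda>j. e' j x) \<longleftrightarrow> indep_family (vscale E) (Suc n) (\<lambda>j. e j x)"
    "j < n \<Longrightarrow> k < n \<Longrightarrow> h x (e' j x) (e' k x) =
       h x (e j x) (e k x) - h x (e j x) (e n x) * h x (e n x) (e k x) / h x (e n x) (e n x)"
    if x: "x \<in> W'" for x j k
  proof -
    interpret hermitian_space "vscale E" "fibre E x" "h x" by (rule hermitian_space)
    have e: "e j x \<in> fibre E x" if "j < Suc n" for j using Suc.prems(3) x that by (auto simp: W'_def)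
    show 1: "e n x \<noteq> 0" using x h_zero(1)[of 0] by (auto simp: W'_def)
    show "e' j x \<in> fibre E x" if "j < n" using that e unfolding e'_def by (intro reduce_closed) auto
    show "indep_family (vscale E) n (\<lambda>j. e' j x) \<longleftrightarrow> indep_family (vscale E) (Suc n) (\<lambda>j. e j x)"
      unfolding e'_def using indep_family_reduce[of n "\<lambda>j. e j x"] e 1 by blast
    show "h x (e' j x) (e' k x) =
       h x (e j x) (e k x) - h x (e j x) (e n x) * h x (e n x) (e k x) / h x (e n x) (e n x)"
      if "j < n" "k < n" using that e 1 unfolding e'_def by (subst h_reduce) auto
  qed
  have x0': "x0 \<in> W'"
  proof -
    interpret hermitian_space "vscale E" "fibre E x0" "h x0" by (rule hermitian_space)
    have "e n x0 \<noteq> 0" using indep_family_nonzero[OF Suc.prems(5), of n] by simp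
    then show ?thesis
      using h_definite[of "e n x0"] Suc.prems(2,3) x0 by (simp add: W'_def)
  qed
  have "\<exists>N. open N \<and> x0 \<in> N \<and> N \<subseteq> fst c \<inter> W' \<and> (\<forall>x\<in>N. indep_family (vscale E) n (\<lambda>j. e' j x))"
  proof (rule Suc.IH[OF oW' x0'])
    fix j k assume jk: "j < n" "k < n"
    have sub: "smooth_in c W' (\<lambda>x. h x (e i x) (e l x))" if "i < Suc n" "l < Suc n" for i l
      by (rule smooth_in_subset[OF Suc.prems(4)[OF that]]) (auto simp: W'_def)
    have "smooth_in c W' (\<lambda>x. h x (e j x) (e k x) - h x (e j x) (e n x) * h x (e n x) (e k x) / ?q x)"
      using jk by (intro smooth_in_diff smooth_in_divide smooth_in_mult c oW' sub) (simp_all add: W'_def)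
    then show "smooth_in c W' (\<lambda>x. h x (e' j x) (e' k x))"
      by (rule smooth_in_cong[OF c oW', rotated]) (use pt(4) jk in simp)
  qed (use pt x0' Suc.prems(5) in auto)
  then obtain N where N: "open N" "x0 \<in> N" "N \<subseteq> fst c \<inter> W'"
    "\<forall>x\<in>N. indep_family (vscale E) n (\<lambda>j. e' j x)" by blast
  then have "\<forall>x\<in>N. indep_family (vscale E) (Suc n) (\<lambda>j. e j x)" using pt(3) by blast
  moreover have "N \<subseteq> fst c \<inter> W" using N(3) by (auto simp: W'_def)
  ultimately show ?case using N(1,2) by blast
qed

text \<open>A smooth subbundle of \<open>E\<close>, with frames that consist of smooth local sections of \<open>E\<close>.\<close>

definition smooth_subbundle :: "('m, 'v) vbundle \<Rightarrow> bool" where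
  "smooth_subbundle V \<longleftrightarrow> vscale V = vscale E \<and> (\<forall>x. fibre V x \<subseteq> fibre E x) \<and>
     (\<Union>F\<in>frames V. fst F) = UNIV \<and>
     (\<forall>(U, e) \<in> frames V. open U \<and>
        (\<forall>x\<in>U. basis_of (vscale E) (rank V) (fibre V x) (\<lambda>j. e j x)) \<and>
        (\<forall>j<rank V. section_on smooth_on M E U (e j)))"

lemma smooth_subbundleD:
  assumes "smooth_subbundle V"
  shows "vscale V = vscale E" "fibre V x \<subseteq> fibre E x"
    "(U, e) \<in> frames V \<Longrightarrow> open U"
    "(U, e) \<in> frames V \<Longrightarrow> x \<in> U \<Longrightarrow> basis_of (vscale E) (rank V) (fibre V x) (\<lambda>j. e j x)"
    "(U, e) \<in> frames V \<Longrightarrow> c \<in> M \<Longrightarrow> j < rank V \<Longrightarrow> smooth_field c E U (e j)"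
    "\<exists>U e. (U, e) \<in> frames V \<and> x \<in> U"
proof -
  note * = assms[unfolded smooth_subbundle_def section_on_smooth_iff]
  then have 1: "open U \<and> (\<forall>x\<in>U. basis_of (vscale E) (rank V) (fibre V x) (\<lambda>j. e j x)) \<and>
        (\<forall>j<rank V. \<forall>c\<in>M. smooth_field c E U (e j))" if "(U, e) \<in> frames V"
    using that by (elim conjE) (drule (1) bspec, simp)
  show "vscale V = vscale E" "fibre V x \<subseteq> fibre E x"
    using * by simp_all
  show "(U, e) \<in> frames V \<Longrightarrow> open U"
    "(U, e) \<in> frames V \<Longrightarrow> x \<in> U \<Longrightarrow> basis_of (vscale E) (rank V) (fibre V x) (\<lambda>j. e j x)"
    "(U, e) \<in> frames V \<Longrightarrow> c \<in> M \<Longrightarrow> j < rank V \<Longrightarrow> smooth_field c E U (e j)"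
    using 1 by simp_all
  have "x \<in> (\<Union>F\<in>frames V. fst F)" using * by simp
  then show "\<exists>U e. (U, e) \<in> frames V \<and> x \<in> U" by (metis UN_E prod.collapse)
qed

text \<open>Smoothness in \<open>V\<close> can be tested with the metric.\<close>

lemma smooth_field_subbundleI:
  assumes V: "smooth_subbundle V" and c: "c \<in> M" and W: "open W"
    and w: "\<And>x. x \<in> fst c \<Longrightarrow> x \<in> W \<Longrightarrow> w x \<in> fibre V x"
    and h: "\<And>U e k. (U, e) \<in> frames V \<Longrightarrow> k < rank V \<Longrightarrow> smooth_in c (U \<inter> W) (\<lambda>x. h x (w x) (e k x))"
  shows "smooth_field c V W w"
  unfolding smooth_field_def
proof (intro conjI ballI)
  show "w x \<in> fibre V x" if "x \<in> fst c \<inter> W" for x using w that by auto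
  fix F assume "F \<in> frames V"
  moreover obtain U e where F: "F = (U, e)" by (cases F)
  ultimately have U: "(U, e) \<in> frames V" by simp
  note D = smooth_subbundleD[OF V]
  have o: "open (U \<inter> W)" using D(3)[OF U] W by (rule open_Int)
  have "smooth_in c (U \<inter> W) (\<lambda>x. component V e j x (w x))" if j: "j < rank V" for j
  proof (rule smooth_coefficients[OF c o _ _ _ _ j, of e])
    have sf: "smooth_field c E (U \<inter> W) (e j)" if "j < rank V" for j
      by (rule smooth_field_subset[OF D(5)[OF U c that]]) auto
    show "e j x \<in> fibre E x" if "j < rank V" "x \<in> fst c" "x \<in> U \<inter> W" for j x
      using smooth_field_fibre[OF sf] that by blast
    show "indep_family (vscale E) (rank V) (\<lambda>j. e j x)" if "x \<in> fst c" "x \<in> U \<inter> W" for x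
      using D(4)[OF U, of x] that basis_of_iff[OF vector_space_axioms] by blast
    show "smooth_in c (U \<inter> W) (\<lambda>x. h x (e j x) (e k x))" if "j < rank V" "k < rank V" for j k
      by (rule smooth_in_metric[OF c o sf sf]) fact+
    fix k assume k: "k < rank V"
    show "smooth_in c (U \<inter> W) (\<lambda>x. h x (lincomb (vscale E) (rank V)
        (\<lambda>j. component V e j x (w x)) (\<lambda>j. e j x)) (e k x))"
    proof (rule smooth_in_cong[OF c o _ h[OF U k]])
      fix x assume x: "x \<in> fst c" "x \<in> U \<inter> W"
      obtain a where a: "w x = lincomb (vscale E) (rank V) a (\<lambda>j. e j x)"
        using D(4)[OF U, of x] w x basis_of_iff[OF vector_space_axioms] by blast
      have "component V e j x (w x) = a j" if "j < rank V" for j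
        unfolding component_def a D(1)
        using basis_of_representation[OF vector_space_axioms D(4)[OF U] that, of x] x by simp
      then show "h x (w x) (e k x) = h x (lincomb (vscale E) (rank V)
          (\<lambda>j. component V e j x (w x)) (\<lambda>j. e j x)) (e k x)"
        by (simp add: a lincomb_def)
    qed
  qed
  then show "case F of (U, e) \<Rightarrow> \<forall>j<rank V. smooth_in c (U \<inter> W) (\<lambda>x. component V e j x (w x))"
    by (simp add: F)
qed

lemma smooth_subbundle_bundle:
  assumes V: "smooth_subbundle V"
  shows "smooth_vector_bundle M V"
proof -
  note D = smooth_subbundleD[OF V]
  have "section_on smooth_on M V U (e j)" if U: "(U, e) \<in> frames V" "j < rank V" for U e j
    unfolding section_on_smooth_iff
  proof
    fix c assume c: "c \<in> M"
    show "smooth_field c V U (e j)"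
    proof (rule smooth_field_subbundleI[OF V c D(3)[OF U(1)]])
      show "e j x \<in> fibre V x" if "x \<in> fst c" "x \<in> U" for x
        using D(4)[OF U(1) that(2)] span_base[of "e j x"] U(2) by (auto simp: basis_of_def)
      fix U' e' k assume U': "(U', e') \<in> frames V" "k < rank V"
      have o: "open (U' \<inter> U)" using D(3)[OF U'(1)] D(3)[OF U(1)] by (rule open_Int)
      show "smooth_in c (U' \<inter> U) (\<lambda>x. h x (e j x) (e' k x))"
        by (rule smooth_in_metric[OF c o smooth_field_subset[OF D(5)[OF U(1) c U(2)]]
              smooth_field_subset[OF D(5)[OF U'(1) c U'(2)]]]) auto
    qed
  qed
  then show ?thesis
    using V vector_space_axioms unfolding vector_bundle_def smooth_subbundle_def by auto
qed

lemma smooth_field_subbundleD: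
  assumes V: "smooth_subbundle V" and c: "c \<in> M" and W: "open W" and s: "smooth_field c V W s"
  shows "smooth_field c E W s"
proof (rule smooth_field_local[OF c])
  note D = smooth_subbundleD[OF V]
  interpret V: smooth_bundle M V by unfold_locales (rule smooth_subbundle_bundle[OF V])
  fix x assume x: "x \<in> fst c" "x \<in> W"
  obtain U e where U: "(U, e) \<in> frames V" "x \<in> U" using D(6) by blast
  have o: "open (U \<inter> W)" using D(3)[OF U(1)] W by (rule open_Int)
  have "smooth_field c E (U \<inter> W)
      (\<lambda>x. lincomb (vscale E) (rank V) (\<lambda>j. component V e j x (s x)) (\<lambda>j. e j x))"
    by (rule smooth_field_lincomb[OF c o smooth_field_component[OF s U(1)]
          smooth_field_subset[OF D(5)[OF U(1) c]]]) auto
  then have "smooth_field c E (U \<inter> W) s"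
    by (rule smooth_field_cong[OF c o, rotated])
      (use V.lincomb_component[OF U(1)] smooth_field_fibre[OF s] D(1) in auto)
  then show "\<exists>N. open N \<and> x \<in> N \<and> smooth_field c E N s" using o U x by blast
qed

lemma smooth_field_into_subbundle:
  assumes V: "smooth_subbundle V" and c: "c \<in> M" and W: "open W" and s: "smooth_field c E W s"
    and w: "\<And>x. x \<in> fst c \<Longrightarrow> x \<in> W \<Longrightarrow> s x \<in> fibre V x"
  shows "smooth_field c V W s"
proof (rule smooth_field_subbundleI[OF V c W w])
  fix U e k assume U: "(U, e) \<in> frames V" "k < rank V"
  have o: "open (U \<inter> W)" using smooth_subbundleD(3)[OF V U(1)] W by (rule open_Int)
  show "smooth_in c (U \<inter> W) (\<lambda>x. h x (s x) (e k x))"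
    by (rule smooth_in_metric[OF c o smooth_field_subset[OF s]
          smooth_field_subset[OF smooth_subbundleD(5)[OF V U(1) c U(2)]]]) auto
qed

end

section \<open>The orthogonal complement and the projections\<close>

text \<open>A hermitian bundle \<open>E\<close> with a smooth subbundle \<open>S\<close>, its orthogonal complement and the
  orthogonal projections onto both.\<close>

locale hermitian_subbundle = hermitian_bundle M E h
  for M :: "('m::t2_space, 'n::finite) atlas" and E :: "('m, 'v::ab_group_add) vbundle" and h +
  fixes S :: "('m, 'v) vbundle"
  assumes S: "smooth_subbundle S"
begin

abbreviation "Sperp \<equiv> orth_complement M E h S"
abbreviation "PS \<equiv> projection S Sperp"
abbreviation "Pperp \<equiv> projection Sperp S"

lemma Sperp_simps [simp]:
  "vscale Sperp = vscale E" "rank Sperp = rank E - rank S"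
  "fibre Sperp x = orth_fibre E h S x" "vscale S = vscale E"
  using smooth_subbundleD(1)[OF S] by (simp_all add: orth_complement_def)

lemma S_sub: "v \<in> fibre S x \<Longrightarrow> v \<in> fibre E x"
  using smooth_subbundleD(2)[OF S] by blast

lemma orth_sub: "v \<in> orth_fibre E h S x \<Longrightarrow> v \<in> fibre E x"
  by (simp add: orth_fibre_def)

lemma orth_fibre_eq: "orth_fibre E h S x = hermitian_space.orth (fibre E x) (h x) (fibre S x)"
  using hermitian_space.orth_def[OF hermitian_space, of x] by (simp add: orth_fibre_def)

sublocale S: smooth_bundle M S
  rewrites "vscale S \<equiv> vscale E"
  by unfold_locales (simp_all add: smooth_subbundle_bundle[OF S])

lemma basis_S: obtains b where "basis_of (vscale E) (rank S) (fibre S x) b"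
proof -
  obtain U e where "(U, e) \<in> frames S" "x \<in> U" using smooth_subbundleD(6)[OF S] by blast
  then show ?thesis using smooth_subbundleD(4)[OF S] that by blast
qed

lemma subspace_orth_fibre: "subspace (orth_fibre E h S x)"
  unfolding orth_fibre_eq using hermitian_space.subspace_orth[OF hermitian_space] S_sub by blast

lemma orth_closed [simp, intro]:
  "0 \<in> orth_fibre E h S x"
  "u \<in> orth_fibre E h S x \<Longrightarrow> v \<in> orth_fibre E h S x \<Longrightarrow> u + v \<in> orth_fibre E h S x"
  "u \<in> orth_fibre E h S x \<Longrightarrow> v \<in> orth_fibre E h S x \<Longrightarrow> u - v \<in> orth_fibre E h S x"
  "u \<in> orth_fibre E h S x \<Longrightarrow> vscale E a u \<in> orth_fibre E h S x"
  using subspace_orth_fibre by (auto intro: subspace_0 subspace_add subspace_diff subspace_scale)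

lemma decomposition: "v \<in> fibre E x \<Longrightarrow> \<exists>!w. w \<in> fibre S x \<and> v - w \<in> orth_fibre E h S x"
  using basis_S[of x] hermitian_space.orth_decomposition[OF hermitian_space] S_sub
  unfolding orth_fibre_eq by (metis subsetI)

lemma PS_in: "v \<in> fibre E x \<Longrightarrow> PS x v \<in> fibre S x"
  and PS_orth: "v \<in> fibre E x \<Longrightarrow> v - PS x v \<in> orth_fibre E h S x"
  using theI'[OF decomposition, of v x] by (simp_all add: projection_def)

lemma PS_eqI: "w \<in> fibre S x \<Longrightarrow> v - w \<in> orth_fibre E h S x \<Longrightarrow> PS x v = w"
proof -
  assume w: "w \<in> fibre S x" "v - w \<in> orth_fibre E h S x"
  then have "v \<in> fibre E x" using fibre_closed(2)[OF orth_sub S_sub, of "v - w" x w] by simp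
  then show ?thesis using the1_equality[OF decomposition] w by (simp add: projection_def)
qed

lemma Pperp_eq: assumes "v \<in> fibre E x" shows "Pperp x v = v - PS x v"
  unfolding projection_def[of Sperp]
proof (rule the_equality)
  show "v - PS x v \<in> fibre Sperp x \<and> v - (v - PS x v) \<in> fibre S x"
    using PS_in PS_orth assms by simp
  fix w assume w: "w \<in> fibre Sperp x \<and> v - w \<in> fibre S x"
  then have "PS x v = v - w" by (intro PS_eqI) simp_all
  then show "w = v - PS x v" by simp
qed

lemma Pperp_in: "v \<in> fibre E x \<Longrightarrow> Pperp x v \<in> orth_fibre E h S x"
  by (simp add: Pperp_eq PS_orth)

lemma PS_id: "v \<in> fibre S x \<Longrightarrow> PS x v = v"
  by (rule PS_eqI) simp_all

lemma PS_add: "u \<in> fibre E x \<Longrightarrow> v \<in> fibre E x \<Longrightarrow> PS x (u + v) = PS x u + PS x v"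
  using orth_closed(2)[OF PS_orth PS_orth, of u x v] PS_in by (intro PS_eqI) (simp_all add: algebra_simps)

lemma PS_scale: "u \<in> fibre E x \<Longrightarrow> PS x (vscale E a u) = vscale E a (PS x u)"
  using orth_closed(4)[OF PS_orth, of u x a] PS_in
  by (intro PS_eqI) (simp_all add: scale_right_diff_distrib)

lemma Pperp_add: "u \<in> fibre E x \<Longrightarrow> v \<in> fibre E x \<Longrightarrow> Pperp x (u + v) = Pperp x u + Pperp x v"
  by (simp add: Pperp_eq PS_add)

lemma Pperp_scale: "u \<in> fibre E x \<Longrightarrow> Pperp x (vscale E a u) = vscale E a (Pperp x u)"
  by (simp add: Pperp_eq PS_scale scale_right_diff_distrib)

lemma h_orth: "u \<in> orth_fibre E h S x \<Longrightarrow> s \<in> fibre S x \<Longrightarrow> h x u s = 0"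
  "u \<in> orth_fibre E h S x \<Longrightarrow> s \<in> fibre S x \<Longrightarrow> h x s u = 0"
proof -
  show 1: "u \<in> orth_fibre E h S x \<Longrightarrow> s \<in> fibre S x \<Longrightarrow> h x u s = 0" by (simp add: orth_fibre_def)
  show "u \<in> orth_fibre E h S x \<Longrightarrow> s \<in> fibre S x \<Longrightarrow> h x s u = 0"
    using hermitian_space.h_sym[OF hermitian_space, of u x s] orth_sub S_sub 1 by simp
qed

lemma h_PS:
  assumes v: "v \<in> fibre E x" and s: "s \<in> fibre S x"
  shows "h x (PS x v) s = h x v s" "h x s (PS x v) = h x s v"
proof -
  interpret hermitian_space "vscale E" "fibre E x" "h x" by (rule hermitian_space)
  show "h x (PS x v) s = h x v s"
    using h_orth(1)[OF PS_orth[OF v] s] S_sub[OF PS_in[OF v]] S_sub[OF s] v by (simp add: h_diff)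
  show "h x s (PS x v) = h x s v"
    using h_orth(2)[OF PS_orth[OF v] s] S_sub[OF PS_in[OF v]] S_sub[OF s] v by (simp add: h_diff_right)
qed

lemma h_Pperp:
  assumes v: "v \<in> fibre E x" and t: "t \<in> orth_fibre E h S x"
  shows "h x (Pperp x v) t = h x v t"
proof -
  interpret hermitian_space "vscale E" "fibre E x" "h x" by (rule hermitian_space)
  show ?thesis
    using h_orth(2)[OF t PS_in[OF v]] S_sub[OF PS_in[OF v]] orth_sub[OF t] v
    by (simp add: Pperp_eq h_diff)
qed

lemma smooth_field_PS:
  assumes c: "c \<in> M" and W: "open W" and s: "smooth_field c E W s"
  shows "smooth_field c S W (\<lambda>x. PS x (s x))"
proof (rule smooth_field_subbundleI[OF S c W])
  show "PS x (s x) \<in> fibre S x" if "x \<in> fst c" "x \<in> W" for x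
    using PS_in smooth_field_fibre[OF s that] by blast
  fix U e k assume U: "(U, e) \<in> frames S" "k < rank S"
  have o: "open (U \<inter> W)" using smooth_subbundleD(3)[OF S U(1)] W by (rule open_Int)
  have "smooth_in c (U \<inter> W) (\<lambda>x. h x (s x) (e k x))"
    by (rule smooth_in_metric[OF c o smooth_field_subset[OF s]
          smooth_field_subset[OF smooth_subbundleD(5)[OF S U(1) c U(2)]]]) auto
  then show "smooth_in c (U \<inter> W) (\<lambda>x. h x (PS x (s x)) (e k x))"
  proof (rule smooth_in_cong[OF c o, rotated])
    fix x assume x: "x \<in> fst c" "x \<in> U \<inter> W"
    then show "h x (s x) (e k x) = h x (PS x (s x)) (e k x)"
      using h_PS(1)[OF smooth_field_fibre[OF s], of x "e k x"] S.frame(4)[OF U(1) _ U(2)] by simp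
  qed
qed

text \<open>Near a given point, a frame of \<open>S\<close> and constant combinations of a frame of \<open>E\<close>
  together form a frame of \<open>E\<close>; the components of the latter orthogonal to \<open>S\<close> then form a
  frame of the orthogonal complement.\<close>

lemma ex_orth_frame: "\<exists>N p. (N, p) \<in> frames Sperp \<and> x0 \<in> N"
proof -
  note vs = vector_space_axioms
  obtain U e where U: "(U, e) \<in> frames S" "x0 \<in> U" using smooth_subbundleD(6)[OF S] by blast
  obtain U' f where U': "(U', f) \<in> frames E" "x0 \<in> U'" by (rule ex_frame)
  obtain c where c: "c \<in> M" "x0 \<in> fst c" by (rule ex_chart)
  note bS = smooth_subbundleD(4)[OF S U(1)] and bE = frame(2)[OF U'(1)]
  have e_in: "e j x \<in> fibre E x" if "j < rank S" "x \<in> U" for j x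
    using S.frame(4)[OF U(1) that(2,1)] S_sub by blast
  have "indep_family (vscale E) (rank S) (\<lambda>j. e j x0)"
    using bS[OF U(2)] basis_of_iff[OF vs] by blast
  then obtain b' where b': "rank S \<le> rank E" "basis_of (vscale E) (rank E) (fibre E x0) b'"
    "\<And>j. j < rank S \<Longrightarrow> b' j = e j x0"
    using indep_family_extend[OF vs bE[OF U'(2)], of "rank S" "\<lambda>j. e j x0"] e_in U(2) by metis
  define a where "a j k = component E f k x0 (b' j)" for j k
  define b where "b j = (if j < rank S then e j
      else (\<lambda>x. lincomb (vscale E) (rank E) (a j) (\<lambda>k. f k x)))" for j
  let ?W = "U \<inter> U'"
  have oW: "open ?W" using S.frame(1)[OF U(1)] frame(1)[OF U'(1)] by (rule open_Int)
  have b_smooth: "smooth_field c E ?W (b j)" if c: "c \<in> M" for c j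
  proof (cases "j < rank S")
    case True
    then show ?thesis
      using smooth_field_subset[OF smooth_subbundleD(5)[OF S U(1) c True]] by (simp add: b_def)
  next
    case False
    have "smooth_field c E ?W (\<lambda>x. lincomb (vscale E) (rank E) (\<lambda>k. a j k) (\<lambda>k. f k x))"
      by (rule smooth_field_lincomb[OF c oW smooth_in_const[OF c oW]
            smooth_field_subset[OF frame(3)[OF U'(1) c]]]) auto
    then show ?thesis using False by (simp add: b_def)
  qed
  have b_in: "b j x \<in> fibre E x" if "x \<in> ?W" for j x
  proof -
    obtain c where "c \<in> M" "x \<in> fst c" by (rule ex_chart)
    then show ?thesis using smooth_field_fibre[OF b_smooth] that by blast
  qed
  have b0: "b j x0 = b' j" if "j < rank E" for j
  proof (cases "j < rank S")
    case False
    have "b' j \<in> fibre E x0"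
      using b'(2) span_base[of "b' j" "b' ` {..<rank E}"] that by (auto simp: basis_of_def)
    then show ?thesis using False lincomb_component[OF U'] by (simp add: b_def a_def[abs_def])
  qed (simp add: b_def b'(3))
  have b_ind: "indep_family (vscale E) (rank E) (\<lambda>j. b j x0)"
  proof -
    have "lincomb (vscale E) (rank E) d (\<lambda>j. b j x0) = lincomb (vscale E) (rank E) d b'" for d
      by (simp add: lincomb_def b0)
    then show ?thesis using b'(2) basis_of_iff[OF vs] by (simp add: indep_family_def)
  qed
  have b_h: "smooth_in c ?W (\<lambda>x. h x (b j x) (b k x))" for j k
    by (rule smooth_in_metric[OF c(1) oW b_smooth b_smooth]) (rule c(1))+
  have "x0 \<in> ?W" using U(2) U'(2) by simp
  from indep_family_open[OF c oW this b_in b_h b_ind] obtain N where N: "open N" "x0 \<in> N" "N \<subseteq> fst c \<inter> ?W"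
    "\<forall>x\<in>N. indep_family (vscale E) (rank E) (\<lambda>j. b j x)"
    by blast
  define p where "p j x = b (rank S + j) x - PS x (b (rank S + j) x)" for j x
  have "basis_of (vscale E) (rank E - rank S) (orth_fibre E h S x) (\<lambda>j. p j x)" if x: "x \<in> N" for x
  proof -
    have xW: "x \<in> ?W" using x N(3) by blast
    have 1: "basis_of (vscale E) (rank E) (fibre E x) (\<lambda>j. b j x)"
      using basis_of_indep_family[OF vs bE] N(4) x xW b_in by blast
    have 2: "basis_of (vscale E) (rank S) (fibre S x) (\<lambda>j. b j x)"
    proof -
      have "(\<lambda>j. b j x) ` {..<rank S} = (\<lambda>j. e j x) ` {..<rank S}"
        by (rule image_cong) (simp_all add: b_def)
      moreover have "inj_on (\<lambda>j. b j x) {..<rank S} \<longleftrightarrow> inj_on (\<lambda>j. e j x) {..<rank S}"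
        by (rule inj_on_cong) (simp add: b_def)
      ultimately show ?thesis using bS[of x] xW by (simp add: basis_of_def)
    qed
    show ?thesis
      unfolding orth_fibre_eq
    proof (rule hermitian_space.basis_of_orth[OF hermitian_space 1 2 b'(1)])
      show "p j x \<in> hermitian_space.orth (fibre E x) (h x) (fibre S x) \<and> b (rank S + j) x - p j x \<in> fibre S x" for j
        using PS_in[OF b_in[OF xW]] PS_orth[OF b_in[OF xW]] by (simp add: p_def orth_fibre_eq)
    qed
  qed
  moreover have "section_on smooth_on M E N (p j)" for j
    unfolding section_on_smooth_iff
  proof
    fix c assume c: "c \<in> M"
    have bs: "smooth_field c E N (b (rank S + j))"
      by (rule smooth_field_subset[OF b_smooth[OF c]]) (use N(3) in blast)
    show "smooth_field c E N (p j)"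
      unfolding p_def[abs_def]
      by (rule smooth_field_diff[OF c N(1) bs
            smooth_field_subbundleD[OF S c N(1) smooth_field_PS[OF c N(1) bs]]])
  qed
  ultimately have "(N, p) \<in> frames Sperp" using N(1) by (simp add: orth_complement_def)
  then show ?thesis using N(2) by blast
qed

lemma Sperp: "smooth_subbundle Sperp"
  unfolding smooth_subbundle_def
proof (intro conjI allI)
  show "fibre Sperp x \<subseteq> fibre E x" for x using orth_sub by auto
  have "x \<in> (\<Union>F\<in>frames Sperp. fst F)" for x using ex_orth_frame[of x] by force
  then show "(\<Union>F\<in>frames Sperp. fst F) = UNIV" by blast
qed (simp_all add: orth_complement_def)

sublocale Sperp: smooth_bundle M Sperp
  rewrites "vscale Sperp \<equiv> vscale E"
  by unfold_locales (simp_all add: smooth_subbundle_bundle[OF Sperp])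

lemma smooth_field_Pperp:
  assumes c: "c \<in> M" and W: "open W" and s: "smooth_field c E W s"
  shows "smooth_field c Sperp W (\<lambda>x. Pperp x (s x))"
proof (rule smooth_field_into_subbundle[OF Sperp c W])
  have "smooth_field c E W (\<lambda>x. s x - PS x (s x))"
    by (intro smooth_field_diff[OF c W s] smooth_field_subbundleD[OF S c W] smooth_field_PS[OF c W s])
  then show "smooth_field c E W (\<lambda>x. Pperp x (s x))"
    by (rule smooth_field_cong[OF c W, rotated]) (simp add: Pperp_eq smooth_field_fibre[OF s])
  show "Pperp x (s x) \<in> fibre Sperp x" if "x \<in> fst c" "x \<in> W" for x
    using Pperp_in[OF smooth_field_fibre[OF s that]] by simp
qed

lemma A1_E_fibre: "\<omega> \<in> A1 M E \<Longrightarrow> X \<in> tangent_space M x \<Longrightarrow> \<omega> x X \<in> fibre E x"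
  unfolding A1_iff by blast

lemma A1_PS: assumes \<omega>: "\<omega> \<in> A1 M E" shows "(\<lambda>x X. PS x (\<omega> x X)) \<in> A1 M S"
  unfolding A1_iff
proof (intro conjI allI ballI)
  fix x X assume X: "X \<in> tangent_space M x"
  show "PS x (\<omega> x X) \<in> fibre S x" by (rule PS_in[OF A1_E_fibre[OF \<omega> X]])
  show "PS x (\<omega> x (tadd X Y)) = PS x (\<omega> x X) + PS x (\<omega> x Y)" if Y: "Y \<in> tangent_space M x" for Y
  proof -
    have "\<omega> x (tadd X Y) = \<omega> x X + \<omega> x Y" using \<omega> X Y unfolding A1_iff by blast
    then show ?thesis using PS_add A1_E_fibre[OF \<omega>] X Y by simp
  qed
  show "PS x (\<omega> x (tscale a X)) = vscale S (complex_of_real a) (PS x (\<omega> x X))" for a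
  proof -
    have "\<omega> x (tscale a X) = vscale E (complex_of_real a) (\<omega> x X)" using \<omega> X unfolding A1_iff by blast
    then show ?thesis using PS_scale A1_E_fibre[OF \<omega> X] by simp
  qed
next
  fix c u assume "c \<in> M"
  then show "smooth_field c S UNIV (\<lambda>x. PS x (\<omega> x (tvec M c x u)))"
    using \<omega> unfolding A1_iff by (intro smooth_field_PS) simp_all
qed

lemma A1_Pperp: assumes \<omega>: "\<omega> \<in> A1 M E" shows "(\<lambda>x X. Pperp x (\<omega> x X)) \<in> A1 M Sperp"
  unfolding A1_iff
proof (intro conjI allI ballI)
  fix x X assume X: "X \<in> tangent_space M x"
  show "Pperp x (\<omega> x X) \<in> fibre Sperp x" using Pperp_in[OF A1_E_fibre[OF \<omega> X]] by simp
  show "Pperp x (\<omega> x (tadd X Y)) = Pperp x (\<omega> x X) + Pperp x (\<omega> x Y)" if Y: "Y \<in> tangent_space M x" for Y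
  proof -
    have "\<omega> x (tadd X Y) = \<omega> x X + \<omega> x Y" using \<omega> X Y unfolding A1_iff by blast
    then show ?thesis using Pperp_add A1_E_fibre[OF \<omega>] X Y by simp
  qed
  show "Pperp x (\<omega> x (tscale a X)) = vscale Sperp (complex_of_real a) (Pperp x (\<omega> x X))" for a
  proof -
    have "\<omega> x (tscale a X) = vscale E (complex_of_real a) (\<omega> x X)" using \<omega> X unfolding A1_iff by blast
    then show ?thesis using Pperp_scale A1_E_fibre[OF \<omega> X] by simp
  qed
next
  fix c u assume "c \<in> M"
  then show "smooth_field c Sperp UNIV (\<lambda>x. Pperp x (\<omega> x (tvec M c x u)))"
    using \<omega> unfolding A1_iff by (intro smooth_field_Pperp) simp_all
qed

lemma A0_S: "\<xi> \<in> A0 M S \<Longrightarrow> \<xi> \<in> A0 M E"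
  unfolding A0_iff S.A0_iff using smooth_field_subbundleD[OF S] by blast

lemma A0_Sperp: "\<xi> \<in> A0 M Sperp \<Longrightarrow> \<xi> \<in> A0 M E"
  unfolding A0_iff Sperp.A0_iff using smooth_field_subbundleD[OF Sperp] by blast

end

section \<open>Chern connections of subbundles\<close>

lemma connectionD:
  assumes "connection M V D" "\<xi> \<in> A0 M V"
  shows "D \<xi> \<in> A1 M V"
    "\<eta> \<in> A0 M V \<Longrightarrow> X \<in> tangent_space M x \<Longrightarrow> D (\<lambda>x. \<xi> x + \<eta> x) x X = D \<xi> x X + D \<eta> x X"
    "fun_on smooth_on M UNIV f \<Longrightarrow> X \<in> tangent_space M x \<Longrightarrow>
      D (\<lambda>x. vscale V (f x) (\<xi> x)) x X = vscale V (differential M f x X) (\<xi> x) + vscale V (f x) (D \<xi> x X)"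
proof -
  note * = assms(1)[unfolded connection_def form_eq_def]
  note add = bspec[OF conjunct1[OF conjunct2[OF *]] assms(2)]
  note leibniz = conjunct2[OF conjunct2[OF *]]
  show "D \<xi> \<in> A1 M V" by (rule bspec[OF conjunct1[OF *] assms(2)])
  show "D (\<lambda>x. \<xi> x + \<eta> x) x X = D \<xi> x X + D \<eta> x X" if "\<eta> \<in> A0 M V" "X \<in> tangent_space M x"
    by (rule bspec[OF spec[OF bspec[OF add that(1)]] that(2)])
  show "D (\<lambda>x. vscale V (f x) (\<xi> x)) x X = vscale V (differential M f x X) (\<xi> x) + vscale V (f x) (D \<xi> x X)"
    if "fun_on smooth_on M UNIV f" "X \<in> tangent_space M x"
    by (rule bspec[OF spec[OF mp[OF bspec[OF spec[OF leibniz] assms(2)] that(1)]] that(2)])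
qed

lemma chern_connectionD:
  assumes "chern_connection M V h D"
  shows "connection M V D"
    "\<xi> \<in> A0 M V \<Longrightarrow> \<eta> \<in> A0 M V \<Longrightarrow> X \<in> tangent_space M x \<Longrightarrow>
      differential M (\<lambda>y. h y (\<xi> y) (\<eta> y)) x X = h x (D \<xi> x X) (\<eta> x) + h x (\<xi> x) (D \<eta> x X)"
    "\<xi> \<in> A0 M V \<Longrightarrow> (U, e) \<in> frames V \<Longrightarrow> x \<in> U \<Longrightarrow> X \<in> tangent_space M x \<Longrightarrow>
      part01 V (D \<xi>) x X = dbar_in_frame M V e \<xi> x X"
proof -
  note * = assms(1)[unfolded chern_connection_def]
  note metric = conjunct1[OF conjunct2[OF *]] and dbar = conjunct2[OF conjunct2[OF *]]
  show "connection M V D" by (rule conjunct1[OF *])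
  show "differential M (\<lambda>y. h y (\<xi> y) (\<eta> y)) x X = h x (D \<xi> x X) (\<eta> x) + h x (\<xi> x) (D \<eta> x X)"
    if "\<xi> \<in> A0 M V" "\<eta> \<in> A0 M V" "X \<in> tangent_space M x"
    by (rule bspec[OF spec[OF bspec[OF bspec[OF metric that(1)] that(2)]] that(3)])
  show "part01 V (D \<xi>) x X = dbar_in_frame M V e \<xi> x X"
    if "\<xi> \<in> A0 M V" "(U, e) \<in> frames V" "x \<in> U" "X \<in> tangent_space M x"
    using bspec[OF bspec[OF dbar that(1)] that(2)] that(3,4) by simp
qed

text \<open>The difference \<open>\<delta>\<close> of two Chern connections satisfies \<open>\<delta>(JX) = i \<delta>(X)\<close>, as its (0,1)-part
  vanishes, while \<open>\<delta>(X)\<close> and \<open>\<delta>(JX)\<close> are skew with respect to the metric. Hence it is zero.\<close>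

lemma (in smooth_bundle) chern_connection_unique:
  assumes D1: "chern_connection M V h D1" and D2: "chern_connection M V h D2"
    and h: "\<And>x. hermitian_space (vscale V) (fibre V x) (h x)"
    and \<xi>: "\<xi> \<in> A0 M V" and X: "X \<in> tangent_space M x"
  shows "D1 \<xi> x X = D2 \<xi> x X"
proof -
  interpret h: hermitian_space "vscale V" "fibre V x" "h x" by (rule h)
  define \<delta> where "\<delta> \<eta> Y = D1 \<eta> x Y - D2 \<eta> x Y" for \<eta> Y
  have JX: "tJ X \<in> tangent_space M x" by (rule tJ_tangent[OF X])
  have in1: "D1 \<eta> x Y \<in> fibre V x" "D2 \<eta> x Y \<in> fibre V x"
    if "\<eta> \<in> A0 M V" "Y \<in> tangent_space M x" for \<eta> Y
    using connectionD(1)[OF chern_connectionD(1)[OF D1] that(1)]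
      connectionD(1)[OF chern_connectionD(1)[OF D2] that(1)] that(2) unfolding A1_iff by blast+
  have \<delta>_in: "\<delta> \<eta> Y \<in> fibre V x" if "\<eta> \<in> A0 M V" "Y \<in> tangent_space M x" for \<eta> Y
    using in1 that by (simp add: \<delta>_def)
  have skew: "h x (\<delta> \<eta> Y) (\<zeta> x) + h x (\<eta> x) (\<delta> \<zeta> Y) = 0"
    if "\<eta> \<in> A0 M V" "\<zeta> \<in> A0 M V" "Y \<in> tangent_space M x" for \<eta> \<zeta> Y
  proof -
    have "h x (D1 \<eta> x Y) (\<zeta> x) + h x (\<eta> x) (D1 \<zeta> x Y) = h x (D2 \<eta> x Y) (\<zeta> x) + h x (\<eta> x) (D2 \<zeta> x Y)"
      using chern_connectionD(2)[OF D1 that] chern_connectionD(2)[OF D2 that] by simp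
    then show ?thesis
      using in1 that A0_fibre by (simp add: \<delta>_def h.h_diff h.h_diff_right algebra_simps)
  qed
  have J: "\<delta> \<eta> (tJ X) = vscale V \<i> (\<delta> \<eta> X)" if \<eta>: "\<eta> \<in> A0 M V" for \<eta>
  proof -
    obtain U e where U: "(U, e) \<in> frames V" "x \<in> U" by (rule ex_frame)
    have "part01 V (D1 \<eta>) x X = part01 V (D2 \<eta>) x X"
      using chern_connectionD(3)[OF D1 \<eta> U X] chern_connectionD(3)[OF D2 \<eta> U X] by simp
    then have "D1 \<eta> x X + vscale V \<i> (D1 \<eta> x (tJ X)) = D2 \<eta> x X + vscale V \<i> (D2 \<eta> x (tJ X))"
      by (simp add: part01_def scale_left_imp_eq)
    then have "\<delta> \<eta> X + vscale V \<i> (\<delta> \<eta> (tJ X)) = 0"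
      by (simp add: \<delta>_def scale_right_diff_distrib algebra_simps)
    then have "vscale V \<i> (\<delta> \<eta> X + vscale V \<i> (\<delta> \<eta> (tJ X))) = 0" by simp
    then show ?thesis by (simp add: scale_right_distrib scale_minus_left)
  qed
  have "\<delta> \<xi> X = 0"
  proof (rule ccontr)
    assume nz: "\<delta> \<xi> X \<noteq> 0"
    \<comment> \<open>The two skewness relations show that \<open>\<delta> \<xi> X\<close> is orthogonal to the values of all global
      sections, in particular to itself.\<close>
    obtain \<eta> where \<eta>: "\<eta> \<in> A0 M V" "\<eta> x = \<delta> \<xi> X" by (rule extend_vector[OF \<delta>_in[OF \<xi> X]])
    note in2 = \<delta>_in[OF \<xi> X] \<delta>_in[OF \<eta>(1) X] A0_fibre[OF \<xi>, of x] A0_fibre[OF \<eta>(1), of x]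
    have "h x (\<delta> \<xi> X) (\<eta> x) + h x (\<xi> x) (\<delta> \<eta> X) = 0" by (rule skew[OF \<xi> \<eta>(1) X])
    moreover have "\<i> * h x (\<delta> \<xi> X) (\<eta> x) - \<i> * h x (\<xi> x) (\<delta> \<eta> X) = 0"
      using skew[OF \<xi> \<eta>(1) JX] in2 by (simp add: J[OF \<xi>] J[OF \<eta>(1)] h.h_scale h.h_scale_right)
    ultimately have "h x (\<delta> \<xi> X) (\<eta> x) = 0" by (simp add: right_diff_distrib[symmetric])
    then show False using h.h_definite[OF \<delta>_in[OF \<xi> X]] nz \<eta>(2) by simp
  qed
  then show ?thesis by (simp add: \<delta>_def)
qed

context hermitian_subbundle
begin

lemma hermitian_space_S: "hermitian_space (vscale E) (fibre S x) (h x)"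
proof -
  interpret hermitian_space "vscale E" "fibre E x" "h x" by (rule hermitian_space)
  show ?thesis
  proof (intro hermitian_space.intro hermitian_space_axioms.intro vector_space_axioms S.subspace_fibre)
    fix u v w a
    show "h x v u = cnj (h x u v)" if "u \<in> fibre S x" "v \<in> fibre S x" by (rule h_sym[OF S_sub S_sub]) fact+
    show "h x (u + v) w = h x u w + h x v w" if "u \<in> fibre S x" "v \<in> fibre S x" "w \<in> fibre S x"
      by (rule h_add[OF S_sub S_sub S_sub]) fact+
    show "h x (vscale E a u) v = a * h x u v" if "u \<in> fibre S x" "v \<in> fibre S x"
      by (rule h_scale[OF S_sub S_sub]) fact+
    show "0 < Re (h x v v)" if "v \<in> fibre S x" "v \<noteq> 0" by (rule h_pos[OF S_sub]) fact+
  qed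
qed

text \<open>The Dolbeault operator of \<open>E\<close> restricts to that of a holomorphic subbundle, as the
  members of a holomorphic frame of the subbundle have holomorphic components in \<open>E\<close>.\<close>

lemma dbar_in_frame_subbundle:
  assumes U: "(U, e) \<in> frames S" "x \<in> U" and U': "(U', f) \<in> frames E" "x \<in> U'"
    and e: "\<And>j. j < rank S \<Longrightarrow> section_on hol_on M E U (e j)" and \<xi>: "\<xi> \<in> A0 M S"
  shows "dbar_in_frame M E f \<xi> x X = dbar_in_frame M S e \<xi> x X"
proof -
  let ?a = "\<lambda>j y. component S e j y (\<xi> y)" and ?g = "\<lambda>j k y. component E f k y (e j y)"
  let ?W = "U' \<inter> U"
  have oW: "open ?W" using frame(1)[OF U'(1)] S.frame(1)[OF U(1)] by (rule open_Int)
  have xW: "x \<in> ?W" using U U' by simp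
  have a: "fun_on smooth_on M ?W (?a j)" if "j < rank S" for j
    unfolding fun_on_smooth_iff
  proof
    fix c assume "c \<in> M"
    then have "smooth_field c S UNIV \<xi>" using \<xi> S.A0_iff by blast
    from smooth_in_subset[OF smooth_field_component[OF this U(1) that]]
    show "smooth_in c ?W (?a j)" by auto
  qed
  have g: "fun_on hol_on M ?W (?g j k)" if "j < rank S" "k < rank E" for j k
    using e[OF that(1)] U'(1) that(2) unfolding section_on_def by blast
  have e_in: "e j y \<in> fibre E y" if "j < rank S" "y \<in> U" for j y
    using S.frame(4)[OF U(1) that(2,1)] S_sub by blast
  have eq: "component E f k y (\<xi> y) = (\<Sum>j<rank S. ?a j y * ?g j k y)" if "y \<in> ?W" "k < rank E" for k y
  proof -
    have y: "y \<in> U" "y \<in> U'" using that by auto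
    have "lincomb (vscale E) (rank E) (\<lambda>k. \<Sum>j<rank S. ?a j y * ?g j k y) (\<lambda>k. f k y)
        = (\<Sum>k<rank E. \<Sum>j<rank S. vscale E (?a j y) (vscale E (?g j k y) (f k y)))"
      by (simp add: lincomb_def scale_sum_left)
    also have "\<dots> = (\<Sum>j<rank S. \<Sum>k<rank E. vscale E (?a j y) (vscale E (?g j k y) (f k y)))"
      by (rule sum.swap)
    also have "\<dots> = (\<Sum>j<rank S. vscale E (?a j y) (lincomb (vscale E) (rank E) (\<lambda>k. ?g j k y) (\<lambda>k. f k y)))"
      by (simp add: lincomb_def scale_sum_right)
    also have "\<dots> = (\<Sum>j<rank S. vscale E (?a j y) (e j y))"
      using lincomb_component[OF U'(1) y(2)] e_in y by simp
    also have "\<dots> = \<xi> y"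
      using S.lincomb_component[OF U(1) y(1) S.A0_fibre[OF \<xi>]] by (simp add: lincomb_def)
    finally show ?thesis
      using component_lincomb[OF U'(1) y(2) that(2), of "\<lambda>k. \<Sum>j<rank S. ?a j y * ?g j k y"] by simp
  qed
  have d: "dbar M (\<lambda>y. component E f k y (\<xi> y)) x X = (\<Sum>j<rank S. dbar M (?a j) x X * ?g j k x)"
    if k: "k < rank E" for k
  proof -
    have sm: "fun_on smooth_on M ?W (\<lambda>y. \<Sum>j<rank S. ?a j y * ?g j k y)"
      using a g[OF _ k, THEN fun_on_hol_smooth] by (intro fun_on_sum_mult[OF oW])
    have "dbar M (\<lambda>y. component E f k y (\<xi> y)) x X = dbar M (\<lambda>y. \<Sum>j<rank S. ?a j y * ?g j k y) x X"
      by (rule dbar_cong[OF oW xW _ sm]) (simp add: eq[OF _ k])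
    also have "\<dots> = (\<Sum>j<rank S. dbar M (?a j) x X * ?g j k x)"
      using a g[OF _ k] by (rule dbar_sum_mult_hol[OF oW xW])
    finally show ?thesis .
  qed
  have "dbar_in_frame M E f \<xi> x X
      = (\<Sum>k<rank E. vscale E (\<Sum>j<rank S. dbar M (?a j) x X * ?g j k x) (f k x))"
    unfolding dbar_in_frame_def by (rule sum.cong) (simp_all add: d)
  also have "\<dots> = (\<Sum>k<rank E. \<Sum>j<rank S. vscale E (dbar M (?a j) x X) (vscale E (?g j k x) (f k x)))"
    by (simp add: scale_sum_left)
  also have "\<dots> = (\<Sum>j<rank S. \<Sum>k<rank E. vscale E (dbar M (?a j) x X) (vscale E (?g j k x) (f k x)))"
    by (rule sum.swap)
  also have "\<dots> = (\<Sum>j<rank S. vscale E (dbar M (?a j) x X)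
      (lincomb (vscale E) (rank E) (\<lambda>k. ?g j k x) (\<lambda>k. f k x)))"
    by (simp add: lincomb_def scale_sum_right)
  also have "\<dots> = (\<Sum>j<rank S. vscale E (dbar M (?a j) x X) (e j x))"
    using lincomb_component[OF U'] e_in U(2) by simp
  finally show ?thesis by (simp add: dbar_in_frame_def)
qed

text \<open>The component in \<open>S\<close> of the Chern connection of \<open>E\<close> is a Chern connection of \<open>S\<close>.\<close>

lemma chern_connection_PS:
  assumes D: "chern_connection M E h D"
    and hol: "\<And>U e j. (U, e) \<in> frames S \<Longrightarrow> j < rank S \<Longrightarrow> section_on hol_on M E U (e j)"
  shows "chern_connection M S h (\<lambda>\<xi> x X. PS x (D \<xi> x X))"
proof -
  note C = connectionD[OF chern_connectionD(1)[OF D] A0_S]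
  note DE = A1_E_fibre[OF C(1)]
  have conn: "connection M S (\<lambda>\<xi> x X. PS x (D \<xi> x X))"
    unfolding connection_def form_eq_def
  proof (intro conjI ballI allI impI)
    fix \<xi> assume \<xi>: "\<xi> \<in> A0 M S"
    show "(\<lambda>x X. PS x (D \<xi> x X)) \<in> A1 M S" by (rule A1_PS[OF C(1)[OF \<xi>]])
    fix x X assume X: "X \<in> tangent_space M x"
    show "PS x (D (\<lambda>x. \<xi> x + \<eta> x) x X) = PS x (D \<xi> x X) + PS x (D \<eta> x X)" if \<eta>: "\<eta> \<in> A0 M S" for \<eta>
      using C(2)[OF \<xi> A0_S[OF \<eta>] X] PS_add DE[OF \<xi> X] DE[OF \<eta> X] by simp
  next
    fix f \<xi> x X assume \<xi>: "\<xi> \<in> A0 M S" and f: "fun_on smooth_on M UNIV f" and X: "X \<in> tangent_space M x"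
    show "PS x (D (\<lambda>x. vscale S (f x) (\<xi> x)) x X)
        = vscale S (differential M f x X) (\<xi> x) + vscale S (f x) (PS x (D \<xi> x X))"
      using C(3)[OF \<xi> f X] S.A0_fibre[OF \<xi>, of x] S_sub[OF S.A0_fibre[OF \<xi>, of x]] DE[OF \<xi> X]
      by (simp add: PS_add PS_scale PS_id)
  qed
  have metric: "differential M (\<lambda>y. h y (\<xi> y) (\<eta> y)) x X
      = h x (PS x (D \<xi> x X)) (\<eta> x) + h x (\<xi> x) (PS x (D \<eta> x X))"
    if \<xi>: "\<xi> \<in> A0 M S" and \<eta>: "\<eta> \<in> A0 M S" and X: "X \<in> tangent_space M x" for \<xi> \<eta> x X
    using chern_connectionD(2)[OF D A0_S[OF \<xi>] A0_S[OF \<eta>] X]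
      h_PS(1)[OF DE[OF \<xi> X] S.A0_fibre[OF \<eta>]] h_PS(2)[OF DE[OF \<eta> X] S.A0_fibre[OF \<xi>]] by simp
  have dbar: "part01 S (\<lambda>x X. PS x (D \<xi> x X)) x X = dbar_in_frame M S e \<xi> x X"
    if \<xi>: "\<xi> \<in> A0 M S" and U: "(U, e) \<in> frames S" "x \<in> U" and X: "X \<in> tangent_space M x" for \<xi> U e x X
  proof -
    obtain U' f where U': "(U', f) \<in> frames E" "x \<in> U'" by (rule ex_frame)
    have "part01 E (D \<xi>) x X = dbar_in_frame M E f \<xi> x X"
      by (rule chern_connectionD(3)[OF D A0_S[OF \<xi>] U' X])
    also have "\<dots> = dbar_in_frame M S e \<xi> x X"
      by (rule dbar_in_frame_subbundle[OF U U' hol[OF U(1)] \<xi>])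
    finally have 1: "part01 E (D \<xi>) x X = dbar_in_frame M S e \<xi> x X" .
    have "dbar_in_frame M S e \<xi> x X \<in> fibre S x"
      unfolding dbar_in_frame_def using S.frame(4)[OF U]
      by (intro subspace_sum[OF S.subspace_fibre]) simp
    then have "PS x (part01 E (D \<xi>) x X) = dbar_in_frame M S e \<xi> x X" using 1 PS_id by simp
    moreover have "PS x (part01 E (D \<xi>) x X) = part01 S (\<lambda>x X. PS x (D \<xi> x X)) x X"
      using DE[OF \<xi> X] DE[OF \<xi> tJ_tangent[OF X]] by (simp add: part01_def PS_add PS_scale)
    ultimately show ?thesis by simp
  qed
  show ?thesis
    unfolding chern_connection_def using conn metric dbar by blast
qed

text \<open>The second fundamental form is tensorial: by compatibility with the metric,
  \<open>h(D \<xi>, \<eta>) = - h(\<xi>, D \<eta>)\<close> for sections \<open>\<eta>\<close> of the orthogonal complement.\<close>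

lemma Pperp_D_tensorial:
  assumes D: "chern_connection M E h D"
    and \<xi>: "\<xi> \<in> A0 M S" "\<xi>' \<in> A0 M S" "\<xi> x = \<xi>' x" and X: "X \<in> tangent_space M x"
  shows "Pperp x (D \<xi> x X) = Pperp x (D \<xi>' x X)"
proof -
  note DE = A1_E_fibre[OF connectionD(1)[OF chern_connectionD(1)[OF D] A0_S] X]
  interpret h: hermitian_space "vscale E" "fibre E x" "h x" by (rule hermitian_space)
  have "h x (Pperp x (D \<zeta> x X)) (\<eta> x) = - h x (\<zeta> x) (D \<eta> x X)"
    if \<zeta>: "\<zeta> \<in> A0 M S" and \<eta>: "\<eta> \<in> A0 M Sperp" for \<zeta> \<eta>
  proof -
    have "h y (\<zeta> y) (\<eta> y) = 0" for y
      using h_orth(2)[OF _ S.A0_fibre[OF \<zeta>]] Sperp.A0_fibre[OF \<eta>, of y] by simp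
    then have "0 = h x (D \<zeta> x X) (\<eta> x) + h x (\<zeta> x) (D \<eta> x X)"
      using chern_connectionD(2)[OF D A0_S[OF \<zeta>] A0_Sperp[OF \<eta>] X] differential_const[of 0 x X] by simp
    then show ?thesis
      using h_Pperp[OF DE[OF \<zeta>], of "\<eta> x"] Sperp.A0_fibre[OF \<eta>, of x] by (simp add: eq_neg_iff_add_eq_0)
  qed
  then have "h x (Pperp x (D \<xi> x X)) w = h x (Pperp x (D \<xi>' x X)) w" if "w \<in> fibre Sperp x" for w
    using Sperp.extend_vector[OF that] \<xi> by metis
  then show ?thesis
    using Pperp_in DE \<xi>(1,2) orth_sub
    by (intro h.eq_if_h_eq[OF subspace_orth_fibre, of x]) auto
qed

end

section \<open>The Higgs field and its hermitian conjugate\<close>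

lemma hom_formsD:
  assumes "\<alpha> \<in> hom_forms R M V W" "X \<in> tangent_space M x" "v \<in> fibre V x"
  shows "\<alpha> x X v \<in> fibre W x"
    "w \<in> fibre V x \<Longrightarrow> \<alpha> x X (v + w) = \<alpha> x X v + \<alpha> x X w"
    "\<alpha> x X (vscale V a v) = vscale W a (\<alpha> x X v)"
    "Y \<in> tangent_space M x \<Longrightarrow> \<alpha> x (tadd X Y) v = \<alpha> x X v + \<alpha> x Y v"
    "\<alpha> x (tscale r X) v = vscale W (complex_of_real r) (\<alpha> x X v)"
  using bspec[OF bspec[OF spec[OF conjunct1[OF CollectD[OF assms(1)[unfolded hom_forms_def]]]]
        assms(2)] assms(3)]
  by simp_all

text \<open>A 1-form \<open>\<Phi>\<close> with values in the endomorphisms of a hermitian bundle, with holomorphic matrix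
  entries in the given frames.\<close>

locale higgs_field = hermitian_bundle M E h
  for M :: "('m::t2_space, 'n::finite) atlas" and E :: "('m, 'v::ab_group_add) vbundle" and h +
  fixes \<Phi> :: "('m, 'n, 'v) hom_form"
  assumes \<Phi>: "\<Phi> \<in> hom_forms hol_on M E E"
begin

abbreviation "\<Phi>bar \<equiv> hermitian_conj E h \<Phi>"

text \<open>The adjoint exists on every invariant subspace \<open>G\<close> of a fibre; it is used both for the fibres of
  \<open>E\<close> and for those of a subbundle.\<close>

lemma adjoint_ex1:
  assumes G: "subspace G" "G \<subseteq> fibre E x" "basis_of (vscale E) r G b"
    and inv: "\<And>u. u \<in> G \<Longrightarrow> \<Phi> x X u \<in> G"
    and X: "X \<in> tangent_space M x" and v: "v \<in> fibre E x"
  shows "\<exists>!w. w \<in> G \<and> (\<forall>u\<in>G. h x w u = h x v (\<Phi> x X u))"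
proof -
  interpret h: hermitian_space "vscale E" "fibre E x" "h x" by (rule hermitian_space)
  note * = hom_formsD[OF \<Phi> X subsetD[OF G(2)]]
  show ?thesis
  proof (rule h.riesz[OF G(3,2)])
    show "h x v (\<Phi> x X (u + u')) = h x v (\<Phi> x X u) + h x v (\<Phi> x X u')" if "u \<in> G" "u' \<in> G" for u u'
      using *(2)[OF that(1), of u'] *(1)[OF that(1)] *(1)[OF that(2)] that G(2) v
      by (simp add: h.h_add_right subset_iff)
    show "h x v (\<Phi> x X (vscale E a u)) = cnj a * h x v (\<Phi> x X u)" if "u \<in> G" for a u
      using *(3)[OF that, of a] *(1)[OF that] v by (simp add: h.h_scale_right)
  qed
qed

lemma \<Phi>bar:
  assumes X: "X \<in> tangent_space M x" and v: "v \<in> fibre E x"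
  shows "\<Phi>bar x X v \<in> fibre E x" "u \<in> fibre E x \<Longrightarrow> h x (\<Phi>bar x X v) u = h x v (\<Phi> x X u)"
proof -
  obtain U e where U: "(U, e) \<in> frames E" "x \<in> U" by (rule ex_frame)
  have "\<exists>!w. w \<in> fibre E x \<and> (\<forall>u\<in>fibre E x. h x w u = h x v (\<Phi> x X u))"
    by (rule adjoint_ex1[OF subspace_fibre order_refl frame(2)[OF U] hom_formsD(1)[OF \<Phi> X] X v])
  from theI'[OF this]
  show "\<Phi>bar x X v \<in> fibre E x" "u \<in> fibre E x \<Longrightarrow> h x (\<Phi>bar x X v) u = h x v (\<Phi> x X u)"
    unfolding hermitian_conj_def by auto
qed

lemma \<Phi>bar_eqI:
  assumes X: "X \<in> tangent_space M x" and v: "v \<in> fibre E x" and w: "w \<in> fibre E x"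
    and "\<And>u. u \<in> fibre E x \<Longrightarrow> h x w u = h x v (\<Phi> x X u)"
  shows "\<Phi>bar x X v = w"
  using hermitian_space.eq_if_h_eq[OF hermitian_space subspace_fibre order_refl \<Phi>bar(1)[OF X v] w]
    \<Phi>bar(2)[OF X v] assms(4) by simp

lemma \<Phi>bar_linear:
  assumes X: "X \<in> tangent_space M x" and v: "v \<in> fibre E x"
  shows "w \<in> fibre E x \<Longrightarrow> \<Phi>bar x X (v + w) = \<Phi>bar x X v + \<Phi>bar x X w"
    "\<Phi>bar x X (vscale E a v) = vscale E a (\<Phi>bar x X v)"
    "Y \<in> tangent_space M x \<Longrightarrow> \<Phi>bar x (tadd X Y) v = \<Phi>bar x X v + \<Phi>bar x Y v"
    "\<Phi>bar x (tscale r X) v = vscale E (complex_of_real r) (\<Phi>bar x X v)"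
proof -
  interpret h: hermitian_space "vscale E" "fibre E x" "h x" by (rule hermitian_space)
  note P = hom_formsD[OF \<Phi>]
  show "\<Phi>bar x X (v + w) = \<Phi>bar x X v + \<Phi>bar x X w" if w: "w \<in> fibre E x"
    by (rule \<Phi>bar_eqI[OF X])
      (use \<Phi>bar[OF X v] \<Phi>bar[OF X w] P(1)[OF X] v w in \<open>simp_all add: h.h_add\<close>)
  show "\<Phi>bar x X (vscale E a v) = vscale E a (\<Phi>bar x X v)"
    by (rule \<Phi>bar_eqI[OF X])
      (use \<Phi>bar[OF X v] P(1)[OF X] v in \<open>simp_all add: h.h_scale\<close>)
  show "\<Phi>bar x (tadd X Y) v = \<Phi>bar x X v + \<Phi>bar x Y v"
    if Y: "Y \<in> tangent_space M x"
    by (rule \<Phi>bar_eqI[OF tadd_tangent[OF X Y] v])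
      (use \<Phi>bar[OF X v] \<Phi>bar[OF Y v] P(1)[OF X] P(1)[OF Y] P(4)[OF X _ Y] v in
        \<open>simp_all add: h.h_add h.h_add_right\<close>)
  show "\<Phi>bar x (tscale r X) v = vscale E (complex_of_real r) (\<Phi>bar x X v)"
    by (rule \<Phi>bar_eqI[OF tscale_tangent[OF X] v])
      (use \<Phi>bar[OF X v] P(1)[OF X] P(5)[OF X] v in \<open>simp_all add: h.h_scale h.h_scale_right\<close>)
qed

lemma smooth_field_\<Phi>:
  assumes c: "c \<in> M" and W: "open W" and s: "smooth_field c E W s"
  shows "smooth_field c E W (\<lambda>x. \<Phi> x (tvec M c x u) (s x))"
proof (rule smooth_field_local[OF c])
  fix x assume x: "x \<in> fst c" "x \<in> W"
  obtain U e where U: "(U, e) \<in> frames E" "x \<in> U" by (rule ex_frame)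
  have o: "open (U \<inter> W)" using frame(1)[OF U(1)] W by (rule open_Int)
  let ?P = "\<lambda>y. \<Phi> y (tvec M c y u)"
  have e: "smooth_field c E U (\<lambda>y. ?P y (e j y))" if j: "j < rank E" for j
  proof (rule smooth_fieldI)
    show "?P y (e j y) \<in> fibre E y" if "y \<in> fst c" "y \<in> U" for y
      using hom_formsD(1)[OF \<Phi> tvec_tangent[OF c that(1)]] frame(4)[OF U(1) that(2) j] by blast
    fix U' f k assume U': "(U', f) \<in> frames E" "k < rank E"
    have "\<forall>(U, e) \<in> frames E. \<forall>(U', f) \<in> frames E. \<forall>j<rank E. \<forall>k<rank E. \<forall>c\<in>M. \<forall>u.
        hol_on (snd c ` (fst c \<inter> U \<inter> U'))
          ((\<lambda>x. component E f k x (\<Phi> x (tvec M c x u) (e j x))) \<circ> chart_inv c)"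
      using \<Phi> unfolding hom_forms_def by blast
    then have "hol_on (snd c ` (fst c \<inter> U \<inter> U'))
          ((\<lambda>y. component E f k y (?P y (e j y))) \<circ> chart_inv c)"
      using U(1) U' j c by blast
    moreover have "fst c \<inter> U \<inter> U' = fst c \<inter> (U' \<inter> U)" by auto
    ultimately show "smooth_in c (U' \<inter> U) (\<lambda>y. component E f k y (?P y (e j y)))"
      by (simp add: hol_on_def smooth_in_def)
  qed
  have "smooth_field c E (U \<inter> W)
      (\<lambda>y. lincomb (vscale E) (rank E) (\<lambda>j. component E e j y (s y)) (\<lambda>j. ?P y (e j y)))"
    by (rule smooth_field_lincomb[OF c o smooth_field_component[OF s U(1)] smooth_field_subset[OF e]]) auto
  then have "smooth_field c E (U \<inter> W) (\<lambda>y. ?P y (s y))"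
  proof (rule smooth_field_cong[OF c o, rotated])
    fix y assume y: "y \<in> fst c" "y \<in> U \<inter> W"
    note T = tvec_tangent[OF c y(1), of u]
    have ey: "e j y \<in> fibre E y" if "j < rank E" for j using frame(4)[OF U(1) _ that] y by simp
    have "?P y (lincomb (vscale E) m a (\<lambda>j. e j y)) = lincomb (vscale E) m a (\<lambda>j. ?P y (e j y)) \<and>
        lincomb (vscale E) m a (\<lambda>j. e j y) \<in> fibre E y" if "m \<le> rank E" for m a
      using that
    proof (induction m)
      case 0
      show ?case using hom_formsD(3)[OF \<Phi> T fibre_closed(1), of 0] by (simp add: lincomb_def)
    next
      case (Suc m)
      then have "lincomb (vscale E) m a (\<lambda>j. e j y) \<in> fibre E y" "e m y \<in> fibre E y"
        using ey by simp_all
      then show ?case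
        using Suc hom_formsD(2)[OF \<Phi> T, of "lincomb (vscale E) m a (\<lambda>j. e j y)" "vscale E (a m) (e m y)"]
          hom_formsD(3)[OF \<Phi> T, of "e m y" "a m"] by (simp add: lincomb_def)
    qed
    from this[of "rank E" "\<lambda>j. component E e j y (s y)"]
    show "lincomb (vscale E) (rank E) (\<lambda>j. component E e j y (s y)) (\<lambda>j. ?P y (e j y)) = ?P y (s y)"
      using lincomb_component[OF U(1), of y "s y"] smooth_field_fibre[OF s] y by simp
  qed
  then show "\<exists>N. open N \<and> x \<in> N \<and> smooth_field c E N (\<lambda>y. ?P y (s y))" using o U x by blast
qed

end

section \<open>The second fundamental form of the Hitchin-Simpson connection\<close>

text \<open>A smooth subbundle \<open>S\<close> of \<open>E\<close> that is invariant under the Higgs field.\<close>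

locale higgs_subbundle_setting = hermitian_subbundle M E h S + higgs_field M E h \<Phi>
  for M :: "('m::t2_space, 'n::finite) atlas" and E S :: "('m, 'v::ab_group_add) vbundle"
    and h and \<Phi> +
  assumes \<Phi>_S: "X \<in> tangent_space M x \<Longrightarrow> v \<in> fibre S x \<Longrightarrow> \<Phi> x X v \<in> fibre S x"
begin

lemma hermitian_conj_S:
  assumes X: "X \<in> tangent_space M x" and v: "v \<in> fibre S x"
  shows "hermitian_conj S h \<Phi> x X v = PS x (\<Phi>bar x X v)"
proof -
  obtain b where b: "basis_of (vscale E) (rank S) (fibre S x) b" by (rule basis_S)
  have ex1: "\<exists>!w. w \<in> fibre S x \<and> (\<forall>u\<in>fibre S x. h x w u = h x v (\<Phi> x X u))"
    by (rule adjoint_ex1[OF S.subspace_fibre _ b _ X S_sub[OF v]]) (use S_sub \<Phi>_S[OF X] in auto)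
  show ?thesis
    unfolding hermitian_conj_def[of S]
  proof (rule the1_equality[OF ex1], intro conjI ballI)
    show "PS x (\<Phi>bar x X v) \<in> fibre S x" by (rule PS_in[OF \<Phi>bar(1)[OF X S_sub[OF v]]])
    show "h x (PS x (\<Phi>bar x X v)) u = h x v (\<Phi> x X u)" if "u \<in> fibre S x" for u
      using h_PS(1)[OF \<Phi>bar(1)[OF X S_sub[OF v]] that] \<Phi>bar(2)[OF X S_sub[OF v] S_sub[OF that]] by simp
  qed
qed

text \<open>The second fundamental form of the Hitchin-Simpson connection built from \<open>D\<close>, as a form with
  values in the homomorphisms. It is evaluated at a vector \<open>v\<close> in a fibre of \<open>S\<close> with the help of an
  arbitrary extension of \<open>v\<close> to a global section; the choice does not matter by tensoriality.\<close>

definition second_form :: "(('m, 'v) bsection \<Rightarrow> ('m, 'n, 'v) bform) \<Rightarrow> ('m, 'n, 'v) hom_form" where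
  "second_form D = (\<lambda>x X v. Pperp x (D (SOME \<xi>. \<xi> \<in> A0 M S \<and> \<xi> x = v) x X) + Pperp x (\<Phi>bar x X v))"

lemma second_form_section:
  assumes D: "chern_connection M E h D" and \<xi>: "\<xi> \<in> A0 M S" and X: "X \<in> tangent_space M x"
  shows "second_form D x X (\<xi> x) = Pperp x (D \<xi> x X) + Pperp x (\<Phi>bar x X (\<xi> x))"
proof -
  let ?\<eta> = "SOME \<eta>. \<eta> \<in> A0 M S \<and> \<eta> x = \<xi> x"
  have "?\<eta> \<in> A0 M S \<and> ?\<eta> x = \<xi> x" by (rule someI[of _ \<xi>]) (simp add: \<xi>)
  then show ?thesis using Pperp_D_tensorial[OF D _ \<xi> _ X] by (simp add: second_form_def)
qed

text \<open>The inner products of the adjoint term with a frame of the orthogonal complement are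
  \<open>h(s, \<Phi> f)\<close>, which are visibly smooth.\<close>

lemma smooth_field_Pperp_\<Phi>bar:
  assumes c: "c \<in> M" and W: "open W" and s: "smooth_field c E W s"
  shows "smooth_field c Sperp W (\<lambda>x. Pperp x (\<Phi>bar x (tvec M c x u) (s x)))"
proof (rule smooth_field_subbundleI[OF Sperp c W])
  show "Pperp x (\<Phi>bar x (tvec M c x u) (s x)) \<in> fibre Sperp x" if "x \<in> fst c" "x \<in> W" for x
    using Pperp_in[OF \<Phi>bar(1)[OF tvec_tangent[OF c that(1)] smooth_field_fibre[OF s that]]] by simp
  fix U f k assume U: "(U, f) \<in> frames Sperp" "k < rank Sperp"
  have o: "open (U \<inter> W)" using Sperp.frame(1)[OF U(1)] W by (rule open_Int)
  have f: "smooth_field c E (U \<inter> W) (f k)"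
    by (rule smooth_field_subset[OF smooth_subbundleD(5)[OF Sperp U(1) c U(2)]]) auto
  have "smooth_in c (U \<inter> W) (\<lambda>x. h x (s x) (\<Phi> x (tvec M c x u) (f k x)))"
    by (rule smooth_in_metric[OF c o smooth_field_subset[OF s] smooth_field_\<Phi>[OF c o f]]) auto
  then show "smooth_in c (U \<inter> W) (\<lambda>x. h x (Pperp x (\<Phi>bar x (tvec M c x u) (s x))) (f k x))"
  proof (rule smooth_in_cong[OF c o, rotated])
    fix x assume x: "x \<in> fst c" "x \<in> U \<inter> W"
    note T = tvec_tangent[OF c x(1), of u]
    have sx: "s x \<in> fibre E x" using smooth_field_fibre[OF s] x by blast
    have fx: "f k x \<in> orth_fibre E h S x" using Sperp.frame(4)[OF U(1) _ U(2), of x] x by simp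
    show "h x (s x) (\<Phi> x (tvec M c x u) (f k x)) = h x (Pperp x (\<Phi>bar x (tvec M c x u) (s x))) (f k x)"
      using h_Pperp[OF \<Phi>bar(1)[OF T sx] fx] \<Phi>bar(2)[OF T sx orth_sub[OF fx]] by simp
  qed
qed

text \<open>The second fundamental form is smooth: near a given point a member of a frame of \<open>S\<close>
  agrees with a global section.\<close>

lemma second_form_A1_Hom:
  assumes D: "chern_connection M E h D"
  shows "second_form D \<in> A1_Hom M S Sperp"
proof -
  note C = connectionD[OF chern_connectionD(1)[OF D] A0_S]
  note DE = A1_E_fibre[OF C(1)]
  have ext: "\<exists>\<xi>. \<xi> \<in> A0 M S \<and> \<xi> x = v" if "v \<in> fibre S x" for x v
    using S.extend_vector[OF that] by metis
  have pointwise: "second_form D x X v \<in> fibre Sperp x \<and>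
      (\<forall>w\<in>fibre S x. second_form D x X (v + w) = second_form D x X v + second_form D x X w) \<and>
      (\<forall>a. second_form D x X (vscale S a v) = vscale Sperp a (second_form D x X v)) \<and>
      (\<forall>Y\<in>tangent_space M x. second_form D x (tadd X Y) v = second_form D x X v + second_form D x Y v) \<and>
      (\<forall>r. second_form D x (tscale r X) v = vscale Sperp (complex_of_real r) (second_form D x X v))"
    if X: "X \<in> tangent_space M x" and v: "v \<in> fibre S x" for x X v
  proof (intro conjI ballI allI)
    obtain \<xi> where \<xi>: "\<xi> \<in> A0 M S" "\<xi> x = v" using ext[OF v] by blast
    note sf = second_form_section[OF D]
    note vE = S_sub[OF v]
    have X_lin: "D \<xi> x (tadd X Y) = D \<xi> x X + D \<xi> x Y" if "Y \<in> tangent_space M x" for Y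
      using C(1)[OF \<xi>(1)] X that unfolding A1_iff by blast
    have X_scale: "D \<xi> x (tscale r X) = vscale E (complex_of_real r) (D \<xi> x X)" for r
      using C(1)[OF \<xi>(1)] X unfolding A1_iff by blast
    have eq: "second_form D x Y v = Pperp x (D \<xi> x Y) + Pperp x (\<Phi>bar x Y v)"
      if "Y \<in> tangent_space M x" for Y
      using sf[OF \<xi>(1) that] \<xi>(2) by simp
    show "second_form D x X v \<in> fibre Sperp x"
      using Pperp_in[OF DE[OF \<xi>(1) X]] Pperp_in[OF \<Phi>bar(1)[OF X vE]] by (simp add: eq[OF X])
    show "second_form D x X (v + w) = second_form D x X v + second_form D x X w" if w: "w \<in> fibre S x" for w
    proof -
      obtain \<eta> where \<eta>: "\<eta> \<in> A0 M S" "\<eta> x = w" using ext[OF w] by blast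
      have "(\<lambda>x. \<xi> x + \<eta> x) \<in> A0 M S"
        using \<xi>(1) \<eta>(1) unfolding S.A0_iff by (blast intro: S.smooth_field_add)
      from sf[OF this X] show ?thesis
        using C(2)[OF \<xi>(1) A0_S[OF \<eta>(1)] X] DE[OF \<xi>(1) X] DE[OF \<eta>(1) X] eq[OF X] sf[OF \<eta>(1) X]
          \<Phi>bar_linear(1)[OF X vE S_sub[OF w]] \<Phi>bar(1)[OF X vE] \<Phi>bar(1)[OF X S_sub[OF w]] \<xi>(2) \<eta>(2)
        by (simp add: Pperp_add)
    qed
    show "second_form D x X (vscale S a v) = vscale Sperp a (second_form D x X v)" for a
    proof -
      have a: "fun_on smooth_on M UNIV (\<lambda>x. a)"
        unfolding fun_on_smooth_iff using smooth_in_const by blast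
      have "(\<lambda>x. vscale E a (\<xi> x)) \<in> A0 M S"
        using \<xi>(1) unfolding S.A0_iff using S.smooth_field_scale[OF _ _ smooth_in_const] by blast
      from sf[OF this X] show ?thesis
        using C(3)[OF \<xi>(1) a X] DE[OF \<xi>(1) X] eq[OF X] \<Phi>bar_linear(2)[OF X vE] \<Phi>bar(1)[OF X vE] \<xi>(2)
        by (simp add: Pperp_scale differential_const scale_right_distrib)
    qed
    show "second_form D x (tadd X Y) v = second_form D x X v + second_form D x Y v"
      if Y: "Y \<in> tangent_space M x" for Y
      using X_lin[OF Y] DE[OF \<xi>(1) X] DE[OF \<xi>(1) Y] \<Phi>bar_linear(3)[OF X vE Y] \<Phi>bar(1)[OF X vE]
        \<Phi>bar(1)[OF Y vE] by (simp add: eq[OF X] eq[OF Y] eq[OF tadd_tangent[OF X Y]] Pperp_add)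
    show "second_form D x (tscale r X) v = vscale Sperp (complex_of_real r) (second_form D x X v)" for r
      using X_scale DE[OF \<xi>(1) X] \<Phi>bar_linear(4)[OF X vE] \<Phi>bar(1)[OF X vE]
      by (simp add: eq[OF X] eq[OF tscale_tangent[OF X]] Pperp_scale scale_right_distrib)
  qed
  have smooth: "smooth_field c Sperp U (\<lambda>x. second_form D x (tvec M c x u) (e j x))"
    if U: "(U, e) \<in> frames S" and j: "j < rank S" and c: "c \<in> M" for U e j c u
  proof (rule Sperp.smooth_field_local[OF c])
    fix x0 assume x0: "x0 \<in> fst c" "x0 \<in> U"
    obtain \<xi> N where \<xi>: "\<xi> \<in> A0 M S" and N: "open N" "x0 \<in> N" "N \<subseteq> U" "\<And>x. x \<in> N \<Longrightarrow> \<xi> x = e j x"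
      using S.extend_section[OF S.frame(1)[OF U] x0(2), of "e j"] S.frame(3)[OF U _ j] by metis
    have "smooth_field c Sperp UNIV (\<lambda>x. Pperp x (D \<xi> x (tvec M c x u)))"
      by (rule spec[OF bspec[OF conjunct2[OF A1_Pperp[OF C(1)[OF \<xi>], unfolded A1_iff]] c]])
    then have 1: "smooth_field c Sperp N (\<lambda>x. Pperp x (D \<xi> x (tvec M c x u)))"
      by (rule Sperp.smooth_field_subset) simp
    have "smooth_field c E UNIV \<xi>" using A0_S[OF \<xi>] c A0_iff by blast
    from smooth_field_Pperp_\<Phi>bar[OF c N(1) smooth_field_subset[OF this]]
    have 2: "smooth_field c Sperp N (\<lambda>x. Pperp x (\<Phi>bar x (tvec M c x u) (\<xi> x)))" by simp
    have "smooth_field c Sperp N (\<lambda>x. second_form D x (tvec M c x u) (e j x))"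
    proof (rule Sperp.smooth_field_cong[OF c N(1) _ Sperp.smooth_field_add[OF c N(1) 1 2]])
      fix x assume x: "x \<in> fst c" "x \<in> N"
      show "Pperp x (D \<xi> x (tvec M c x u)) + Pperp x (\<Phi>bar x (tvec M c x u) (\<xi> x))
          = second_form D x (tvec M c x u) (e j x)"
        using second_form_section[OF D \<xi> tvec_tangent[OF c x(1)]] N(4)[OF x(2)] by simp
    qed
    then show "\<exists>N. open N \<and> x0 \<in> N \<and>
        smooth_field c Sperp N (\<lambda>x. second_form D x (tvec M c x u) (e j x))"
      using N by blast
  qed
  have entries: "smooth_on (snd c ` (fst c \<inter> U \<inter> U'))
      ((\<lambda>x. component Sperp f k x (second_form D x (tvec M c x u) (e j x))) \<circ> chart_inv c)"
    if "(U, e) \<in> frames S" "(U', f) \<in> frames Sperp" "j < rank S" "k < rank Sperp" "c \<in> M"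
    for U e U' f j k c u
  proof -
    have "smooth_in c (U' \<inter> U) (\<lambda>x. component Sperp f k x (second_form D x (tvec M c x u) (e j x)))"
      by (rule smooth_field_component[OF smooth[OF that(1,3,5)] that(2,4)])
    moreover have "fst c \<inter> U \<inter> U' = fst c \<inter> (U' \<inter> U)" by auto
    ultimately show ?thesis by (simp add: smooth_in_def)
  qed
  show ?thesis
    unfolding A1_Hom_def hom_forms_def
  proof (intro CollectI conjI)
    show "\<forall>(U, e)\<in>frames S. \<forall>(U', f)\<in>frames Sperp. \<forall>j<rank S. \<forall>k<rank Sperp. \<forall>c\<in>M. \<forall>u.
        smooth_on (snd c ` (fst c \<inter> U \<inter> U'))
          ((\<lambda>x. component Sperp f k x (second_form D x (tvec M c x u) (e j x))) \<circ> chart_inv c)"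
      by (intro ballI) (clarsimp simp only: split_paired_all split_conv, blast intro: entries)
  qed (intro allI ballI pointwise)
qed

lemma higgs_operator_PS:
  assumes \<xi>: "\<xi> \<in> A0 M S" and X: "X \<in> tangent_space M x"
  shows "higgs_operator S \<Phi> h (\<lambda>\<xi> x X. PS x (D \<xi> x X)) \<xi> x X
    = PS x (D \<xi> x X) + \<Phi> x X (\<xi> x) + PS x (\<Phi>bar x X (\<xi> x))"
  by (simp add: higgs_operator_def hermitian_conj_S[OF X S.A0_fibre[OF \<xi>]])

end

section \<open>The Hitchin-Simpson connection of a Higgs subbundle\<close>

lemma (in cmanifold) section_on_hol_smooth: "section_on hol_on M V W s \<Longrightarrow> section_on smooth_on M V W s"
  unfolding section_on_def using fun_on_hol_smooth by blast

lemma (in cmanifold) holomorphic_bundle_smooth: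
  assumes "holomorphic_vector_bundle M V"
  shows "smooth_vector_bundle M V"
  using assms unfolding vector_bundle_def using section_on_hol_smooth by blast

lemma (in hermitian_bundle) holomorphic_subbundle_smooth:
  assumes "holomorphic_subbundle M V E"
  shows "smooth_subbundle V"
proof -
  have V: "holomorphic_vector_bundle M V" "vscale V = vscale E" "\<forall>x. fibre V x \<subseteq> fibre E x"
    "\<forall>(U, e)\<in>frames V. \<forall>j<rank V. section_on hol_on M E U (e j)"
    using assms unfolding holomorphic_subbundle_def by blast+
  have "section_on smooth_on M E U (e j)" if "(U, e) \<in> frames V" "j < rank V" for U e j
    using V(4) that section_on_hol_smooth by blast
  then show ?thesis
    using V(1-3) unfolding smooth_subbundle_def vector_bundle_def by auto
qed

theorem proposition5:
  fixes M :: "('m::t2_space, 'n::finite) atlas"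
    and E S Sperp :: "('m, 'v::ab_group_add) vbundle"
    and \<Phi> :: "('m, 'n, 'v) hom_form"
    and h :: "'m \<Rightarrow> 'v \<Rightarrow> 'v \<Rightarrow> complex"
    and D\<^sub>h \<D>\<^sub>h D\<^sub>h\<^sub>S A\<^sub>h \<D>\<^sub>h\<^sub>S \<A>\<^sub>h :: "('m, 'v) bsection \<Rightarrow> ('m, 'n, 'v) bform"
    and \<Phi>bar :: "('m, 'n, 'v) hom_form"
    and PS Pperp :: "'m \<Rightarrow> 'v \<Rightarrow> 'v"
  assumes "compact_kaehler_manifold M"
    and "hermitian_higgs_bundle M E \<Phi> h"
    and "chern_connection M E h D\<^sub>h"
    and "higgs_subbundle M S E \<Phi>"
  defines "\<Phi>bar \<equiv> hermitian_conj E h \<Phi>"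
    and "\<D>\<^sub>h \<equiv> \<lambda>\<xi> x X. D\<^sub>h \<xi> x X + \<Phi> x X (\<xi> x) + \<Phi>bar x X (\<xi> x)"
    and "Sperp \<equiv> orth_complement M E h S"
    and "PS \<equiv> projection S Sperp"
    and "Pperp \<equiv> projection Sperp S"
    and "D\<^sub>h\<^sub>S \<equiv> \<lambda>\<xi> x X. PS x (D\<^sub>h \<xi> x X)"
    and "A\<^sub>h \<equiv> \<lambda>\<xi> x X. Pperp x (D\<^sub>h \<xi> x X)"
    and "\<D>\<^sub>h\<^sub>S \<equiv> \<lambda>\<xi> x X. D\<^sub>h\<^sub>S \<xi> x X + \<Phi> x X (\<xi> x) + PS x (\<Phi>bar x X (\<xi> x))"
    and "\<A>\<^sub>h \<equiv> \<lambda>\<xi> x X. A\<^sub>h \<xi> x X + Pperp x (\<Phi>bar x X (\<xi> x))"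
  shows "smooth_vector_bundle M Sperp
    \<and> (\<forall>\<xi>\<in>A0 M S. D\<^sub>h\<^sub>S \<xi> \<in> A1 M S \<and> A\<^sub>h \<xi> \<in> A1 M Sperp
          \<and> form_eq M (D\<^sub>h \<xi>) (\<lambda>x X. D\<^sub>h\<^sub>S \<xi> x X + A\<^sub>h \<xi> x X)
          \<and> form_eq M (\<D>\<^sub>h \<xi>) (\<lambda>x X. \<D>\<^sub>h\<^sub>S \<xi> x X + \<A>\<^sub>h \<xi> x X))
    \<and> hitchin_simpson_connection M S \<Phi> h \<D>\<^sub>h\<^sub>S
    \<and> (\<forall>\<D>. hitchin_simpson_connection M S \<Phi> h \<D> \<longrightarrow>
          (\<forall>\<xi>\<in>A0 M S. form_eq M (\<D>\<^sub>h\<^sub>S \<xi>) (\<D> \<xi>)))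
    \<and> (\<exists>\<alpha>\<in>A1_Hom M S Sperp. \<forall>\<xi>\<in>A0 M S. form_eq M (\<A>\<^sub>h \<xi>) (\<lambda>x X. \<alpha> x X (\<xi> x)))"
proof -
  interpret cmanifold M
    using assms(1) by unfold_locales (simp add: compact_kaehler_manifold_def)
  have E: "holomorphic_vector_bundle M E" and \<Phi>: "\<Phi> \<in> hom_forms hol_on M E E"
    and metric: "hermitian_metric M E h"
    using assms(2) unfolding hermitian_higgs_bundle_def higgs_bundle_def by blast+
  interpret hermitian_bundle M E h
    by unfold_locales (rule holomorphic_bundle_smooth[OF E], rule metric)
  have S: "holomorphic_subbundle M S E"
    and \<Phi>S: "\<forall>x. \<forall>X\<in>tangent_space M x. \<forall>v\<in>fibre S x. \<Phi> x X v \<in> fibre S x"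
    using assms(4) unfolding higgs_subbundle_def by blast+
  interpret H: higgs_subbundle_setting M E S h \<Phi>
    by unfold_locales (rule holomorphic_subbundle_smooth[OF S], rule \<Phi>, use \<Phi>S in blast)
  have hol: "section_on hol_on M E U (e j)" if "(U, e) \<in> frames S" "j < rank S" for U e j
    using S that unfolding holomorphic_subbundle_def by blast
  note D = assms(3)
  note C = connectionD[OF chern_connectionD(1)[OF D] H.A0_S]
  note DE = H.A1_E_fibre[OF C(1)]
  note defs = assms(5-)[unfolded atomize_eq]
  have chern: "chern_connection M S h (\<lambda>\<xi> x X. H.PS x (D\<^sub>h \<xi> x X))"
    by (rule H.chern_connection_PS[OF D]) (rule hol)
  have operator: "\<D>\<^sub>h\<^sub>S \<xi> x X = higgs_operator S \<Phi> h (\<lambda>\<xi> x X. H.PS x (D\<^sub>h \<xi> x X)) \<xi> x X"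
    if "\<xi> \<in> A0 M S" "X \<in> tangent_space M x" for \<xi> x X
    by (simp add: H.higgs_operator_PS[OF that] defs)
  have split: "D\<^sub>h \<xi> x X = D\<^sub>h\<^sub>S \<xi> x X + A\<^sub>h \<xi> x X" if "\<xi> \<in> A0 M S" "X \<in> tangent_space M x" for \<xi> x X
    using H.Pperp_eq[OF DE[OF that]] by (simp add: defs)
  have split': "\<D>\<^sub>h \<xi> x X = \<D>\<^sub>h\<^sub>S \<xi> x X + \<A>\<^sub>h \<xi> x X"
    if "\<xi> \<in> A0 M S" "X \<in> tangent_space M x" for \<xi> x X
    using H.Pperp_eq[OF DE[OF that]]
      H.Pperp_eq[OF H.\<Phi>bar(1)[OF that(2) H.S_sub[OF H.S.A0_fibre[OF that(1)]]]]
    by (simp add: defs)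
  have parts: "D\<^sub>h\<^sub>S \<xi> \<in> A1 M S" "A\<^sub>h \<xi> \<in> A1 M Sperp" if "\<xi> \<in> A0 M S" for \<xi>
    using H.A1_PS[OF C(1)[OF that]] H.A1_Pperp[OF C(1)[OF that]] by (simp_all add: defs)
  have smooth: "smooth_vector_bundle M Sperp"
    using H.Sperp.smooth_bundle by (simp add: defs)
  have hitchin_simpson: "hitchin_simpson_connection M S \<Phi> h \<D>\<^sub>h\<^sub>S"
    unfolding hitchin_simpson_connection_def form_eq_def using chern operator by blast
  have unique: "form_eq M (\<D>\<^sub>h\<^sub>S \<xi>) (\<D> \<xi>)"
    if hs: "hitchin_simpson_connection M S \<Phi> h \<D>" and \<xi>: "\<xi> \<in> A0 M S" for \<D> \<xi>
    unfolding form_eq_def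
  proof (intro allI ballI)
    fix x X assume X: "X \<in> tangent_space M x"
    obtain D where D: "chern_connection M S h D"
      and eq: "form_eq M (\<D> \<xi>) (higgs_operator S \<Phi> h D \<xi>)"
      using hs \<xi> unfolding hitchin_simpson_connection_def by blast
    have "H.PS x (D\<^sub>h \<xi> x X) = D \<xi> x X"
      using H.S.chern_connection_unique[OF chern D _ \<xi> X] H.hermitian_space_S by simp
    then have "\<D>\<^sub>h\<^sub>S \<xi> x X = higgs_operator S \<Phi> h D \<xi> x X"
      by (simp add: operator[OF \<xi> X] higgs_operator_def)
    then show "\<D>\<^sub>h\<^sub>S \<xi> x X = \<D> \<xi> x X" using eq X unfolding form_eq_def by simp
  qed
  have second: "\<exists>\<alpha>\<in>A1_Hom M S Sperp. \<forall>\<xi>\<in>A0 M S. form_eq M (\<A>\<^sub>h \<xi>) (\<lambda>x X. \<alpha> x X (\<xi> x))"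
  proof (intro bexI ballI)
    show "H.second_form D\<^sub>h \<in> A1_Hom M S Sperp"
      using H.second_form_A1_Hom[OF D] by (simp add: defs)
    show "form_eq M (\<A>\<^sub>h \<xi>) (\<lambda>x X. H.second_form D\<^sub>h x X (\<xi> x))" if "\<xi> \<in> A0 M S" for \<xi>
      unfolding form_eq_def using H.second_form_section[OF D that] by (simp add: defs)
  qed
  show ?thesis
  proof (intro conjI ballI allI impI)
    fix \<xi> assume \<xi>: "\<xi> \<in> A0 M S"
    show "form_eq M (D\<^sub>h \<xi>) (\<lambda>x X. D\<^sub>h\<^sub>S \<xi> x X + A\<^sub>h \<xi> x X)"
      unfolding form_eq_def by (intro allI ballI split \<xi>)
    show "form_eq M (\<D>\<^sub>h \<xi>) (\<lambda>x X. \<D>\<^sub>h\<^sub>S \<xi> x X + \<A>\<^sub>h \<xi> x X)"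
      unfolding form_eq_def by (intro allI ballI split' \<xi>)
  qed (fact smooth parts hitchin_simpson unique second)+
qed

end
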